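(* Let $n\ge1$, let $q\in\mathbb{C}$ be generic, and let $U_n$ be a standard Young tableau with $n$ boxes, with quantum contents $c_1,\dots,c_n$. Let $E_{U_n}\in H_n(q)$ be the corresponding primitive idempotent of the Hecke algebra. Let $c\in\mathbb{C}$ be a parameter with $c\,c_k^2\ne1$ for $k=1,\dots,n$. Define $$\widetilde{\Psi}_{U_n}(u_1,\dots,u_n):=\left(\prod_{k=1}^n\frac{u_k-c_k}{c\,u_kc_k-1}\,\frac{c\,u_k-1}{u_k-1}\right)\widetilde{Y}_1(u_1)\,\widetilde{Y}_2(u_1,u_2)\cdots\widetilde{Y}_n(u_1,\dots,u_n),$$ where $\widetilde{Y}_1(u_1)=1$ and, for $j\ge 2$, $$\widetilde{Y}_j(u_1,\dots,u_j):=\left(T_{j-1}+\frac{q-q^{-1}}{c\,u_{j-1}u_j-1}\right)\cdots\left(T_1+\frac{q-q^{-1}}{c\,u_1u_j-1}\right)\left(T_1+\frac{q-q^{-1}}{u_1/u_j-1}\right)^{-1}\cdots\left(T_{j-1}+\frac{q-q^{-1}}{u_{j-1}/u_j-1}\right)^{-1}$$ (in the first group the index of $T$ decreases from $j-1$ to $1$, in the second it increases from $1$ to $j-1$). Then the consecutive evaluation of this rational function at $u_1=c_1$, then $u_2=c_2$, and so on up to $u_n=c_n$ gives the idempotent: $$E_{U_n}=\Bigl.\bigl.\widetilde{\Psi}_{U_n}(u_1,\dots,u_n)\bigr|_{u_1=c_1}\cdots\Bigr|_{u_n=c_n}.$$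
   Context: $H_n(q)$ is the Hecke algebra: the unital associative $\mathbb{C}$-algebra generated by $T_1,\dots,T_{n-1}$ with relations $T_iT_{i+1}T_i=T_{i+1}T_iT_{i+1}$, $T_iT_j=T_jT_i$ for $|i-j|>1$, and $T_i-T_i^{-1}=q-q^{-1}$. The parameter $q$ is a nonzero complex number assumed generic; in particular $q-q^{-1}\neq0$, the algebras $H_k(q)$, $k\le n$, are semisimple with irreducible representations labelled by partitions of $k$ (Bratteli diagram the Young graph), and standard tableaux are determined by their content sequences. A standard Young tableau $U_n$ is viewed as a sequence of Young diagrams $\Lambda_1,\dots,\Lambda_n$ with $\Lambda_1$ a single box and $\Lambda_j$ obtained from $\Lambda_{j-1}$ by adding one box; the quantum content $c_j$ is $q^{2(b-a)}$ if the box added at step $j$ is in row $a$ and column $b$ (so $c_1=1$). The Jucys--Murphy elements are $y_1=1$, $y_{k+1}=T_k\cdots T_2T_1^2T_2\cdots T_k$. The irreducible representation of $H_n(q)$ labelled by $\lambda$ has a basis $\{v_{U_n}\}$ indexed by standard tableaux of shape $\lambda$ with $y_jv_{U_n}=c_jv_{U_n}$ for $j=1,\dots,n$. $E_{U_n}\in H_n(q)$ is the primitive idempotent acting in this representation as the projector onto $\mathbb{C}v_{U_n}$ along the span of the other basis vectors, and annihilating all other irreducible representations. Each evaluation is that of a rational function in the remaining variables with values in $H_n(q)$. *)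

theory Defs
  imports
    Complex_Main
    "HOL-Library.Poly_Mapping"
    "HOL-Algebra.QuotRing"
    "Jordan_Normal_Form.Matrix"
    "Jordan_Normal_Form.VS_Connect"
begin

section \<open>The Hecke algebra by generators and relations\<close>

text \<open>
  Words in the letters \<open>i :: nat\<close> form the free monoid, written additively so that finitely supported
  functions \<open>gen_word \<Rightarrow>\<^sub>0 complex\<close> with the convolution product of
  \<^theory>\<open>HOL-Library.Poly_Mapping\<close> are noncommutative polynomials.
\<close>

datatype gen_word = Word (letters: "nat list")

instantiation gen_word :: monoid_add
begin

definition zero_gen_word :: gen_word where
  "zero_gen_word = Word []"

definition plus_gen_word :: "gen_word \<Rightarrow> gen_word \<Rightarrow> gen_word" where
  "plus_gen_word v w = Word (letters v @ letters w)"

instance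
  by standard (simp_all add: zero_gen_word_def plus_gen_word_def)

end

type_synonym nc_poly = "gen_word \<Rightarrow>\<^sub>0 complex"

definition free_algebra :: "nat \<Rightarrow> nc_poly ring" where
  "free_algebra n =
    \<lparr> carrier = {f. \<forall>w \<in> Poly_Mapping.keys f. set (letters w) \<subseteq> {1..<n}},
      mult = (*), one = 1, zero = 0, add = (+) \<rparr>"

definition free_scalar :: "complex \<Rightarrow> nc_poly" where
  "free_scalar a = Poly_Mapping.single 0 a"

definition free_gen :: "nat \<Rightarrow> nc_poly" where
  "free_gen i = Poly_Mapping.single (Word [i]) 1"

text \<open>
  The relation \<open>T - T\<inverse> = q - q\<inverse>\<close> (with \<open>T\<close> invertible) is multiplied by \<open>T\<close>: the quadratic relation
  makes \<open>T - (q - q\<inverse>)\<close> the inverse of \<open>T\<close>.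
\<close>

definition hecke_relations :: "nat \<Rightarrow> complex \<Rightarrow> nc_poly set" where
  "hecke_relations n q =
     {free_gen i * free_gen (i+1) * free_gen i - free_gen (i+1) * free_gen i * free_gen (i+1) | i.
        i \<in> {1..<n} \<and> i + 1 \<in> {1..<n}}
   \<union> {free_gen i * free_gen j - free_gen j * free_gen i | i j.
        i \<in> {1..<n} \<and> j \<in> {1..<n} \<and> \<bar>int i - int j\<bar> > 1}
   \<union> {free_gen i * free_gen i - free_scalar (q - inverse q) * free_gen i - 1 | i.
        i \<in> {1..<n}}"

definition hecke_ideal :: "nat \<Rightarrow> complex \<Rightarrow> nc_poly set" where
  "hecke_ideal n q = Idl\<^bsub>free_algebra n\<^esub> (hecke_relations n q)"

definition hecke :: "nat \<Rightarrow> complex \<Rightarrow> nc_poly set ring" where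
  "hecke n q = free_algebra n Quot hecke_ideal n q"

definition hecke_scalar :: "nat \<Rightarrow> complex \<Rightarrow> complex \<Rightarrow> nc_poly set" where
  "hecke_scalar n q a = hecke_ideal n q +>\<^bsub>free_algebra n\<^esub> free_scalar a"

definition hecke_T :: "nat \<Rightarrow> complex \<Rightarrow> nat \<Rightarrow> nc_poly set" where
  "hecke_T n q i = hecke_ideal n q +>\<^bsub>free_algebra n\<^esub> free_gen i"

definition hecke_prod :: "nat \<Rightarrow> complex \<Rightarrow> nc_poly set list \<Rightarrow> nc_poly set" where
  "hecke_prod n q xs = foldr (\<lambda>x y. x \<otimes>\<^bsub>hecke n q\<^esub> y) xs \<one>\<^bsub>hecke n q\<^esub>"

lemma keys_times_gen_word:
  fixes f g :: nc_poly
  assumes "w \<in> Poly_Mapping.keys (f * g)"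
  obtains u v where "u \<in> Poly_Mapping.keys f" "v \<in> Poly_Mapping.keys g"
    "letters w = letters u @ letters v"
  using assms keys_mult[of f g] by (fastforce simp: plus_gen_word_def)

lemma ring_free_algebra: "ring (free_algebra n)"
proof (rule ringI)
  show "abelian_group (free_algebra n)"
  proof (rule abelian_groupI)
    fix x assume "x \<in> carrier (free_algebra n)"
    then show "\<exists>y\<in>carrier (free_algebra n). y \<oplus>\<^bsub>free_algebra n\<^esub> x = \<zero>\<^bsub>free_algebra n\<^esub>"
      by (intro bexI[of _ "- x"]) (simp_all add: free_algebra_def)
  qed (use Poly_Mapping.keys_add in \<open>fastforce simp: free_algebra_def add_ac\<close>)+
  show "Group.monoid (free_algebra n)"
  proof (rule monoidI)
    fix x y assume "x \<in> carrier (free_algebra n)" "y \<in> carrier (free_algebra n)"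
    then show "x \<otimes>\<^bsub>free_algebra n\<^esub> y \<in> carrier (free_algebra n)"
      by (fastforce simp: free_algebra_def elim!: keys_times_gen_word)
  qed (auto simp: free_algebra_def zero_gen_word_def mult.assoc)
qed (auto simp: free_algebra_def distrib_left distrib_right)

lemma hecke_relations_carrier: "hecke_relations n q \<subseteq> carrier (free_algebra n)"
proof -
  interpret R: ring "free_algebra n" by (rule ring_free_algebra)
  have gen: "free_gen i \<in> carrier (free_algebra n)" if "i \<in> {1..<n}" for i
    using that by (auto simp: free_algebra_def free_gen_def split: if_splits)
  have scal: "free_scalar a \<in> carrier (free_algebra n)" for a
    by (auto simp: free_algebra_def free_scalar_def zero_gen_word_def split: if_splits)
  have one: "1 \<in> carrier (free_algebra n)"
    using R.one_closed by (simp add: free_algebra_def)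
  have mult: "x * y \<in> carrier (free_algebra n)"
    if "x \<in> carrier (free_algebra n)" "y \<in> carrier (free_algebra n)" for x y
    using R.m_closed[OF that] by (simp add: free_algebra_def)
  have minus: "x - y \<in> carrier (free_algebra n)"
    if "x \<in> carrier (free_algebra n)" "y \<in> carrier (free_algebra n)" for x y
    using that keys_diff[of x y] by (fastforce simp: free_algebra_def)
  show ?thesis
    unfolding hecke_relations_def by (auto intro!: minus mult gen scal one)
qed

lemma ideal_hecke_ideal: "ideal (hecke_ideal n q) (free_algebra n)"
  unfolding hecke_ideal_def
  using ring_free_algebra hecke_relations_carrier by (rule ring.genideal_ideal)

lemma ring_hecke: "ring (hecke n q)"
  unfolding hecke_def using ideal_hecke_ideal by (rule ideal.quotient_is_ring)


section \<open>Genericity\<close>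

text \<open>
  Since \<open>k = 1\<close> gives \<open>q - q\<inverse> \<noteq> 0\<close>, the condition says that the quantum integers
  \<open>(q^k - q^(-k)) / (q - q\<inverse>)\<close>, \<open>k \<le> n\<close>, do not vanish. This is the classical criterion under which
  the algebras \<open>H\<^sub>k(q)\<close>, \<open>k \<le> n\<close>, are semisimple with irreducibles labelled by the partitions of \<open>k\<close>;
  it also makes content sequences separate standard tableaux.
\<close>

definition generic_parameter :: "nat \<Rightarrow> complex \<Rightarrow> bool" where
  "generic_parameter n q \<longleftrightarrow> q \<noteq> 0 \<and> (\<forall>k \<in> {1..n}. q ^ (2 * k) \<noteq> 1)"


section \<open>Standard Young tableaux and contents\<close>

text \<open>Boxes are pairs (row, column), counted from 1.\<close>

definition young_diagram :: "(nat \<times> nat) set \<Rightarrow> bool" where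
  "young_diagram D \<longleftrightarrow> finite D \<and>
     (\<forall>(a, b) \<in> D. 1 \<le> a \<and> 1 \<le> b \<and> {1..a} \<times> {1..b} \<subseteq> D)"

text \<open>The list entry \<open>U ! (j - 1)\<close> is the diagram \<open>\<Lambda>\<^sub>j\<close>.\<close>

type_synonym tableau = "(nat \<times> nat) set list"

definition standard_tableau :: "nat \<Rightarrow> tableau \<Rightarrow> bool" where
  "standard_tableau n U \<longleftrightarrow> length U = n \<and> (\<forall>D \<in> set U. young_diagram D) \<and>
     (n \<ge> 1 \<longrightarrow> U ! 0 = {(1, 1)}) \<and>
     (\<forall>j. j + 1 < n \<longrightarrow> (\<exists>x. x \<notin> U ! j \<and> U ! (j + 1) = insert x (U ! j)))"

definition tableaux_of_shape :: "nat \<Rightarrow> (nat \<times> nat) set \<Rightarrow> tableau set" where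
  "tableaux_of_shape n D = {U. standard_tableau n U \<and> last U = D}"

definition added_box :: "tableau \<Rightarrow> nat \<Rightarrow> nat \<times> nat" where
  "added_box U j = (THE x. x \<in> U ! (j - 1) \<and> (j \<ge> 2 \<longrightarrow> x \<notin> U ! (j - 2)))"

definition q_content :: "complex \<Rightarrow> tableau \<Rightarrow> nat \<Rightarrow> complex" where
  "q_content q U j = (case added_box U j of (a, b) \<Rightarrow> q powi (2 * (int b - int a)))"


section \<open>Representations and the idempotent of a tableau\<close>

definition jucys_murphy :: "nat \<Rightarrow> complex \<Rightarrow> nat \<Rightarrow> nc_poly set" where
  "jucys_murphy n q j = hecke_prod n q (map (hecke_T n q) (rev [1..<j] @ [1..<j]))"

definition hecke_rep :: "nat \<Rightarrow> complex \<Rightarrow> nat \<Rightarrow> (nc_poly set \<Rightarrow> complex mat) \<Rightarrow> bool" where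
  "hecke_rep n q d \<rho> \<longleftrightarrow>
     \<rho> \<in> Ring.ring_hom (hecke n q) (ring_mat TYPE(complex) d ()) \<and>
     (\<forall>a. \<rho> (hecke_scalar n q a) = a \<cdot>\<^sub>m 1\<^sub>m d)"

definition irreducible_rep :: "nat \<Rightarrow> complex \<Rightarrow> nat \<Rightarrow> (nc_poly set \<Rightarrow> complex mat) \<Rightarrow> bool" where
  "irreducible_rep n q d \<rho> \<longleftrightarrow> hecke_rep n q d \<rho> \<and> d > 0 \<and>
     (\<forall>W. VectorSpace.subspace class_ring W (module_vec TYPE(complex) d) \<and>
          (\<forall>h \<in> carrier (hecke n q). \<forall>w \<in> W. \<rho> h *\<^sub>v w \<in> W)
        \<longrightarrow> W = {0\<^sub>v d} \<or> W = carrier_vec d)"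

definition young_basis ::
  "nat \<Rightarrow> complex \<Rightarrow> (nat \<times> nat) set \<Rightarrow> nat \<Rightarrow> (nc_poly set \<Rightarrow> complex mat) \<Rightarrow> (tableau \<Rightarrow> complex vec) \<Rightarrow> bool" where
  "young_basis n q D d \<rho> v \<longleftrightarrow>
     inj_on v (tableaux_of_shape n D) \<and>
     vectorspace.basis class_ring (module_vec TYPE(complex) d) (v ` tableaux_of_shape n D) \<and>
     (\<forall>U \<in> tableaux_of_shape n D. \<forall>j \<in> {1..n}.
        \<rho> (jucys_murphy n q j) *\<^sub>v v U = q_content q U j \<cdot>\<^sub>v v U)"

text \<open>The irreducible representation labelled by a diagram is the one having a Young basis for it.\<close>

definition labelled_rep ::
  "nat \<Rightarrow> complex \<Rightarrow> (nat \<times> nat) set \<Rightarrow> nat \<Rightarrow> (nc_poly set \<Rightarrow> complex mat) \<Rightarrow> bool" where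
  "labelled_rep n q D d \<rho> \<longleftrightarrow> irreducible_rep n q d \<rho> \<and> (\<exists>v. young_basis n q D d \<rho> v)"

text \<open>
  By semisimplicity an element is determined by its action on all irreducible representations
  (which are finite-dimensional, hence given by matrices); that the element is a primitive idempotent
  is a consequence of the description.
\<close>

definition is_tableau_idempotent :: "nat \<Rightarrow> complex \<Rightarrow> tableau \<Rightarrow> nc_poly set \<Rightarrow> bool" where
  "is_tableau_idempotent n q U e \<longleftrightarrow> e \<in> carrier (hecke n q) \<and>
     (\<forall>d \<rho> v. irreducible_rep n q d \<rho> \<and> young_basis n q (last U) d \<rho> v \<longrightarrow>
        (\<forall>V \<in> tableaux_of_shape n (last U). \<rho> e *\<^sub>v v V = (if V = U then v V else 0\<^sub>v d))) \<and>
     (\<forall>d \<rho>. irreducible_rep n q d \<rho> \<and> \<not> labelled_rep n q (last U) d \<rho> \<longrightarrow> \<rho> e = 0\<^sub>m d d)"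

definition tableau_idempotent :: "nat \<Rightarrow> complex \<Rightarrow> tableau \<Rightarrow> nc_poly set" where
  "tableau_idempotent n q U = (THE e. is_tableau_idempotent n q U e)"


section \<open>Rational functions with values in the Hecke algebra\<close>

text \<open>
  The point \<open>u :: nat \<Rightarrow> complex\<close> has coordinates \<open>u 1, \<dots>, u n\<close>. As the field is infinite, polynomials in
  these variables are polynomial functions, and a rational function is determined by its values off
  the zero set of a nonzero polynomial.
\<close>

inductive_set poly_functions :: "nat \<Rightarrow> ((nat \<Rightarrow> complex) \<Rightarrow> complex) set" for n where
  const: "(\<lambda>u. a) \<in> poly_functions n"
| var: "i \<in> {1..n} \<Longrightarrow> (\<lambda>u. u i) \<in> poly_functions n"
| add: "p \<in> poly_functions n \<Longrightarrow> r \<in> poly_functions n \<Longrightarrow> (\<lambda>u. p u + r u) \<in> poly_functions n"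
| mult: "p \<in> poly_functions n \<Longrightarrow> r \<in> poly_functions n \<Longrightarrow> (\<lambda>u. p u * r u) \<in> poly_functions n"

inductive_set hecke_poly_functions :: "nat \<Rightarrow> complex \<Rightarrow> ((nat \<Rightarrow> complex) \<Rightarrow> nc_poly set) set" for n q where
  monom: "p \<in> poly_functions n \<Longrightarrow> h \<in> carrier (hecke n q) \<Longrightarrow>
    (\<lambda>u. hecke_scalar n q (p u) \<otimes>\<^bsub>hecke n q\<^esub> h) \<in> hecke_poly_functions n q"
| add: "f \<in> hecke_poly_functions n q \<Longrightarrow> g \<in> hecke_poly_functions n q \<Longrightarrow>
    (\<lambda>u. f u \<oplus>\<^bsub>hecke n q\<^esub> g u) \<in> hecke_poly_functions n q"

definition generically :: "nat \<Rightarrow> ((nat \<Rightarrow> complex) \<Rightarrow> bool) \<Rightarrow> bool" where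
  "generically n P \<longleftrightarrow>
     (\<exists>p \<in> poly_functions n. (\<exists>u. p u \<noteq> 0) \<and> (\<forall>u. p u \<noteq> 0 \<longrightarrow> P u))"

definition quotient_value ::
  "nat \<Rightarrow> complex \<Rightarrow> ((nat \<Rightarrow> complex) \<Rightarrow> nc_poly set) \<Rightarrow> ((nat \<Rightarrow> complex) \<Rightarrow> complex) \<Rightarrow> (nat \<Rightarrow> complex) \<Rightarrow> nc_poly set" where
  "quotient_value n q N p u = hecke_scalar n q (inverse (p u)) \<otimes>\<^bsub>hecke n q\<^esub> N u"

text \<open>
  \<open>F\<close> is a rational function \<open>N / p\<close> whose denominator does not vanish identically at \<open>u k = a\<close>, and \<open>G\<close> is
  the rational function in the remaining variables obtained by substituting \<open>u k = a\<close> in \<open>N / p\<close>. Here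
  \<open>F\<close> and \<open>G\<close> matter only up to generic equality, so that the values which division by zero or the
  inverse of a non-unit happen to have in HOL play no role.
\<close>

definition evaluates_at ::
  "nat \<Rightarrow> complex \<Rightarrow> nat \<Rightarrow> complex \<Rightarrow> ((nat \<Rightarrow> complex) \<Rightarrow> nc_poly set) \<Rightarrow> ((nat \<Rightarrow> complex) \<Rightarrow> nc_poly set) \<Rightarrow> bool" where
  "evaluates_at n q k a F G \<longleftrightarrow>
     (\<exists>N \<in> hecke_poly_functions n q. \<exists>p \<in> poly_functions n.
        (\<exists>u. p (u(k := a)) \<noteq> 0) \<and>
        generically n (\<lambda>u. F u = quotient_value n q N p u) \<and>
        generically n (\<lambda>u. G u = quotient_value n q N p (u(k := a))))"

definition consecutive_evaluation ::
  "nat \<Rightarrow> complex \<Rightarrow> (nat \<Rightarrow> complex) \<Rightarrow> ((nat \<Rightarrow> complex) \<Rightarrow> nc_poly set) \<Rightarrow> nc_poly set \<Rightarrow> bool" where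
  "consecutive_evaluation n q a F x \<longleftrightarrow>
     (\<exists>G. G 0 = F \<and> (\<forall>k \<in> {1..n}. evaluates_at n q k (a k) (G (k - 1)) (G k)) \<and> G n = (\<lambda>u. x))"


section \<open>The fusion function\<close>

definition baxterized :: "nat \<Rightarrow> complex \<Rightarrow> nat \<Rightarrow> complex \<Rightarrow> nc_poly set" where
  "baxterized n q i x = hecke_T n q i \<oplus>\<^bsub>hecke n q\<^esub> hecke_scalar n q ((q - inverse q) / (x - 1))"

definition fusion_Y :: "nat \<Rightarrow> complex \<Rightarrow> complex \<Rightarrow> nat \<Rightarrow> (nat \<Rightarrow> complex) \<Rightarrow> nc_poly set" where
  "fusion_Y n q c j u = hecke_prod n q
     (map (\<lambda>i. baxterized n q i (c * u i * u j)) (rev [1..<j]) @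
      map (\<lambda>i. inv\<^bsub>hecke n q\<^esub> (baxterized n q i (u i / u j))) [1..<j])"

definition fusion_Psi :: "nat \<Rightarrow> complex \<Rightarrow> complex \<Rightarrow> tableau \<Rightarrow> (nat \<Rightarrow> complex) \<Rightarrow> nc_poly set" where
  "fusion_Psi n q c U u =
     hecke_scalar n q (\<Prod>k = 1..n. (u k - q_content q U k) / (c * u k * q_content q U k - 1) *
                                  ((c * u k - 1) / (u k - 1)))
     \<otimes>\<^bsub>hecke n q\<^esub> hecke_prod n q (map (\<lambda>j. fusion_Y n q c j u) [1..<n + 1])"

end

(*
  Following Okounkov and Vershik: a joint eigenvector of the Jucys-Murphy elements whose eigenvalues are the
  contents of a tableau can only be extended to the next Jucys-Murphy element by the contents of addable boxes.
  Hence products of Lagrange polynomials in the Jucys-Murphy elements are idempotents E_U of sum 1, and the left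
  ideal of E_U has a basis of eigenvectors, indexed by the tableaux of the shape of U, obtained from E_U by
  Baxterized generators. An irreducible representation on which E_U does not vanish is therefore the one
  labelled by the shape of U; conversely these left ideals are irreducible, so an element acting by zero in all
  irreducible representations kills every E_U and vanishes.

  For the fusion formula let V be U without its last box. By induction on n,
    E_V Y_n(c_1, ..., c_{n-1}, u) = E_V (u - 1) / (c u - 1) * (c u y_n - 1) / (u - y_n),
  where y_n acts on the summands E_{V + box} of E_V by the contents of the boxes. The prefactor cancels
  the pole of the summand E_U at u = c_n, and kills the other summands.
*)

theory Submission
  imports Defs "HOL-Computational_Algebra.Polynomial"
begin

section \<open>Words of row indices\<close>

text \<open>Up to the fusion formula everything takes place in the algebra acting on itself by left
  multiplication: an eigenvector is an element w, and an eigenvalue sequence is impossible if it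
  forces w = 0. The induction on tableaux carries an annihilating polynomial with simple roots, not
  just a list of eigenvalues, because simple roots rule out Jordan blocks. From V to V with a box of
  content \<alpha> the intertwiner yields too many roots, namely the exits of V together with
  \<alpha> + 1 and \<alpha> - 1. A surplus root leads either to two equal neighbouring eigenvalues
  or, after V is rearranged, to a pattern b, a, b with a and b at distance 1; both force w = 0.

  In the fusion formula, Y_n is the corresponding product for n - 1, with the same last variable,
  enclosed between one generator and one inverse generator. Hence the induction is on the prefix of
  the word, with the last variable kept free. The order of evaluation matters: the E_V produced by
  the earlier evaluations reduces the poles of the next factor to the simple ones of 1 / (u -
  y_n).\<close>

text \<open>
  A standard tableau is encoded by the word of the (zero-based) rows of its successive boxes; a shape
  is the function giving the length of each row.
\<close>

definition addable :: "(nat \<Rightarrow> nat) \<Rightarrow> nat \<Rightarrow> bool" where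
  "addable f a \<longleftrightarrow> a = 0 \<or> f a < f (a - 1)"

definition add_box :: "(nat \<Rightarrow> nat) \<Rightarrow> nat \<Rightarrow> (nat \<Rightarrow> nat)" where
  "add_box f a = f(a := Suc (f a))"

definition box_content :: "(nat \<Rightarrow> nat) \<Rightarrow> nat \<Rightarrow> int" where
  "box_content f a = int (f a) - int a"

fun lattice_from :: "(nat \<Rightarrow> nat) \<Rightarrow> nat list \<Rightarrow> bool" where
  "lattice_from f [] \<longleftrightarrow> True"
| "lattice_from f (a # v) \<longleftrightarrow> addable f a \<and> lattice_from (add_box f a) v"

fun contents_from :: "(nat \<Rightarrow> nat) \<Rightarrow> nat list \<Rightarrow> int list" where
  "contents_from f [] = []"
| "contents_from f (a # v) = box_content f a # contents_from (add_box f a) v"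

definition shape :: "nat list \<Rightarrow> nat \<Rightarrow> nat" where
  "shape = count_list"

abbreviation lattice :: "nat list \<Rightarrow> bool" where
  "lattice \<equiv> lattice_from (\<lambda>_. 0)"

abbreviation contents :: "nat list \<Rightarrow> int list" where
  "contents \<equiv> contents_from (\<lambda>_. 0)"

lemma add_box_commute: "add_box (add_box f a) b = add_box (add_box f b) a"
  by (auto simp: add_box_def fun_eq_iff)

lemma shape_simps [simp]: "shape [] = (\<lambda>_. 0)" "shape (ws @ [a]) = add_box (shape ws) a"
  by (auto simp: shape_def add_box_def fun_eq_iff)

lemma foldl_add_box: "foldl add_box f v = (\<lambda>a. f a + count_list v a)"
  by (induction v arbitrary: f) (auto simp: add_box_def fun_eq_iff)

lemma foldl_add_box_0: "foldl add_box (\<lambda>_. 0) v = shape v"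
  by (simp add: foldl_add_box shape_def)

lemma lattice_from_append:
  "lattice_from f (u @ v) \<longleftrightarrow> lattice_from f u \<and> lattice_from (foldl add_box f u) v"
  by (induction u arbitrary: f) auto

lemma contents_from_append:
  "contents_from f (u @ v) = contents_from f u @ contents_from (foldl add_box f u) v"
  by (induction u arbitrary: f) auto

lemma lattice_append: "lattice (u @ v) \<longleftrightarrow> lattice u \<and> lattice_from (shape u) v"
  by (simp add: lattice_from_append foldl_add_box_0)

lemma contents_append: "contents (u @ v) = contents u @ contents_from (shape u) v"
  by (simp add: contents_from_append foldl_add_box_0)

lemma length_contents_from [simp]: "length (contents_from f v) = length v"
  by (induction v arbitrary: f) auto

lemma shape_eq_iff: "shape u = shape v \<longleftrightarrow> mset u = mset v"
  by (auto simp: shape_def fun_eq_iff multiset_eq_iff count_mset)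

lemma shape_antimono:
  assumes "lattice ws" "a \<le> b"
  shows "shape ws b \<le> shape ws a"
proof -
  have "shape ws (Suc a) \<le> shape ws a" for a
    using assms(1)
  proof (induction ws arbitrary: a rule: rev_induct)
    case (snoc r ws)
    then have "addable (shape ws) r" and IH: "\<And>a. shape ws (Suc a) \<le> shape ws a"
      by (auto simp: lattice_append)
    then show ?case using IH[of a] by (auto simp: add_box_def addable_def intro: le_SucI)
  qed simp
  with assms(2) show ?thesis by (simp add: lift_Suc_antimono_le)
qed

lemma shape_sum: "finite A \<Longrightarrow> (\<Sum>i\<in>A. shape ws i) \<le> length ws"
proof (induction ws rule: rev_induct)
  case (snoc r ws)
  have "(\<Sum>i\<in>A. shape (ws @ [r]) i) = (\<Sum>i\<in>A. shape ws i + (if i = r then 1 else 0))"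
    by (intro sum.cong) (auto simp: add_box_def)
  also have "\<dots> \<le> (\<Sum>i\<in>A. shape ws i) + 1"
    using snoc(2) by (auto simp: sum.distrib sum.delta)
  finally show ?case using snoc by simp
qed simp

text \<open>Row a is at least as long as row b - 1, which is longer than row b; the row numbers
  contribute another 1. The upper bound counts a hook: row a together with one box in each row
  strictly between a and b lies in the shape. It limits the exponents that genericity has to keep
  away from 1.\<close>

lemma addable_gap:
  assumes "lattice u" "addable (shape u) a" "addable (shape u) b" "a < b"
  shows "box_content (shape u) a - box_content (shape u) b \<ge> 2"
    and "box_content (shape u) a - box_content (shape u) b \<le> int (length u) + 1"
proof -
  have 1: "shape u b < shape u (b - 1)" using assms by (auto simp: addable_def)
  have 2: "shape u (b - 1) \<le> shape u a" using assms by (intro shape_antimono) auto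
  show "box_content (shape u) a - box_content (shape u) b \<ge> 2"
    using 1 2 assms(4) by (auto simp: box_content_def)
  have pos: "shape u i \<ge> 1" if "i < b" for i
    using shape_antimono[OF assms(1), of i "b - 1"] 1 that by linarith
  have "(\<Sum>i\<in>{a..<b}. shape u i) = shape u a + (\<Sum>i\<in>{Suc a..<b}. shape u i)"
    using assms(4) by (simp add: sum.atLeast_Suc_lessThan)
  moreover have "(\<Sum>i\<in>{Suc a..<b}. shape u i) \<ge> (\<Sum>i\<in>{Suc a..<b}. 1)"
    by (rule sum_mono) (use pos in auto)
  moreover have "(\<Sum>i\<in>{a..<b}. shape u i) \<le> length u" by (rule shape_sum) simp
  ultimately show "box_content (shape u) a - box_content (shape u) b \<le> int (length u) + 1"
    using assms(4) by (simp add: box_content_def)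
qed

lemma addable_contents:
  assumes "lattice u" "addable (shape u) a" "addable (shape u) b" "a \<noteq> b"
  shows "2 \<le> \<bar>box_content (shape u) a - box_content (shape u) b\<bar>"
    and "\<bar>box_content (shape u) a - box_content (shape u) b\<bar> \<le> int (length u) + 1"
  using addable_gap[OF assms(1,2,3)] addable_gap[OF assms(1,3,2)] assms(4)
  by (cases "a < b"; force)+

lemma addable_bound:
  assumes "lattice u" "addable (shape u) a"
  shows "a \<le> length u"
proof (rule ccontr)
  assume "\<not> a \<le> length u"
  then have "a \<ge> 1" and 1: "shape u (a - 1) > 0" using assms by (auto simp: addable_def)
  have "shape u i \<ge> 1" if "i < a" for i
    using shape_antimono[OF assms(1), of i "a - 1"] 1 that by linarith
  then have "(\<Sum>i\<in>{..<a}. 1) \<le> (\<Sum>i\<in>{..<a}. shape u i)" by (intro sum_mono) auto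
  with shape_sum[of "{..<a}" u] \<open>\<not> a \<le> length u\<close> show False by simp
qed

definition addables :: "nat list \<Rightarrow> nat set" where
  "addables u = {a. addable (shape u) a}"

lemma finite_addables [simp]: "lattice u \<Longrightarrow> finite (addables u)"
  unfolding addables_def by (rule finite_subset[of _ "{..length u}"]) (use addable_bound in auto)

lemma mem_addables [simp]: "a \<in> addables u \<longleftrightarrow> addable (shape u) a"
  by (simp add: addables_def)


subsection \<open>Exchanging adjacent letters\<close>

definition swap_at :: "nat \<Rightarrow> 'a list \<Rightarrow> 'a list" where
  "swap_at k ws = ws[k := ws ! Suc k, Suc k := ws ! k]"

lemma length_swap_at [simp]: "length (swap_at k ws) = length ws"
  by (simp add: swap_at_def)

lemma swap_at_append: "swap_at (length u) (u @ r # s # v) = u @ s # r # v"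
  by (simp add: swap_at_def nth_append list_update_append)

lemma swap_at_append1: "Suc k < length xs \<Longrightarrow> swap_at k (xs @ ys) = swap_at k xs @ ys"
  by (simp add: swap_at_def nth_append list_update_append)

lemma split_at:
  assumes "Suc k < length ws"
  obtains u v where "ws = u @ ws ! k # ws ! Suc k # v" "length u = k"
  using assms that[of "take k ws" "drop (k + 2) ws"]
  by (simp add: id_take_nth_drop Cons_nth_drop_Suc)

lemma nth_swap_at:
  "Suc k < length ws \<Longrightarrow> j < length ws \<Longrightarrow>
   swap_at k ws ! j = (if j = k then ws ! Suc k else if j = Suc k then ws ! k else ws ! j)"
  by (auto simp: swap_at_def nth_list_update)

lemma swap_at_swap_at: "Suc k < length ws \<Longrightarrow> swap_at k (swap_at k ws) = ws"
  by (rule nth_equalityI) (auto simp: nth_swap_at)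

lemma swap_at_braid:
  "Suc (Suc k) < length ws \<Longrightarrow>
   swap_at k (swap_at (Suc k) (swap_at k ws)) = swap_at (Suc k) (swap_at k (swap_at (Suc k) ws))"
  by (rule nth_equalityI) (simp_all add: nth_swap_at)

lemma swap_at_far:
  "Suc i < j \<Longrightarrow> Suc j < length ws \<Longrightarrow> swap_at i (swap_at j ws) = swap_at j (swap_at i ws)"
  by (rule nth_equalityI) (simp_all add: nth_swap_at)

lemma mset_swap_at [simp]: "Suc k < length ws \<Longrightarrow> mset (swap_at k ws) = mset ws"
  by (elim split_at) (metis (no_types) add_mset_commute mset.simps(2) mset_append swap_at_append)

lemma contents_swap_at:
  assumes "Suc k < length ws" "ws ! k \<noteq> ws ! Suc k"
  shows "contents (swap_at k ws) = swap_at k (contents ws)"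
proof -
  obtain u v where ws: "ws = u @ ws ! k # ws ! Suc k # v" "length u = k"
    using assms(1) by (rule split_at)
  define r s where "r = ws ! k" and "s = ws ! Suc k"
  have ws': "ws = u @ r # s # v" and rs: "r \<noteq> s" using ws assms by (auto simp: r_def s_def)
  have c: "box_content (add_box (shape u) r) s = box_content (shape u) s"
    "box_content (add_box (shape u) s) r = box_content (shape u) r"
    using rs by (auto simp: box_content_def add_box_def)
  show ?thesis
    using swap_at_append[of u r s v]
      swap_at_append[of "contents u" "box_content (shape u) r" "box_content (shape u) s"] ws(2)
    by (simp add: ws' contents_append c add_box_commute[of _ s r])
qed

lemma nth_contents:
  assumes "k < length ws"
  shows "contents ws ! k = box_content (shape (take k ws)) (ws ! k)"
proof -
  have "ws = take k ws @ ws ! k # drop (Suc k) ws" using assms by (simp add: id_take_nth_drop)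
  then have "contents ws ! k = contents (take k ws @ ws ! k # drop (Suc k) ws) ! k" by simp
  then show ?thesis using assms by (simp add: contents_append nth_append)
qed

lemma lattice_take: "lattice ws \<Longrightarrow> lattice (take k ws)"
  by (metis append_take_drop_id lattice_append)

lemma lattice_nth: "lattice ws \<Longrightarrow> k < length ws \<Longrightarrow> addable (shape (take k ws)) (ws ! k)"
  by (metis id_take_nth_drop lattice_append lattice_from.simps(2))

lemma lattice_nth_Suc:
  assumes "lattice ws" "Suc k < length ws"
  shows "addable (add_box (shape (take k ws)) (ws ! k)) (ws ! Suc k)"
  using lattice_nth[OF assms] assms(2) by (simp add: take_Suc_conv_app_nth)

lemma lattice_swap_at_iff:
  assumes "lattice ws" "Suc k < length ws" "ws ! k \<noteq> ws ! Suc k"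
  shows "lattice (swap_at k ws) \<longleftrightarrow> addable (shape (take k ws)) (ws ! Suc k)"
proof -
  obtain u v where ws: "ws = u @ ws ! k # ws ! Suc k # v" "length u = k"
    using assms(2) by (rule split_at)
  define r s where "r = ws ! k" and "s = ws ! Suc k"
  have ws': "ws = u @ r # s # v" and rs: "r \<noteq> s" using ws assms by (auto simp: r_def s_def)
  have tk: "take k ws = u" using ws' ws(2) by simp
  have l: "lattice u" "addable (shape u) r" "lattice_from (add_box (add_box (shape u) r) s) v"
    using assms(1) by (auto simp: ws' lattice_append)
  have "addable (add_box (shape u) s) r" if "addable (shape u) s"
    using l(2) rs that by (auto simp: addable_def add_box_def)
  then show ?thesis using l ws(2)
    unfolding tk s_def[symmetric] unfolding ws'
    by (auto simp: swap_at_append lattice_append add_box_commute[of _ s r])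
qed

text \<open>Whether a row is addable depends on that row and the one above it, and the box added
  just before in a lower row changes neither. So removing a descent never leaves the lattice words,
  and a lattice word can be sorted within its shape.\<close>

lemma lattice_swap_at:
  assumes "lattice ws" "Suc k < length ws" "ws ! k > ws ! Suc k"
  shows "lattice (swap_at k ws)"
proof -
  have "addable (shape (take k ws)) (ws ! Suc k)"
    using lattice_nth_Suc[OF assms(1,2)] assms(3) by (auto simp: addable_def add_box_def split: if_splits)
  then show ?thesis using lattice_swap_at_iff assms by simp
qed

lemma contents_admissible:
  assumes "lattice ws" "Suc k < length ws" "ws ! k \<noteq> ws ! Suc k" "lattice (swap_at k ws)"
  shows "2 \<le> \<bar>contents ws ! k - contents ws ! Suc k\<bar>"
    and "\<bar>contents ws ! k - contents ws ! Suc k\<bar> < int (length ws)"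
proof -
  let ?u = "take k ws"
  have add: "addable (shape ?u) (ws ! k)" "addable (shape ?u) (ws ! Suc k)"
    using assms lattice_nth lattice_swap_at_iff by auto
  have "contents ws ! k = box_content (shape ?u) (ws ! k)" using assms by (intro nth_contents) auto
  moreover have "contents ws ! Suc k = box_content (shape ?u) (ws ! Suc k)"
    using assms nth_contents[of "Suc k" ws] by (simp add: take_Suc_conv_app_nth box_content_def add_box_def)
  moreover note addable_contents[OF lattice_take[OF assms(1)] add assms(3)]
  ultimately show "2 \<le> \<bar>contents ws ! k - contents ws ! Suc k\<bar>"
    and "\<bar>contents ws ! k - contents ws ! Suc k\<bar> < int (length ws)" using assms(2) by auto
qed

text \<open>An exchange fails only if the second box is the right neighbour of the first (equal
  rows) or lies directly below it. Together with \<open>contents_admissible\<close> this makes the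
  content difference decide whether an exchange is possible.\<close>

lemma contents_inadmissible:
  assumes "lattice ws" "Suc k < length ws" "ws ! k = ws ! Suc k \<or> \<not> lattice (swap_at k ws)"
  shows "\<bar>contents ws ! k - contents ws ! Suc k\<bar> = 1"
proof -
  let ?u = "take k ws"
  have 1: "contents ws ! k = box_content (shape ?u) (ws ! k)" using assms by (intro nth_contents) auto
  have 2: "contents ws ! Suc k = box_content (add_box (shape ?u) (ws ! k)) (ws ! Suc k)"
    using assms nth_contents[of "Suc k" ws] by (simp add: take_Suc_conv_app_nth)
  show ?thesis
  proof (cases "ws ! k = ws ! Suc k")
    case True
    then show ?thesis using 1 2 by (simp add: box_content_def add_box_def)
  next
    case False
    with assms have "\<not> addable (shape ?u) (ws ! Suc k)" using lattice_swap_at_iff by auto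
    moreover have "addable (add_box (shape ?u) (ws ! k)) (ws ! Suc k)"
      using lattice_nth_Suc assms by blast
    moreover have "addable (shape ?u) (ws ! k)" using lattice_nth assms by simp
    moreover have "shape ?u (ws ! Suc k) \<le> shape ?u (ws ! Suc k - 1)"
      by (rule shape_antimono) (use assms lattice_take in auto)
    ultimately have "ws ! Suc k = Suc (ws ! k)" "shape ?u (ws ! Suc k) = shape ?u (ws ! k)"
      using False by (auto simp: addable_def add_box_def split: if_splits)
    then show ?thesis using 1 2 by (simp add: box_content_def add_box_def)
  qed
qed

text \<open>Each letter is weighted by the length of the suffix that it starts, so moving a larger
  letter one place to the right lowers the sum. This is the termination measure for sorting.\<close>

fun disorder :: "nat list \<Rightarrow> nat" where
  "disorder [] = 0"
| "disorder (a # v) = a * Suc (length v) + disorder v"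

lemma disorder_append_mono:
  "length x = length z \<Longrightarrow> disorder x < disorder z \<Longrightarrow> disorder (u @ x) < disorder (u @ z)"
  by (induction u) auto

lemma disorder_swap_at:
  assumes "Suc k < length ws" "ws ! k > ws ! Suc k"
  shows "disorder (swap_at k ws) < disorder ws"
proof -
  obtain u v where ws: "ws = u @ ws ! k # ws ! Suc k # v" "length u = k"
    using assms(1) by (rule split_at)
  define r s where "r = ws ! k" and "s = ws ! Suc k"
  have ws': "ws = u @ r # s # v" and rs: "r > s" using ws assms by (auto simp: r_def s_def)
  have "disorder (s # r # v) < disorder (r # s # v)" using rs by simp
  then have "disorder (u @ s # r # v) < disorder (u @ r # s # v)"
    by (intro disorder_append_mono) auto
  then show ?thesis using swap_at_append[of u r s v] ws(2) by (simp add: ws')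
qed

text \<open>Row p ends in a corner, and some tableau of the same shape fills this corner last. It
  arises by taking the last letter p out of the word and appending it; the only later letters that
  could have relied on it are the letters p + 1.\<close>

lemma lattice_move_to_end:
  assumes "lattice ws" "shape ws (Suc p) < shape ws p"
  obtains us where "lattice (us @ [p])" "mset (us @ [p]) = mset ws"
proof -
  have "p \<in> set ws" using assms(2) by (metis count_list_0_iff not_less_zero shape_def)
  then obtain A B where AB: "ws = A @ p # B" "p \<notin> set B" using split_list_last by metis
  have cB: "count_list B p = 0" using AB(2) by simp
  have "addable (shape (A @ take k B)) (B ! k)" if k: "k < length B" for k
  proof -
    let ?g = "shape (A @ p # take k B)"
    have "lattice ((A @ p # take k B) @ B ! k # drop (Suc k) B)"
      using assms(1) AB(1) k by (simp add: id_take_nth_drop[symmetric])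
    then have add: "addable ?g (B ! k)" by (simp only: lattice_append) simp
    have g: "?g = add_box (shape (A @ take k B)) p"
      by (auto simp: shape_def add_box_def fun_eq_iff)
    have np: "B ! k \<noteq> p" using AB(2) k nth_mem by metis
    \<comment> \<open>A letter p + 1 is still to come, so row p + 1 is at this point shorter than in
      the end, where it is itself shorter than row p. Row p has already reached its final length
      minus the box taken out.\<close>
    have "addable (shape (A @ take k B)) (B ! k)" if e: "B ! k = Suc p"
    proof -
      have "shape ws = (\<lambda>a. shape (A @ p # take k B) a + count_list (drop k B) a)"
        unfolding AB(1) by (subst append_take_drop_id[of k B, symmetric])
          (simp add: shape_def fun_eq_iff del: append_take_drop_id)
      moreover have "count_list (drop k B) p = 0"
        using AB(2) by (meson count_list_0_iff in_set_dropD)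
      moreover have "count_list (drop k B) (Suc p) > 0"
        using k e by (simp add: Cons_nth_drop_Suc[symmetric])
      ultimately show ?thesis using assms(2) e unfolding g
        by (auto simp: addable_def add_box_def)
    qed
    then show ?thesis using add np unfolding g
      by (cases "B ! k = Suc p") (auto simp: addable_def add_box_def split: if_splits)
  qed
  then have "lattice (A @ take k B)" if "k \<le> length B" for k
    using that
  proof (induction k)
    case 0
    then show ?case using assms(1) AB(1) by (simp add: lattice_append)
  next
    case (Suc k)
    then have "lattice ((A @ take k B) @ [B ! k])" by (subst lattice_append) simp
    then show ?case using Suc by (simp add: take_Suc_conv_app_nth)
  qed
  from this[of "length B"] have l: "lattice (A @ B)" by simp
  have sh: "shape ws = add_box (shape (A @ B)) p"
    by (auto simp: AB(1) shape_def add_box_def fun_eq_iff)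
  have "addable (shape (A @ B)) p"
  proof (cases p)
    case (Suc p')
    have "shape ws p \<le> shape ws p'" using shape_antimono[OF assms(1), of p' p] Suc by simp
    then show ?thesis unfolding sh using Suc by (auto simp: addable_def add_box_def)
  qed (simp add: addable_def)
  with l have "lattice ((A @ B) @ [p])" by (subst lattice_append) simp
  moreover have "mset ((A @ B) @ [p]) = mset ws" by (simp add: AB(1))
  ultimately show ?thesis by (rule that)
qed


section \<open>Jucys--Murphy elements\<close>

locale complex_algebra = vector_space scale
  for scale :: "complex \<Rightarrow> 'a::ring_1 \<Rightarrow> 'a" (infixr \<open>*s\<close> 75) +
  assumes scale_mult: "(a *s x) * y = a *s (x * y)"
    and mult_scale: "x * (a *s y) = a *s (x * y)"
begin

definition poly_eval :: "complex poly \<Rightarrow> 'a \<Rightarrow> 'a" where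
  "poly_eval p y = fold_coeffs (\<lambda>a r. a *s 1 + y * r) p 0"

lemma poly_eval_0 [simp]: "poly_eval 0 y = 0"
  by (simp add: poly_eval_def)

lemma poly_eval_pCons [simp]: "poly_eval (pCons a p) y = a *s 1 + y * poly_eval p y"
  by (cases "p = 0 \<and> a = 0") (auto simp: poly_eval_def)

lemma poly_eval_add: "poly_eval (p + r) y = poly_eval p y + poly_eval r y"
proof (induction p arbitrary: r)
  case (pCons a p)
  show ?case by (cases r) (simp add: pCons.IH distrib_left scale_left_distrib add.assoc add.left_commute)
qed simp

lemma poly_eval_1 [simp]: "poly_eval 1 y = 1"
  by (simp add: one_pCons)

lemma poly_eval_smult: "poly_eval (Polynomial.smult c p) y = c *s poly_eval p y"
  by (induction p) (simp_all add: scale_right_distrib mult_scale)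

lemma poly_eval_mult: "poly_eval (p * r) y = poly_eval p y * poly_eval r y"
  by (induction p) (simp_all add: poly_eval_add poly_eval_smult scale_mult algebra_simps)

lemma poly_eval_sum: "poly_eval (\<Sum>i\<in>I. p i) y = (\<Sum>i\<in>I. poly_eval (p i) y)"
  by (induction I rule: infinite_finite_induct) (simp_all add: poly_eval_add)

lemma poly_eval_intertwine: "x * y = z * x \<Longrightarrow> x * poly_eval p y = poly_eval p z * x"
proof (induction p)
  case (pCons a p)
  have "x * (y * poly_eval p y) = z * (x * poly_eval p y)"
    using pCons(3) by (metis mult.assoc)
  then show ?case using pCons by (simp add: distrib_left distrib_right scale_mult mult_scale mult.assoc)
qed simp

lemma poly_eval_comm: "x * y = y * x \<Longrightarrow> x * poly_eval p y = poly_eval p y * x"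
  by (rule poly_eval_intertwine)

lemma poly_eval_eigen: "y * w = b *s w \<Longrightarrow> poly_eval p y * w = poly p b *s w"
  by (induction p)
     (simp_all add: distrib_right scale_mult scale_left_distrib mult.assoc mult_scale mult.commute[of b])

text \<open>On a Jordan block a polynomial acts by its value on the diagonal and by its derivative
  off it. Since the derivative does not vanish at a simple root, an annihilating polynomial with
  simple roots excludes such blocks.\<close>

lemma poly_eval_jordan:
  assumes "y * w = b *s w" "y * v = b *s v + c *s w"
  shows "poly_eval p y * v = poly p b *s v + (c * poly (pderiv p) b) *s w"
proof (induction p)
  case (pCons a p)
  show ?case
    by (simp add: pCons distrib_right scale_mult mult.assoc distrib_left mult_scale assms pderiv_pCons
        algebra_simps)
qed simp

end


section \<open>Lagrange interpolation on a finite set\<close>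

definition root_poly :: "complex set \<Rightarrow> complex poly" where
  "root_poly A = (\<Prod>a\<in>A. [:- a, 1:])"

definition lagrange :: "complex set \<Rightarrow> complex \<Rightarrow> complex poly" where
  "lagrange A a = Polynomial.smult (inverse (\<Prod>b\<in>A - {a}. a - b)) (root_poly (A - {a}))"

lemma poly_root_poly: "finite A \<Longrightarrow> poly (root_poly A) x = (\<Prod>a\<in>A. x - a)"
  by (simp add: root_poly_def poly_prod)

lemma poly_root_poly_eq_0: "finite A \<Longrightarrow> poly (root_poly A) x = 0 \<longleftrightarrow> x \<in> A"
  by (simp add: poly_root_poly)

lemma root_poly_remove: "finite A \<Longrightarrow> a \<in> A \<Longrightarrow> root_poly A = [:- a, 1:] * root_poly (A - {a})"
  by (simp add: root_poly_def prod.remove)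

lemma poly_lagrange:
  "finite A \<Longrightarrow> a \<in> A \<Longrightarrow> b \<in> A \<Longrightarrow> poly (lagrange A a) b = (if a = b then 1 else 0)"
  by (auto simp: lagrange_def poly_root_poly intro!: left_inverse)

lemma lagrange_mult: "finite A \<Longrightarrow> a \<in> A \<Longrightarrow>
    [:- a, 1:] * lagrange A a = Polynomial.smult (inverse (\<Prod>b\<in>A - {a}. a - b)) (root_poly A)"
  by (simp add: lagrange_def root_poly_remove)

text \<open>The difference of the two sides has degree below \<open>card A\<close> but vanishes on
  all of A.\<close>

lemma sum_lagrange:
  assumes "finite A" "A \<noteq> {}"
  shows "(\<Sum>a\<in>A. lagrange A a) = 1"
proof (rule ccontr)
  let ?p = "(\<Sum>a\<in>A. lagrange A a) - 1"
  assume "(\<Sum>a\<in>A. lagrange A a) \<noteq> 1"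
  then have nz: "?p \<noteq> 0" by simp
  have dr: "degree (root_poly B) = card B" if "finite B" for B
    unfolding root_poly_def using that
    by (subst degree_prod_eq_sum_degree) auto
  have "degree (lagrange A a) \<le> card A - 1" if "a \<in> A" for a
    using that assms by (auto simp: lagrange_def dr)
  then have "degree ?p \<le> card A - 1"
    by (intro degree_diff_le degree_sum_le) (use assms in auto)
  moreover have "A \<subseteq> {x. poly ?p x = 0}"
    using assms by (auto simp: poly_sum poly_lagrange sum.delta)
  then have "card A \<le> card {x. poly ?p x = 0}" by (intro card_mono poly_roots_finite nz)
  then have "card A \<le> degree ?p" using card_poly_roots_bound[OF nz] by simp
  moreover have "card A > 0" using assms by (simp add: card_gt_0_iff)
  ultimately show False by simp
qed

lemma pderiv_root_poly_nonzero:
  assumes "finite A" "a \<in> A"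
  shows "poly (pderiv (root_poly A)) a \<noteq> 0"
proof -
  have "poly (pderiv ([:- a, 1:] * root_poly (A - {a}))) a = poly (root_poly (A - {a})) a"
    by (simp only: pderiv_mult poly_add poly_mult) (simp add: pderiv_pCons)
  then show ?thesis using assms poly_root_poly_eq_0[of "A - {a}" a] by (simp add: root_poly_remove)
qed


text \<open>Indices start at 0: \<open>S k\<close> stands for T_{k+1} and the element
  \<open>J k\<close> defined below for y_{k+1}. Hence the generators are those with k + 1 < n and
  the Jucys-Murphy elements those with k < n.\<close>

locale hecke_algebra = complex_algebra scale
  for scale :: "complex \<Rightarrow> 'a::ring_1 \<Rightarrow> 'a" (infixr \<open>*s\<close> 75) +
  fixes S :: "nat \<Rightarrow> 'a" and n :: nat and q :: complex
  assumes generic: "generic_parameter n q"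
    and braid: "k + 2 < n \<Longrightarrow> S k * S (Suc k) * S k = S (Suc k) * S k * S (Suc k)"
    and far: "i + 1 < j \<Longrightarrow> j + 1 < n \<Longrightarrow> S i * S j = S j * S i"
    and quadratic: "k + 1 < n \<Longrightarrow> S k * S k = (q - inverse q) *s S k + 1"
begin

primrec J :: "nat \<Rightarrow> 'a" where
  "J 0 = 1"
| "J (Suc k) = S k * J k * S k"

declare J.simps(2) [simp del]

lemma S_J_above: "k < i \<Longrightarrow> i + 1 < n \<Longrightarrow> S i * J k = J k * S i"
proof (induction k)
  case (Suc k)
  have "S i * S k = S k * S i" using far[of k i] Suc by simp
  then show ?case using Suc by (simp add: J.simps(2)) (metis mult.assoc Suc_lessD)
qed simp

text \<open>In the case k = i + 2 the braid relation turns \<open>S i\<close> on the left into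
  \<open>S (Suc i)\<close>, which commutes with \<open>J i\<close>, and a second braid relation
  turns it back into \<open>S i\<close> on the right. Larger k only add outer factors that commute
  with \<open>S i\<close>.\<close>

lemma S_J_below: "i + 2 \<le> k \<Longrightarrow> k < n \<Longrightarrow> S i * J k = J k * S i"
proof (induction k rule: dec_induct)
  case base
  have b: "S i * S (Suc i) * S i = S (Suc i) * S i * S (Suc i)" using braid base by simp
  have c: "S (Suc i) * J i = J i * S (Suc i)" using S_J_above base by simp
  have "S i * J (i + 2) = (S i * S (Suc i) * S i) * J i * S i * S (Suc i)"
    by (simp add: J.simps(2) mult.assoc)
  also have "\<dots> = S (Suc i) * S i * (S (Suc i) * J i) * S i * S (Suc i)"
    unfolding b by (simp add: mult.assoc)
  also have "\<dots> = S (Suc i) * S i * J i * (S (Suc i) * S i * S (Suc i))"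
    unfolding c by (simp add: mult.assoc)
  also have "\<dots> = J (i + 2) * S i"
    unfolding b[symmetric] by (simp add: J.simps(2) mult.assoc)
  finally show ?case .
next
  case (step k)
  have "S i * S k = S k * S i" using far[of i k] step by simp
  then show ?case using step by (simp add: J.simps(2)) (metis mult.assoc Suc_lessD)
qed

lemma J_commute: "j < n \<Longrightarrow> k < n \<Longrightarrow> J j * J k = J k * J j"
proof -
  have "J j * J k = J k * J j" if "j < k" "k < n" for j k
    using that
  proof (induction j)
    case (Suc j)
    have "S j * J k = J k * S j" using S_J_below Suc by simp
    then show ?case using Suc by (simp add: J.simps(2)) (metis mult.assoc Suc_lessD)
  qed simp
  then show "j < n \<Longrightarrow> k < n \<Longrightarrow> J j * J k = J k * J j" by (metis linorder_neqE_nat)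
qed

abbreviation qd :: complex where "qd \<equiv> q - inverse q"

lemma J_S: "k + 1 < n \<Longrightarrow> J (Suc k) * S k = S k * J k + qd *s J (Suc k)"
proof -
  assume k: "k + 1 < n"
  have "J (Suc k) * S k = S k * J k * (S k * S k)" by (simp add: J.simps(2) mult.assoc)
  then show ?thesis using quadratic[OF k]
    by (simp add: distrib_left mult_scale J.simps(2) mult.assoc)
qed

lemma S_J_Suc: "k + 1 < n \<Longrightarrow> S k * J (Suc k) = J k * S k + qd *s J (Suc k)"
proof -
  assume k: "k + 1 < n"
  have "S k * J (Suc k) = (S k * S k) * J k * S k" by (simp add: J.simps(2) mult.assoc)
  then show ?thesis using quadratic[OF k]
    by (simp add: distrib_right scale_mult J.simps(2) mult.assoc)
qed

lemma S_J: "k + 1 < n \<Longrightarrow> S k * J k = J (Suc k) * S k - qd *s J (Suc k)"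
  using J_S by simp


subsection \<open>Quantum contents\<close>

definition Q :: "int \<Rightarrow> complex" where
  "Q e = q powi (2 * e)"

lemma q_nonzero: "q \<noteq> 0"
  using generic by (simp add: generic_parameter_def)

lemma Q_nonzero [simp]: "Q e \<noteq> 0"
  using q_nonzero by (simp add: Q_def)

lemma Q_add: "Q (d + e) = Q d * Q e"
  using q_nonzero by (simp add: Q_def power_int_add distrib_left)

lemma Q_minus: "Q (- d) = inverse (Q d)"
  by (simp add: Q_def power_int_minus)

lemma Q_diff: "Q (d - e) = Q d / Q e"
  using Q_add[of d "- e"] by (simp add: Q_minus field_simps)

lemma Q_0 [simp]: "Q 0 = 1"
  by (simp add: Q_def)

lemma Q_neq_1:
  assumes "d \<noteq> 0" "\<bar>d\<bar> \<le> int n"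
  shows "Q d \<noteq> 1"
proof -
  have pos: "Q (int k) \<noteq> 1" if "0 < k" "k \<le> n" for k
  proof -
    have "Q (int k) = q ^ (2 * k)" unfolding Q_def by (metis of_nat_mult of_nat_numeral power_int_of_nat)
    then show ?thesis using that generic by (auto simp: generic_parameter_def)
  qed
  show ?thesis
  proof (cases "d > 0")
    case True
    then show ?thesis using pos[of "nat d"] assms by auto
  next
    case False
    then show ?thesis using pos[of "nat (- d)"] assms Q_minus[of d] by auto
  qed
qed

lemma Q_neq: "d \<noteq> e \<Longrightarrow> \<bar>d - e\<bar> \<le> int n \<Longrightarrow> Q d \<noteq> Q e"
  using Q_neq_1[of "d - e"] by (auto simp: Q_diff)

lemma Q_1: "Q 1 = q\<^sup>2"
  by (simp add: Q_def power_int_def)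

definition coef :: "int \<Rightarrow> complex" where
  "coef d = qd / (Q d - 1)"

text \<open>
  The Baxterized generator at the parameter \<open>Q d\<close>; it exchanges two neighbouring eigenvalues of ratio \<open>Q d\<close>.
\<close>

definition tt :: "nat \<Rightarrow> int \<Rightarrow> 'a" where
  "tt k d = S k + coef d *s 1"

lemma coef_minus: "Q d \<noteq> 1 \<Longrightarrow> coef (- d) = - qd - coef d"
proof -
  have "a / (inverse x - 1) = - a - a / (x - 1)" if "x \<noteq> 0" "x \<noteq> 1" for a x :: complex
    using that by (simp add: field_simps)
  then show "Q d \<noteq> 1 \<Longrightarrow> coef (- d) = - qd - coef d" by (simp add: coef_def Q_minus)
qed

lemma coef_1: "coef 1 = inverse q" if "n \<ge> 1"
proof -
  have "Q 1 \<noteq> 1" using Q_neq_1[of 1] that by simp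
  then show ?thesis using q_nonzero
    by (simp add: coef_def Q_1 field_simps power2_eq_square)
qed

lemma coef_minus_1: "coef (- 1) = - q" if "n \<ge> 1"
  using coef_1 that coef_minus[of 1] Q_neq_1[of 1] by simp

definition tt_norm :: "int \<Rightarrow> complex" where
  "tt_norm d = 1 - coef d * (qd + coef d)"

text \<open>The factorization shows that the norm of a Baxterized generator vanishes only at q^2 and
  q^(-2). For parameters that are ratios of contents these are the differences 1 and -1, so the
  exchange operators are invertible exactly away from adjacent contents.\<close>

lemma baxter_norm_eq:
  assumes "x \<noteq> 1"
  shows "1 - qd / (x - 1) * (qd + qd / (x - 1)) = (x - Q 1) * (x - Q (- 1)) / (x - 1)\<^sup>2"
proof -
  have x: "x - 1 \<noteq> 0" using assms by simp
  have "qd\<^sup>2 = q\<^sup>2 + inverse (q\<^sup>2) - 2"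
    using q_nonzero by (simp add: field_simps power2_eq_square)
  moreover have "q\<^sup>2 * inverse (q\<^sup>2) = 1" using q_nonzero by simp
  ultimately have "(x - q\<^sup>2) * (x - inverse (q\<^sup>2)) = (x - 1)\<^sup>2 - qd\<^sup>2 * x"
    by (simp add: algebra_simps power2_eq_square)
  moreover have "1 - a / (x - 1) * (a + a / (x - 1)) = ((x - 1)\<^sup>2 - a\<^sup>2 * x) / (x - 1)\<^sup>2" for a
  proof -
    have "a + a / (x - 1) = a * x / (x - 1)" using x by (simp add: field_simps)
    then show ?thesis using x by (simp add: diff_divide_distrib power2_eq_square)
  qed
  ultimately show ?thesis by (simp add: Q_1 Q_minus)
qed

lemma tt_norm_eq: "Q d \<noteq> 1 \<Longrightarrow> tt_norm d = (Q d - Q 1) * (Q d - Q (- 1)) / (Q d - 1)\<^sup>2"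
  using baxter_norm_eq[of "Q d"] by (simp add: tt_norm_def coef_def)

lemma tt_norm_nonzero: "2 \<le> \<bar>d\<bar> \<Longrightarrow> \<bar>d\<bar> < int n \<Longrightarrow> tt_norm d \<noteq> 0"
  using Q_neq[of d 1] Q_neq[of d "-1"] Q_neq_1[of d] by (subst tt_norm_eq) auto

lemma S_shift_mult:
  assumes "k + 1 < n"
  shows "(S k + a *s 1) * (S k + b *s 1) = (qd + (a + b)) *s S k + (1 + a * b) *s 1"
proof -
  have "(S k + a *s 1) * (S k + b *s 1) = S k * S k + (a + b) *s S k + (a * b) *s 1"
    by (simp add: distrib_left distrib_right scale_mult mult_scale scale_left_distrib
        scale_right_distrib ac_simps)
  then show ?thesis
    using quadratic[OF assms] by (simp only: scale_left_distrib scale_one) (simp only: add_ac)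
qed

lemma tt_mult:
  assumes "k + 1 < n" "Q d \<noteq> 1"
  shows "tt k (- d) * tt k d = tt_norm d *s 1" "tt k d * tt k (- d) = tt_norm d *s 1"
proof -
  have "qd + (coef (- d) + coef d) = 0" "qd + (coef d + coef (- d)) = 0"
    "1 + coef (- d) * coef d = tt_norm d" "1 + coef d * coef (- d) = tt_norm d"
    unfolding coef_minus[OF assms(2)] tt_norm_def by (simp_all add: algebra_simps)
  then show "tt k (- d) * tt k d = tt_norm d *s 1" "tt k d * tt k (- d) = tt_norm d *s 1"
    unfolding tt_def S_shift_mult[OF assms(1)] by simp_all
qed

lemma tt_far: "i + 1 < j \<Longrightarrow> j + 1 < n \<Longrightarrow> tt i d * tt j e = tt j e * tt i d"
  using far[of i j] by (simp add: tt_def algebra_simps scale_mult mult_scale)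

text \<open>After expansion the braid relation matches the cubic terms and the quadratic relation
  reduces the squares. What remains is to compare the coefficients of the two generators, which
  agree by the addition law of \<open>coef\<close>.\<close>

lemma yang_baxter:
  assumes "k + 2 < n" "Q d \<noteq> 1" "Q e \<noteq> 1" "Q (d + e) \<noteq> 1"
  shows "tt k d * tt (Suc k) (d + e) * tt k e = tt (Suc k) e * tt k (d + e) * tt (Suc k) d"
proof -
  define A B where "A = S k" and "B = S (Suc k)"
  define g1 g2 g3 where "g1 = coef d" and "g2 = coef (d + e)" and "g3 = coef e"
  have ABA: "A * (B * A) = B * (A * B)" using braid[OF assms(1)] by (simp add: A_def B_def mult.assoc)
  have sq: "A * A = qd *s A + 1" "B * B = qd *s B + 1"
    using quadratic assms(1) by (auto simp: A_def B_def)
  \<comment> \<open>For \<open>Q d\<close> = exp(2 t) one has 1 / (Q d - 1) = (coth t - 1) / 2, and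
    this is the addition law of the hyperbolic cotangent.\<close>
  have g: "g1 * g3 = g2 * (g1 + g3 + qd)"
  proof -
    have "(a / (x - 1)) * (a / (y - 1)) = a / (x * y - 1) * (a / (x - 1) + a / (y - 1) + a)"
      if "x \<noteq> 1" "y \<noteq> 1" "x * y \<noteq> 1" for a x y :: complex
    proof -
      define p r where "p = x - 1" and "r = y - 1"
      have s: "x * y - 1 = r + p + p * r" by (simp add: p_def r_def algebra_simps)
      have "r + p + p * r \<noteq> 0" unfolding s[symmetric] using that by simp
      moreover have "p \<noteq> 0" "r \<noteq> 0" using that by (auto simp: p_def r_def)
      ultimately have nz: "p \<noteq> 0" "r \<noteq> 0" "r + p + p * r \<noteq> 0" by auto
      have "a / p = a * r / (p * r)" "a / r = a * p / (p * r)" "a = a * (p * r) / (p * r)"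
        using nz by simp_all
      then have "a / p + a / r + a = a * (r + p + p * r) / (p * r)"
        by (metis add_divide_distrib distrib_left)
      then show ?thesis using nz unfolding s p_def[symmetric] r_def[symmetric] by simp
    qed
    then show ?thesis using assms(2-4) by (simp add: g1_def g2_def g3_def coef_def Q_add)
  qed
  have L: "(A + g1 *s 1) * (B + g2 *s 1) * (A + g3 *s 1) =
      A * (B * A) + g3 *s (A * B) + g2 *s (A * A) + g1 *s (B * A)
      + (g2 * g3 + g1 * g2) *s A + (g1 * g3) *s B + (g1 * g2 * g3) *s 1"
    by (simp add: distrib_left distrib_right scale_mult mult_scale scale_left_distrib
        scale_right_distrib mult.assoc ac_simps)
  have R: "(B + g3 *s 1) * (A + g2 *s 1) * (B + g1 *s 1) =
      B * (A * B) + g1 *s (B * A) + g2 *s (B * B) + g3 *s (A * B)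
      + (g1 * g2 + g2 * g3) *s B + (g1 * g3) *s A + (g1 * g2 * g3) *s 1"
    by (simp add: distrib_left distrib_right scale_mult mult_scale scale_left_distrib
        scale_right_distrib mult.assoc ac_simps)
  define X where "X = B * (A * B) + g3 *s (A * B) + g1 *s (B * A) + g2 *s 1 + (g1 * g2 * g3) *s 1"
  have 1: "(g2 * g3 + g1 * g2) *s Z + g2 *s (qd *s Z) = (g1 * g3) *s Z"
    "(g1 * g2 + g2 * g3) *s Z + g2 *s (qd *s Z) = (g1 * g3) *s Z" for Z
    unfolding g scale_scale scale_left_distrib[symmetric] by (simp_all add: distrib_left mult.commute add_ac)
  have lhs: "A * (B * A) + g3 *s (A * B) + g2 *s (A * A) + g1 *s (B * A)
      + (g2 * g3 + g1 * g2) *s A + (g1 * g3) *s B + (g1 * g2 * g3) *s 1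
    = X + ((g2 * g3 + g1 * g2) *s A + g2 *s (qd *s A)) + (g1 * g3) *s B"
    unfolding ABA sq scale_right_distrib X_def by (simp only: add_ac)
  have rhs: "B * (A * B) + g1 *s (B * A) + g2 *s (B * B) + g3 *s (A * B)
      + (g1 * g2 + g2 * g3) *s B + (g1 * g3) *s A + (g1 * g2 * g3) *s 1
    = X + (g1 * g3) *s A + ((g1 * g2 + g2 * g3) *s B + g2 *s (qd *s B))"
    unfolding sq scale_right_distrib X_def by (simp only: add_ac)
  show ?thesis
    unfolding tt_def A_def[symmetric] B_def[symmetric] g1_def[symmetric] g2_def[symmetric] g3_def[symmetric]
      L R lhs rhs unfolding 1 by (simp only: add_ac)
qed


subsection \<open>Joint eigenvectors\<close>

text \<open>The list may be shorter than n, and then prescribes only the first Jucys-Murphy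
  eigenvalues. The zero element qualifies for every list, so that an impossible list is expressed by
  the conclusion w = 0.\<close>

definition eigen :: "int list \<Rightarrow> 'a \<Rightarrow> bool" where
  "eigen es w \<longleftrightarrow> (\<forall>k<length es. J k * w = Q (es ! k) *s w)"

lemma eigen_Nil [simp]: "eigen [] w"
  by (simp add: eigen_def)

lemma eigen_snoc: "eigen (es @ [e]) w \<longleftrightarrow> eigen es w \<and> J (length es) * w = Q e *s w"
  by (auto simp: eigen_def nth_append less_Suc_eq)

lemma eigen_append1: "eigen (es @ fs) w \<Longrightarrow> eigen es w"
  by (auto simp: eigen_def nth_append split: if_splits)

lemma eigen_append2: "eigen (es @ [e, f]) w \<longleftrightarrow>
    eigen es w \<and> J (length es) * w = Q e *s w \<and> J (Suc (length es)) * w = Q f *s w"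
  using eigen_snoc[of "es @ [e]" f w] by (simp add: eigen_snoc)

lemma eigen_scale: "eigen es w \<Longrightarrow> eigen es (c *s w)"
  by (simp add: eigen_def mult_scale mult.commute)

lemma eigen_mult_left:
  assumes "\<And>k. k < length es \<Longrightarrow> x * J k = J k * x" "eigen es w"
  shows "eigen es (x * w)"
  unfolding eigen_def
proof (intro allI impI)
  fix k assume k: "k < length es"
  have "J k * (x * w) = x * (J k * w)" using assms(1)[OF k] by (simp add: mult.assoc[symmetric])
  then show "J k * (x * w) = Q (es ! k) *s (x * w)" using assms(2) k by (simp add: eigen_def mult_scale)
qed

lemma eigen_S: "length es \<le> k \<Longrightarrow> k + 1 < n \<Longrightarrow> eigen es w \<Longrightarrow> eigen es (S k * w)"
  by (rule eigen_mult_left) (auto intro: S_J_above)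

lemma eigen_poly_J:
  "length es \<le> n \<Longrightarrow> j < n \<Longrightarrow> eigen es w \<Longrightarrow> eigen es (poly_eval p (J j) * w)"
  by (rule eigen_mult_left) (auto intro!: poly_eval_comm[symmetric] J_commute)

text \<open>Moving \<open>J k\<close> or \<open>J (Suc k)\<close> past \<open>S k\<close> leaves a
  multiple of w behind. The summand g of the Baxterized generator absorbs it: with eigenvalues
  \<alpha> and \<beta>, the number g is the solution of (qd + g) \<beta> = \<alpha> g.\<close>

lemma eigen_tt:
  assumes "eigen es w" "Suc k < length es" "length es \<le> n" "Q (es ! k - es ! Suc k) \<noteq> 1"
  shows "eigen (swap_at k es) (tt k (es ! k - es ! Suc k) * w)"
  unfolding eigen_def
proof (intro allI impI)
  fix j assume "j < length (swap_at k es)"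
  then have j: "j < length es" by simp
  define \<alpha> \<beta> g where "\<alpha> = Q (es ! k)" and "\<beta> = Q (es ! Suc k)" and "g = coef (es ! k - es ! Suc k)"
  have ab: "J k * w = \<alpha> *s w" "J (Suc k) * w = \<beta> *s w"
    using assms by (auto simp: eigen_def \<alpha>_def \<beta>_def)
  have "\<beta> \<noteq> 0" "\<alpha> \<noteq> \<beta>" using assms(4) by (auto simp: \<alpha>_def \<beta>_def Q_diff)
  then have "(x + x / (\<alpha> / \<beta> - 1)) * \<beta> = \<alpha> * (x / (\<alpha> / \<beta> - 1))" for x
    by (simp add: field_simps)
  then have g: "(qd + g) * \<beta> = \<alpha> * g"
    unfolding g_def coef_def Q_diff \<alpha>_def[symmetric] \<beta>_def[symmetric] .
  have t: "tt k (es ! k - es ! Suc k) * w = S k * w + g *s w"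
    by (simp add: tt_def g_def distrib_right scale_mult)
  have k: "k + 1 < n" using assms by simp
  consider "j = k" | "j = Suc k" | "j < k" | "j \<ge> k + 2" by linarith
  then show "J j * (tt k (es ! k - es ! Suc k) * w) =
      Q (swap_at k es ! j) *s (tt k (es ! k - es ! Suc k) * w)"
  proof cases
    case 1
    have "J k * (S k * w) = S k * (J (Suc k) * w) - qd *s (J (Suc k) * w)"
      using S_J_Suc[OF k] by (simp add: mult.assoc[symmetric] distrib_right scale_mult)
    then have "J k * (S k * w + g *s w) = \<beta> *s (S k * w) + (\<alpha> * g - qd * \<beta>) *s w"
      by (simp add: distrib_left mult_scale ab scale_left_diff_distrib mult.commute)
    also have "\<alpha> * g - qd * \<beta> = \<beta> * g" using g by (simp add: algebra_simps)
    finally show ?thesis using 1 assms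
      by (simp add: t nth_swap_at \<beta>_def[symmetric] scale_right_distrib)
  next
    case 2
    have "J (Suc k) * (S k * w) = S k * (J k * w) + qd *s (J (Suc k) * w)"
      using J_S[OF k] by (simp add: mult.assoc[symmetric] distrib_right scale_mult)
    then have "J (Suc k) * (S k * w + g *s w) = \<alpha> *s (S k * w) + ((qd + g) * \<beta>) *s w"
      by (simp add: distrib_left mult_scale ab scale_left_distrib distrib_right mult.commute add.assoc)
    then show ?thesis using 2 assms unfolding g
      by (simp add: t nth_swap_at \<alpha>_def[symmetric] scale_right_distrib)
  next
    case 3
    then have "J j * S k = S k * J j" using S_J_above k by simp
    then have "J j * (S k * w) = S k * (J j * w)" by (simp add: mult.assoc[symmetric])
    then show ?thesis using 3 assms j
      by (simp add: t nth_swap_at distrib_left mult_scale eigen_def scale_right_distrib mult.commute)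
  next
    case 4
    then have "J j * S k = S k * J j" using S_J_below assms j by simp
    then have "J j * (S k * w) = S k * (J j * w)" by (simp add: mult.assoc[symmetric])
    then show ?thesis using 4 assms j
      by (simp add: t nth_swap_at distrib_left mult_scale eigen_def scale_right_distrib mult.commute)
  qed
qed


subsection \<open>Sorting paths\<close>

text \<open>The element d is a product of Baxterized generators leading from the sorted word, where
  the rows are filled one after the other, up to \<open>ws\<close>: it turns eigenvectors for
  \<open>contents (sort ws)\<close> into eigenvectors for \<open>contents ws\<close>. The argument
  of \<open>tt\<close> is therefore the content difference at k and k + 1 in the swapped word, not
  in \<open>ws\<close>.\<close>

inductive sort_path :: "nat list \<Rightarrow> 'a \<Rightarrow> bool" where
  sorted: "sorted ws \<Longrightarrow> sort_path ws 1"
| step: "Suc k < length ws \<Longrightarrow> ws ! k > ws ! Suc k \<Longrightarrow> sort_path (swap_at k ws) d \<Longrightarrow>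
    sort_path ws (tt k (contents ws ! Suc k - contents ws ! k) * d)"

lemma not_sorted_descent:
  assumes "\<not> sorted ws"
  obtains k where "Suc k < length ws" "ws ! k > ws ! Suc k"
  using assms unfolding sorted_iff_nth_Suc by (meson not_le)

lemma sort_path_exists: "\<exists>d. sort_path ws d"
proof (induction ws rule: measure_induct_rule[of disorder])
  case (less ws)
  show ?case
  proof (cases "sorted ws")
    case False
    then obtain k where k: "Suc k < length ws" "ws ! k > ws ! Suc k" by (rule not_sorted_descent)
    then show ?thesis using less[OF disorder_swap_at[OF k]] sort_path.step by blast
  qed (use sort_path.sorted in blast)
qed

lemma content_differences:
  assumes "lattice ws" "length ws \<le> n" "Suc k < length ws" "ws ! k > ws ! Suc k"
  defines "d \<equiv> contents ws ! Suc k - contents ws ! k"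
  shows "Q d \<noteq> 1" "tt_norm d \<noteq> 0" "Q (- d) \<noteq> 1"
proof -
  have "lattice (swap_at k ws)" using assms lattice_swap_at by blast
  then have "2 \<le> \<bar>d\<bar>" "\<bar>d\<bar> < int n"
    using contents_admissible[of ws k] assms by auto
  then show "Q d \<noteq> 1" "tt_norm d \<noteq> 0" "Q (- d) \<noteq> 1"
    using Q_neq_1[of d] Q_neq_1[of "- d"] tt_norm_nonzero by auto
qed

text \<open>At a descent both boxes are addable to the same shape, so their contents differ by at
  least 2 and every factor of d has nonzero norm. The list \<open>es\<close> carries eigenvalues of
  further Jucys-Murphy elements, which exchanges inside the prefix leave alone.\<close>

lemma sort_path_invertible:
  assumes "sort_path ws d" "lattice ws" "length ws \<le> n"
  shows "\<exists>b. b * d = 1 \<and> d * b = 1 \<and>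
    (\<forall>es e. length ws + length es \<le> n \<longrightarrow>
      eigen (contents (sort ws) @ es) e \<longrightarrow> eigen (contents ws @ es) (d * e)) \<and>
    (\<forall>es e. length ws + length es \<le> n \<longrightarrow>
      eigen (contents ws @ es) e \<longrightarrow> eigen (contents (sort ws) @ es) (b * e))"
  using assms
proof (induction rule: sort_path.induct)
  case (sorted ws)
  then show ?case by (intro exI[of _ 1]) (simp add: sorted_sort_id)
next
  case (step k ws d)
  define g where "g = contents ws ! Suc k - contents ws ! k"
  have k: "k + 1 < n" using step by simp
  note g = content_differences[OF step(5,6,1,2), folded g_def]
  have l: "lattice (swap_at k ws)" using step lattice_swap_at by blast
  have c: "contents (swap_at k ws) = swap_at k (contents ws)" using step by (intro contents_swap_at) auto
  have s: "sort (swap_at k ws) = sort ws"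
    using step(1) by (metis mset_swap_at mset_sort properties_for_sort sorted_sort)
  obtain b where b: "b * d = 1" "d * b = 1"
    "\<And>es e. length ws + length es \<le> n \<Longrightarrow>
      eigen (contents (sort ws) @ es) e \<Longrightarrow> eigen (swap_at k (contents ws) @ es) (d * e)"
    "\<And>es e. length ws + length es \<le> n \<Longrightarrow>
      eigen (swap_at k (contents ws) @ es) e \<Longrightarrow> eigen (contents (sort ws) @ es) (b * e)"
    using step.IH[OF l] step(6) by (auto simp: s c)
  let ?t = "tt k g" and ?t' = "inverse (tt_norm g) *s tt k (- g)"
  have t: "?t * ?t' = 1" "?t' * ?t = 1"
    using tt_mult[OF k g(1)] g(2) by (auto simp: mult_scale scale_mult)
  have sw: "swap_at k (contents ws @ es) = swap_at k (contents ws) @ es"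
    "swap_at k (swap_at k (contents ws) @ es) = contents ws @ es" for es
    using step(1) by (simp_all add: swap_at_append1 swap_at_swap_at)
  have nth: "(contents ws @ es) ! k = contents ws ! k" "(contents ws @ es) ! Suc k = contents ws ! Suc k"
    "(swap_at k (contents ws) @ es) ! k = contents ws ! Suc k"
    "(swap_at k (contents ws) @ es) ! Suc k = contents ws ! k" for es
    using step(1) nth_swap_at[of k "contents ws" k] nth_swap_at[of k "contents ws" "Suc k"]
    by (simp_all add: nth_append)
  show ?case
  proof (intro exI[of _ "b * ?t'"] conjI allI impI)
    have "b * ?t' * (?t * d) = b * (?t' * ?t) * d" by (simp only: mult.assoc)
    then show "b * ?t' * (tt k (contents ws ! Suc k - contents ws ! k) * d) = 1"
      using t b by (simp add: g_def)
    have "?t * d * (b * ?t') = ?t * (d * b) * ?t'" by (simp only: mult.assoc)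
    then show "tt k (contents ws ! Suc k - contents ws ! k) * d * (b * ?t') = 1"
      using t b by (simp add: g_def)
  next
    fix es e assume "length ws + length es \<le> n" "eigen (contents (sort ws) @ es) e"
    with b(3) have "eigen (swap_at k (contents ws) @ es) (d * e)" by blast
    then have "eigen (contents ws @ es) (tt k (contents ws ! Suc k - contents ws ! k) * (d * e))"
      using eigen_tt[of "swap_at k (contents ws) @ es" "d * e" k] step(1) g \<open>length ws + length es \<le> n\<close>
      by (simp add: sw nth g_def)
    then show "eigen (contents ws @ es) (tt k (contents ws ! Suc k - contents ws ! k) * d * e)"
      by (simp add: mult.assoc)
  next
    fix es e assume *: "length ws + length es \<le> n" "eigen (contents ws @ es) e"
    then have "eigen (swap_at k (contents ws) @ es) (tt k (- g) * e)"
      using eigen_tt[of "contents ws @ es" e k] step(1) g by (simp add: sw nth g_def)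
    then have "eigen (swap_at k (contents ws) @ es) (?t' * e)"
      by (simp add: scale_mult eigen_scale)
    with b(4)[OF *(1)] show "eigen (contents (sort ws) @ es) (b * ?t' * e)"
      by (simp add: mult.assoc)
  qed
qed

text \<open>Two words of the same shape have the same sorted word, so one path is undone and the
  other one followed; both elements are invertible, which keeps w different from 0. It serves to
  move a chosen corner to the last place while the subsequent eigenvalues stay.\<close>

lemma eigen_transfer:
  assumes "lattice u" "lattice v" "mset u = mset v" "length u + length es \<le> n"
    and "eigen (contents u @ es) w" "w \<noteq> 0"
  obtains w' where "eigen (contents v @ es) w'" "w' \<noteq> 0"
proof -
  have len: "length u = length v" using assms(3) by (rule mset_eq_length)
  have s: "sort u = sort v" using assms(3) by (metis mset_sort properties_for_sort sorted_sort)
  obtain d where "sort_path u d" using sort_path_exists by blast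
  then obtain b where b: "d * b = 1" "eigen (contents (sort u) @ es) (b * w)"
    using sort_path_invertible[of u d] assms by auto
  obtain d' where "sort_path v d'" using sort_path_exists by blast
  then obtain b' where b': "b' * d' = 1" "eigen (contents v @ es) (d' * (b * w))"
    using sort_path_invertible[of v d'] assms b(2) len by (auto simp: s)
  moreover have "d * (b' * (d' * (b * w))) = w"
    using b(1) b'(1) by (metis mult.assoc mult_1)
  then have "d' * (b * w) \<noteq> 0" using assms(6) by (metis mult_zero_right)
  ultimately show ?thesis using that by blast
qed


subsection \<open>The spectrum of a Jucys--Murphy element on an eigenspace\<close>

definition exits :: "nat list \<Rightarrow> complex set" where
  "exits u = (\<lambda>a. Q (box_content (shape u) a)) ` addables u"

lemma finite_exits [simp]: "lattice u \<Longrightarrow> finite (exits u)"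
  by (simp add: exits_def)

text \<open>As \<open>root_poly\<close> has simple roots, this says two things at once:
  \<open>J (length u)\<close> is diagonalizable on the eigenvectors belonging to u, and its
  eigenvalues there are contents of addable boxes.\<close>

definition spectrum :: "nat list \<Rightarrow> bool" where
  "spectrum u \<longleftrightarrow>
     (\<forall>w. eigen (contents u) w \<longrightarrow> poly_eval (root_poly (exits u)) (J (length u)) * w = 0)"

lemma spectrum_zero:
  assumes "spectrum u" "lattice u" "eigen (contents u @ [e]) w" "Q e \<notin> exits u"
  shows "w = 0"
proof -
  have "eigen (contents u) w" "J (length u) * w = Q e *s w" using assms(3) by (auto simp: eigen_snoc)
  then have "poly (root_poly (exits u)) (Q e) *s w = 0"
    using assms(1) poly_eval_eigen by (metis spectrum_def)
  then show ?thesis using assms by (simp add: poly_root_poly_eq_0)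
qed

lemma qd_nonzero: "n \<ge> 1 \<Longrightarrow> qd \<noteq> 0"
  using Q_neq_1[of 1] q_nonzero by (auto simp: Q_1 power2_eq_square field_simps)

text \<open>
  If \<open>J k\<close> and \<open>J (k + 1)\<close> had the same eigenvalue on \<open>w\<close>, then \<open>w\<close> and \<open>S k * w\<close> would span a Jordan block
  of \<open>J k\<close>, but \<open>J k\<close> is diagonalizable there.
\<close>

lemma equal_neighbours_zero:
  assumes "spectrum u" "lattice u" "length u + 1 < n" "eigen (contents u @ [b, b]) w"
  shows "w = 0"
proof -
  let ?k = "length u" and ?P = "root_poly (exits u)"
  have w: "eigen (contents u) w" "J ?k * w = Q b *s w" "J (Suc ?k) * w = Q b *s w"
    using assms(4) by (auto simp: eigen_append2)
  have "J ?k * (S ?k * w) = S ?k * (J (Suc ?k) * w) - qd *s (J (Suc ?k) * w)"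
    using S_J_Suc[OF assms(3)] by (simp add: mult.assoc[symmetric] distrib_right scale_mult)
  then have v: "J ?k * (S ?k * w) = Q b *s (S ?k * w) + (- qd * Q b) *s w"
    by (simp only: w mult_scale scale_minus_left mult_minus_left scale_scale) simp
  have "poly_eval ?P (J ?k) * (S ?k * w) = 0"
    using assms eigen_S[of "contents u" ?k w] w by (simp add: spectrum_def)
  then have 1: "poly ?P (Q b) *s (S ?k * w) + (- qd * Q b * poly (pderiv ?P) (Q b)) *s w = 0"
    using poly_eval_jordan[OF w(2) v] by simp
  have 2: "poly ?P (Q b) *s w = 0"
    using assms(1) w poly_eval_eigen[OF w(2)] by (metis spectrum_def)
  show ?thesis
  proof (cases "Q b \<in> exits u")
    case True
    then have "poly (pderiv ?P) (Q b) \<noteq> 0" "poly ?P (Q b) = 0"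
      using assms(2) by (auto simp: pderiv_root_poly_nonzero poly_root_poly_eq_0)
    then show ?thesis using 1 qd_nonzero assms(3) by simp
  next
    case False
    then show ?thesis using 2 assms(2) by (simp add: poly_root_poly_eq_0)
  qed
qed

text \<open>Contents of distinct addable boxes are at distance at least 2, so a content at distance
  1 from one of them belongs to none. Its distance to any of them is at most
  \<open>length u + 2\<close>, which is within the range where genericity separates the powers of
  q.\<close>

lemma adjacent_not_exit:
  assumes "lattice u" "addable (shape u) p" "length u + 2 \<le> n"
    and "\<bar>e - box_content (shape u) p\<bar> = 1"
  shows "Q e \<notin> exits u"
proof
  assume "Q e \<in> exits u"
  then obtain a where a: "addable (shape u) a" "Q e = Q (box_content (shape u) a)"
    by (auto simp: exits_def)
  show False
  proof (cases "a = p")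
    case True
    have "Q e \<noteq> Q (box_content (shape u) p)" using assms(3,4) by (intro Q_neq) linarith+
    then show ?thesis using a(2) True by simp
  next
    case False
    have "2 \<le> \<bar>box_content (shape u) a - box_content (shape u) p\<bar>"
      "\<bar>box_content (shape u) a - box_content (shape u) p\<bar> \<le> int (length u) + 1"
      using addable_contents[OF assms(1) a(1) assms(2) False] by auto
    then show ?thesis using a(2) Q_neq[of e "box_content (shape u) a"] assms by force
  qed
qed

lemma tt_zero: "tt k d * w = 0 \<Longrightarrow> S k * w = - coef d *s w"
  by (simp add: tt_def distrib_right scale_mult eq_neg_iff_add_eq_0)

text \<open>
  Exchanging the first or the last two of the eigenvalues \<open>b, a, b\<close> leads to forbidden sequences, so \<open>S k\<close> and
  \<open>S (k + 1)\<close> act on \<open>w\<close> by the scalars \<open>q\<close> and \<open>- q\<inverse>\<close>, which violates the braid relation.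
\<close>

lemma zigzag_zero:
  assumes "spectrum u" "lattice u" "addable (shape u) p" "length u + 3 \<le> n"
    and "b = box_content (shape u) p" "\<bar>a - b\<bar> = 1"
    and w: "eigen (contents u @ [b, a, b]) w"
  shows "w = 0"
proof (rule ccontr)
  assume nz: "w \<noteq> 0"
  let ?k = "length u" and ?es = "contents u @ [b, a, b]"
  have Qab: "Q (b - a) \<noteq> 1" "Q (a - b) \<noteq> 1" using Q_neq_1 assms by auto
  have nth: "?es ! ?k = b" "?es ! Suc ?k = a" "?es ! Suc (Suc ?k) = b"
    by (simp_all add: nth_append)
  have sw: "swap_at ?k ?es = (contents u @ [a]) @ [b, b]" "swap_at (Suc ?k) ?es = (contents u @ [b, b]) @ [a]"
    using swap_at_append[of "contents u" b a "[b]"] swap_at_append[of "contents u @ [b]" a b "[]"]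
    by simp_all
  have "eigen (contents u @ [a]) (tt ?k (b - a) * w)"
    using eigen_tt[OF w, of ?k] assms(4) Qab unfolding nth sw by (auto intro: eigen_append1)
  then have "tt ?k (b - a) * w = 0"
    using spectrum_zero adjacent_not_exit assms by force
  then have S1: "S ?k * w = - coef (b - a) *s w" by (rule tt_zero)
  have "eigen (contents u @ [b, b]) (tt (Suc ?k) (a - b) * w)"
    using eigen_tt[OF w, of "Suc ?k"] assms(4) Qab unfolding nth sw by (auto intro: eigen_append1)
  then have "tt (Suc ?k) (a - b) * w = 0"
    using equal_neighbours_zero assms by force
  then have S2: "S (Suc ?k) * w = - coef (a - b) *s w" by (rule tt_zero)
  define x y where "x = - coef (b - a)" and "y = - coef (a - b)"
  have "S ?k * (S (Suc ?k) * (S ?k * w)) = S (Suc ?k) * (S ?k * (S (Suc ?k) * w))"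
    using braid[of ?k] assms(4) by (simp add: mult.assoc[symmetric])
  then have "(x * x * y) *s w = (x * y * y) *s w"
    by (simp add: S1 S2 mult_scale x_def[symmetric] y_def[symmetric] ac_simps)
  then have "x * x * y = x * y * y" using nz by simp
  moreover have n: "n \<ge> 1" using assms by simp
  have "(x = q \<and> y = - inverse q) \<or> (x = - inverse q \<and> y = q)"
  proof (cases "a - b = 1")
    case True
    then have "b - a = - 1" by simp
    then show ?thesis unfolding x_def y_def True using coef_1[OF n] coef_minus_1[OF n] by simp
  next
    case False
    then have ab: "a - b = - 1" "b - a = 1" using assms(6) by auto
    show ?thesis unfolding x_def y_def ab using coef_1[OF n] coef_minus_1[OF n] by simp
  qed
  \<comment> \<open>The braid relation forces x = y. Then q^2 = -1 and q^4 = 1, against genericity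
    with exponent k = 2.\<close>
  ultimately have "q = - inverse q" using q_nonzero by auto
  then have "q * q = - 1" using q_nonzero by (metis left_inverse mult_minus_left)
  then have "Q 1 * Q 1 = 1" by (simp add: Q_1 power2_eq_square)
  then have "Q 2 = 1" using Q_add[of 1 1] by simp
  then show False using Q_neq_1[of 2] assms(4) by auto
qed


text \<open>The Baxterized generator with its denominator cleared: if \<open>J k\<close> and
  \<open>J (Suc k)\<close> act on w by \<alpha> and \<beta>, this is \<alpha> - \<beta> times the
  exchange operator. Unlike the latter it makes sense before w is known to be an eigenvector of
  \<open>J (Suc k)\<close>.\<close>

definition intertwiner :: "nat \<Rightarrow> 'a" where
  "intertwiner k = S k * (J k - J (Suc k)) + qd *s J (Suc k)"

lemma intertwiner_J:
  assumes "k + 1 < n"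
  shows "intertwiner k * J k = J (Suc k) * intertwiner k"
    and "intertwiner k * J (Suc k) = J k * intertwiner k"
proof -
  define y z where "y = J k" and "z = J (Suc k)"
  have yz: "z * y = y * z" using J_commute[of k "Suc k"] assms by (simp add: y_def z_def)
  have Sy: "S k * y = z * S k - qd *s z" and Sz: "S k * z = y * S k + qd *s z"
    using S_J S_J_Suc assms by (auto simp: y_def z_def)
  have "S k * (y - z) * y = S k * y * (y - z)" by (simp add: algebra_simps yz)
  also have "\<dots> = z * (S k * (y - z)) - qd *s (z * y) + qd *s (z * z)"
    unfolding Sy by (simp add: algebra_simps scale_mult scale_right_diff_distrib)
  finally show "intertwiner k * J k = J (Suc k) * intertwiner k"
    unfolding intertwiner_def y_def[symmetric] z_def[symmetric]
    by (simp add: distrib_left distrib_right scale_mult mult_scale)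
  have "S k * (y - z) * z = S k * z * (y - z)" by (simp add: algebra_simps yz)
  also have "\<dots> = y * (S k * (y - z)) + qd *s (y * z) - qd *s (z * z)"
    unfolding Sz by (simp add: algebra_simps scale_mult scale_right_diff_distrib yz)
  finally show "intertwiner k * J (Suc k) = J k * intertwiner k"
    unfolding intertwiner_def y_def[symmetric] z_def[symmetric]
    by (simp add: distrib_left distrib_right scale_mult mult_scale)
qed

text \<open>This is the norm relation of the Baxterized generators with cleared denominators. The
  roots belong to \<alpha> + 1 and \<alpha> - 1, the contents of the right and the lower neighbour
  of a box of content \<alpha>.\<close>

lemma intertwiner_square:
  assumes "k + 1 < n" "J k * w = Q \<alpha> *s w"
  shows "intertwiner k * (intertwiner k * w) =
    - (poly_eval ([:- Q (\<alpha> + 1), 1:] * [:- Q (\<alpha> - 1), 1:]) (J (Suc k)) * w)"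
proof -
  define y z where "y = J k" and "z = J (Suc k)"
  have yz: "z * y = y * z" using J_commute[of k "Suc k"] assms by (simp add: y_def z_def)
  have Sy: "S k * y = z * S k - qd *s z" and Sz: "S k * z = y * S k + qd *s z"
    using S_J S_J_Suc assms by (auto simp: y_def z_def)
  have yS: "y * S k = S k * z - qd *s z" and zS: "z * S k = S k * y + qd *s z"
    using Sy Sz by simp_all
  let ?F = "S k * (y - z) + qd *s z"
  have yw: "y * w = Q \<alpha> *s w" using assms by (simp add: y_def)
  have Fz: "?F * z = y * ?F"
    using intertwiner_J(2)[OF assms(1)] by (simp add: intertwiner_def y_def z_def)
  have FS: "?F * S k = z - y + (qd * qd) *s z - qd *s (S k * z)"
  proof -
    have "?F * S k = S k * (y * S k) - S k * (z * S k) + qd *s (z * S k)"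
      by (simp add: distrib_right left_diff_distrib right_diff_distrib scale_mult mult.assoc)
    also have "\<dots> = (S k * S k) * z - qd *s (S k * z) - ((S k * S k) * y + qd *s (S k * z))
        + qd *s (S k * y + qd *s z)"
      unfolding yS zS by (simp add: right_diff_distrib distrib_left mult_scale mult.assoc)
    also have "\<dots> = z - y + (qd * qd) *s z - qd *s (S k * z)"
      unfolding quadratic[OF assms(1)]
      by (simp add: distrib_right scale_mult scale_right_distrib)
    finally show ?thesis .
  qed
  have "?F * ?F = ?F * S k * (y - z) + qd *s (?F * z)"
    by (simp add: distrib_left mult_scale mult.assoc)
  also have "\<dots> = (z - y) * (y - z) + (qd * qd) *s (z * (y - z)) - qd *s (S k * z * (y - z))
      + qd *s (y * S k * (y - z) + qd *s (y * z))"
    unfolding Fz FS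
    by (simp add: left_diff_distrib distrib_right scale_mult mult_scale distrib_left mult.assoc)
  also have "\<dots> = (z - y) * (y - z) + (qd * qd) *s (y * z)"
    unfolding yS
    by (simp add: left_diff_distrib right_diff_distrib distrib_right scale_mult scale_right_diff_distrib
        scale_right_distrib yz mult.assoc)
  finally have FF: "?F * ?F = (z - y) * (y - z) + (qd * qd) *s (z * y)" by (simp add: yz)
  have "?F * (?F * w) = ((z - y) * (y - z) + (qd * qd) *s (z * y)) * w"
    unfolding FF[symmetric] by (simp only: mult.assoc)
  also have "\<dots> = (z * y - z * z - y * y + z * y + (qd * qd) *s (z * y)) * w"
    by (simp add: left_diff_distrib right_diff_distrib yz diff_diff_eq2 add_diff_eq diff_add_eq diff_diff_eq add_ac)
  also have "\<dots> = (2 * Q \<alpha> + qd * qd * Q \<alpha>) *s (z * w) - z * (z * w) - (Q \<alpha> * Q \<alpha>) *s w"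
  proof -
    have "y * (y * w) = (Q \<alpha> * Q \<alpha>) *s w" by (simp add: yw mult_scale)
    moreover have "(2 * Q \<alpha> + qd * qd * Q \<alpha>) *s (z * w) =
        Q \<alpha> *s (z * w) + Q \<alpha> *s (z * w) + (qd * qd) *s (Q \<alpha> *s (z * w))"
      by (simp only: scale_left_distrib[symmetric] scale_scale) simp
    ultimately show ?thesis
      by (simp only: left_diff_distrib distrib_right scale_mult mult.assoc yw mult_scale)
        (simp add: algebra_simps)
  qed
  \<comment> \<open>Since qd^2 + 2 = q^2 + q^(-2), the quadratic polynomial in z splits into the two
    announced linear factors.\<close>
  also have "2 * Q \<alpha> + qd * qd * Q \<alpha> = Q (\<alpha> + 1) + Q (\<alpha> - 1)"
    using q_nonzero by (simp add: Q_add Q_diff Q_1 field_simps power2_eq_square)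
  also have "Q \<alpha> * Q \<alpha> = Q (\<alpha> + 1) * Q (\<alpha> - 1)"
    by (simp add: Q_add Q_diff)
  finally have "?F * (?F * w) = (Q (\<alpha> + 1) + Q (\<alpha> - 1)) *s (z * w) - z * (z * w)
      - (Q (\<alpha> + 1) * Q (\<alpha> - 1)) *s w" .
  also have "\<dots> = - (poly_eval ([:- Q (\<alpha> + 1), 1:] * [:- Q (\<alpha> - 1), 1:]) z * w)"
    unfolding poly_eval_mult
    by (simp add: distrib_right distrib_left scale_mult mult_scale mult.assoc scale_left_distrib
        mult.commute algebra_simps)
  finally show ?thesis by (simp add: intertwiner_def y_def z_def)
qed


lemma lagrange_component:
  assumes "finite A" "s \<in> A" "poly_eval (root_poly A) z * w = 0"
  shows "z * (poly_eval (lagrange A s) z * w) = s *s (poly_eval (lagrange A s) z * w)"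
proof -
  have "poly_eval ([:- s, 1:] * lagrange A s) z * w = 0"
    unfolding lagrange_mult[OF assms(1,2)] by (simp add: poly_eval_smult scale_mult assms(3))
  then have "poly_eval [:- s, 1:] z * (poly_eval (lagrange A s) z * w) = 0"
    by (simp only: poly_eval_mult mult.assoc)
  then show ?thesis by (simp add: left_diff_distrib scale_mult)
qed

lemma lagrange_decomposition:
  "finite A \<Longrightarrow> A \<noteq> {} \<Longrightarrow> w = (\<Sum>s\<in>A. poly_eval (lagrange A s) z * w)"
  by (metis mult_1 poly_eval_1 poly_eval_sum sum_distrib_right sum_lagrange)

text \<open>
  The intertwiner carries the polynomial equation for \<open>J k\<close> over to \<open>J (k + 1)\<close>; its square contributes the two
  additional roots.
\<close>

lemma spectrum_superset:
  assumes "spectrum vs" "lattice (vs @ [r])" "length vs + 1 < n" "eigen (contents (vs @ [r])) w"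
  defines "\<alpha> \<equiv> box_content (shape vs) r"
  shows "poly_eval (root_poly (insert (Q (\<alpha> + 1)) (insert (Q (\<alpha> - 1)) (exits vs))))
    (J (Suc (length vs))) * w = 0"
proof -
  let ?k = "length vs" and ?\<Phi> = "intertwiner (length vs)"
  define R where "R = [:- Q (\<alpha> + 1), 1:] * [:- Q (\<alpha> - 1), 1:]"
  have w: "eigen (contents vs) w" "J ?k * w = Q \<alpha> *s w"
    using assms(4) by (auto simp: contents_append eigen_snoc \<alpha>_def)
  have l: "lattice vs" "addable (shape vs) r" using assms(2) by (auto simp: lattice_append)
  have k: "?k + 1 < n" using assms(3) .
  have "eigen (contents vs) (?\<Phi> * w)"
  proof (rule eigen_mult_left[OF _ w(1)])
    fix j assume "j < length (contents vs)"
    then have j: "j < ?k" by simp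
    have c: "S ?k * J j = J j * S ?k" "J ?k * J j = J j * J ?k" "J (Suc ?k) * J j = J j * J (Suc ?k)"
      using j k S_J_above J_commute by simp_all
    have "S ?k * (J ?k - J (Suc ?k)) * J j = S ?k * J j * (J ?k - J (Suc ?k))"
      by (simp add: left_diff_distrib right_diff_distrib c(2,3) mult.assoc)
    also have "\<dots> = J j * (S ?k * (J ?k - J (Suc ?k)))"
      unfolding c(1) by (simp only: mult.assoc)
    finally show "?\<Phi> * J j = J j * ?\<Phi>"
      by (simp add: intertwiner_def distrib_left distrib_right scale_mult mult_scale c(3))
  qed
  then have "poly_eval (root_poly (exits vs)) (J ?k) * (?\<Phi> * w) = 0"
    using assms(1) by (simp add: spectrum_def)
  then have "?\<Phi> * poly_eval (root_poly (exits vs)) (J ?k) * (?\<Phi> * w) = 0"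
    by (simp add: mult.assoc)
  then have "poly_eval (root_poly (exits vs)) (J (Suc ?k)) * (?\<Phi> * (?\<Phi> * w)) = 0"
    by (simp add: poly_eval_intertwine[OF intertwiner_J(1)[OF k]] mult.assoc)
  then have "poly_eval (root_poly (exits vs) * R) (J (Suc ?k)) * w = 0"
    unfolding intertwiner_square[OF k w(2)] R_def[symmetric] poly_eval_mult[of _ R]
    by (simp add: mult.assoc)
  moreover have "root_poly (insert (Q (\<alpha> + 1)) (insert (Q (\<alpha> - 1)) (exits vs))) = root_poly (exits vs) * R"
  proof -
    have "Q (\<alpha> + 1) \<notin> exits vs" "Q (\<alpha> - 1) \<notin> exits vs"
      using k by (intro adjacent_not_exit[OF l]; simp add: \<alpha>_def)+
    moreover have "Q (\<alpha> + 1) \<noteq> Q (\<alpha> - 1)" using k by (intro Q_neq) auto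
    ultimately show ?thesis using l(1) by (simp add: root_poly_def R_def mult_ac del: mult_pCons_left mult_pCons_right)
  qed
  ultimately show ?thesis by simp
qed

text \<open>A candidate root that is no exit after adding a box in row r has one of three origins.
  If \<alpha> + 1 fails, row r has become as long as row r - 1, whose last box has content \<alpha>
  + 1. If \<alpha> - 1 fails, the last box of row r before the addition is a corner of content
  \<alpha> - 1. An old exit in a row other than r remains an exit, and the old exit r repeats the
  eigenvalue \<alpha>. The first two lead to the zigzag pattern, the last to equal
  neighbours.\<close>

lemma spectrum_exclusion:
  assumes IH: "\<And>u. lattice u \<Longrightarrow> length u \<le> length vs \<Longrightarrow> spectrum u"
    and "lattice (vs @ [r])" "length vs + 1 < n"
    and w: "eigen (contents (vs @ [r]) @ [e]) w"
    and e: "Q e \<in> insert (Q (box_content (shape vs) r + 1))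
      (insert (Q (box_content (shape vs) r - 1)) (exits vs))" "Q e \<notin> exits (vs @ [r])"
  shows "w = 0"
proof (rule ccontr)
  assume nz: "w \<noteq> 0"
  define f \<alpha> where "f = shape vs" and "\<alpha> = box_content f r"
  have l: "lattice vs" "addable f r" using assms(2) by (auto simp: lattice_append f_def)
  have exit: "Q (box_content (add_box f r) a) \<in> exits (vs @ [r])" if "addable (add_box f r) a" for a
    using that by (auto simp: exits_def f_def)
  have w': "eigen (contents vs @ [\<alpha>, x]) w" if "Q e = Q x" for x
    using w that by (auto simp: contents_append eigen_def nth_append \<alpha>_def f_def less_Suc_eq)
  \<comment> \<open>Here b is the content of the corner in row p. Once a tableau of the same shape
    is chosen that adds this corner last, the eigenvalue sequence ends in b, \<alpha>, b.\<close>
  have zigzag: False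
    if p: "f (Suc p) < f p" and b: "b = int (f p) - 1 - int p" and ab: "\<bar>\<alpha> - b\<bar> = 1" and eb: "Q e = Q b"
    for p b
  proof -
    obtain us where us: "lattice (us @ [p])" "mset (us @ [p]) = mset vs"
      using lattice_move_to_end[OF l(1), of p] p by (auto simp: f_def)
    have "length (us @ [p]) = length vs" using us(2) by (metis mset_eq_length)
    then have len: "length us + 1 = length vs" by simp
    have fus: "f = add_box (shape us) p" using us(2) shape_eq_iff[of "us @ [p]" vs] by (simp add: f_def)
    have lu: "lattice us" "addable (shape us) p" using us(1) by (auto simp: lattice_append)
    have bp: "box_content (shape us) p = b" by (simp add: b fus box_content_def add_box_def)
    obtain w1 where w1: "eigen (contents (us @ [p]) @ [\<alpha>, b]) w1" "w1 \<noteq> 0"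
      using eigen_transfer[OF l(1) us(1) us(2)[symmetric] _ w'[OF eb] nz] assms(3) by auto
    then have "eigen (contents us @ [b, \<alpha>, b]) w1" by (simp add: contents_append bp)
    then show False
      using zigzag_zero[of us p b \<alpha> w1] w1(2) lu IH[OF lu(1)] len assms(3) bp ab by auto
  qed
  consider "Q e = Q (\<alpha> + 1)" | "Q e = Q (\<alpha> - 1)" | "Q e \<in> exits vs"
    using e(1) by (auto simp: \<alpha>_def f_def)
  then show False
  proof cases
    case 1
    show False
    proof (cases "addable (add_box f r) r")
      case True
      have "box_content (add_box f r) r = \<alpha> + 1" by (simp add: box_content_def add_box_def \<alpha>_def)
      then show False using exit[OF True] e(2) 1 by simp
    next
      case False
      then have r: "r > 0" "f (r - 1) = Suc (f r)"
        using l(2) by (auto simp: addable_def add_box_def split: if_splits)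
      show False
        using zigzag[of "r - 1" "\<alpha> + 1"] r 1 by (simp add: \<alpha>_def box_content_def of_nat_diff)
    qed
  next
    case 2
    show False
    proof (cases "f (Suc r) = f r")
      case True
      have "box_content (add_box f r) (Suc r) = \<alpha> - 1"
        using True by (simp add: box_content_def add_box_def \<alpha>_def)
      moreover have "addable (add_box f r) (Suc r)" using True by (simp add: addable_def add_box_def)
      ultimately show False using exit e(2) 2 by metis
    next
      case False
      then have "f (Suc r) < f r" using shape_antimono[OF l(1), of r "Suc r"] by (simp add: f_def)
      then show False using zigzag[of r "\<alpha> - 1"] 2 by (simp add: \<alpha>_def box_content_def)
    qed
  next
    case 3
    then obtain a where a: "addable f a" "Q e = Q (box_content f a)" by (auto simp: exits_def f_def)
    show False
    proof (cases "a = r")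
      case True
      then have "eigen (contents vs @ [\<alpha>, \<alpha>]) w" using w' a by (simp add: \<alpha>_def)
      then show False using equal_neighbours_zero[of vs \<alpha> w] IH l assms(3) nz by auto
    next
      case False
      then have "box_content (add_box f r) a = box_content f a" by (simp add: box_content_def add_box_def)
      moreover have "addable (add_box f r) a" using a(1) False by (auto simp: addable_def add_box_def)
      ultimately show False using exit e(2) a(2) by metis
    qed
  qed
qed

text \<open>The finite set B of candidate roots splits w into Lagrange components, each an
  eigenvector of the next Jucys-Murphy element. A component outside the exits vanishes, and the
  polynomial of the exits kills the others. The induction starts from \<open>J 0\<close> = 1, the
  only exit of the empty word being 1.\<close>

theorem spectrum_lattice: "lattice u \<Longrightarrow> length u < n \<Longrightarrow> spectrum u"
proof (induction "length u" arbitrary: u rule: less_induct)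
  case less
  show ?case
  proof (cases u rule: rev_cases)
    case Nil
    then have "exits u = {1}" by (auto simp: exits_def addables_def addable_def box_content_def)
    then show ?thesis using Nil by (simp add: spectrum_def root_poly_def)
  next
    case (snoc vs r)
    define \<alpha> where "\<alpha> = box_content (shape vs) r"
    define B where "B = insert (Q (\<alpha> + 1)) (insert (Q (\<alpha> - 1)) (exits vs))"
    have l: "lattice vs" "lattice (vs @ [r])" using less snoc by (auto simp: lattice_append)
    have k: "length vs + 1 < n" using less snoc by simp
    have IH: "spectrum us" if "lattice us" "length us \<le> length vs" for us
      using less.hyps[of us] that snoc k by simp
    have B: "finite B" "B \<noteq> {}" using l by (auto simp: B_def)
    let ?z = "J (Suc (length vs))"
    show ?thesis unfolding spectrum_def
    proof (intro allI impI)
      fix w assume w: "eigen (contents u) w"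
      have Bw: "poly_eval (root_poly B) ?z * w = 0"
        unfolding B_def \<alpha>_def using spectrum_superset[OF IH l(2) k] l w snoc by simp
      have "poly_eval (root_poly (exits u)) ?z * (poly_eval (lagrange B s) ?z * w) = 0" if s: "s \<in> B" for s
      proof -
        let ?ws = "poly_eval (lagrange B s) ?z * w"
        have zs: "?z * ?ws = s *s ?ws" by (rule lagrange_component[OF B(1) s Bw])
        show ?thesis
        proof (cases "s \<in> exits u")
          case True
          then show ?thesis using poly_eval_eigen[OF zs, of "root_poly (exits u)"] less(2)
            by (simp add: poly_root_poly_eq_0)
        next
          case False
          obtain e where e: "s = Q e" using s by (auto simp: B_def exits_def)
          have "eigen (contents (vs @ [r]) @ [e]) ?ws"
            unfolding eigen_snoc using zs e w snoc k
              eigen_poly_J[of "contents u" "Suc (length vs)" w "lagrange B s"] by simp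
          then have "?ws = 0"
            using spectrum_exclusion[OF IH l(2) k] s False e snoc by (simp add: B_def \<alpha>_def)
          then show ?thesis by simp
        qed
      qed
      then have "poly_eval (root_poly (exits u)) ?z * (\<Sum>s\<in>B. poly_eval (lagrange B s) ?z * w) = 0"
        by (simp add: sum_distrib_left)
      then show "poly_eval (root_poly (exits u)) (J (length u)) * w = 0"
        using lagrange_decomposition[OF B, of w ?z] snoc by simp
    qed
  qed
qed


subsection \<open>The idempotents\<close>

text \<open>Words grow at their right end while primitive recursion consumes the left one; hence the
  reversed word.\<close>

primrec idem_rev :: "nat list \<Rightarrow> 'a" where
  "idem_rev [] = 1"
| "idem_rev (a # rs) = poly_eval (lagrange (exits (rev rs)) (Q (box_content (shape (rev rs)) a)))
     (J (length rs)) * idem_rev rs"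

definition E :: "nat list \<Rightarrow> 'a" where
  "E ws = idem_rev (rev ws)"

lemma E_Nil [simp]: "E [] = 1"
  by (simp add: E_def)

lemma E_snoc: "E (ws @ [a]) =
    poly_eval (lagrange (exits ws) (Q (box_content (shape ws) a))) (J (length ws)) * E ws"
  by (simp add: E_def)

lemma E_comm:
  assumes "\<And>j. j < length ws \<Longrightarrow> x * J j = J j * x"
  shows "x * E ws = E ws * x"
  using assms
proof (induction ws rule: rev_induct)
  case (snoc a ws)
  define p where "p = poly_eval (lagrange (exits ws) (Q (box_content (shape ws) a))) (J (length ws))"
  have "x * p = p * x" unfolding p_def using snoc by (intro poly_eval_comm) simp
  moreover have "x * E ws = E ws * x" using snoc by simp
  ultimately show ?case unfolding E_snoc p_def[symmetric] by (metis mult.assoc)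
qed simp

lemma E_J: "length ws \<le> n \<Longrightarrow> k < n \<Longrightarrow> J k * E ws = E ws * J k"
  by (rule E_comm) (simp add: J_commute)

lemma E_S: "length ws \<le> k \<Longrightarrow> k + 1 < n \<Longrightarrow> S k * E ws = E ws * S k"
  by (rule E_comm) (simp add: S_J_above)

lemma E_eigen: "lattice ws \<Longrightarrow> length ws \<le> n \<Longrightarrow> eigen (contents ws) (E ws)"
proof (induction ws rule: rev_induct)
  case (snoc a ws)
  then have l: "lattice ws" "addable (shape ws) a" "eigen (contents ws) (E ws)"
    by (auto simp: lattice_append)
  then have "spectrum ws" using spectrum_lattice snoc by simp
  then have P: "poly_eval (root_poly (exits ws)) (J (length ws)) * E ws = 0"
    using l by (simp add: spectrum_def)
  let ?b = "Q (box_content (shape ws) a)"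
  have "?b \<in> exits ws" using l by (auto simp: exits_def)
  then have "J (length ws) * E (ws @ [a]) = ?b *s E (ws @ [a])"
    unfolding E_snoc using lagrange_component[OF _ _ P] l by simp
  moreover have "eigen (contents ws) (E (ws @ [a]))"
    unfolding E_snoc using l snoc by (intro eigen_poly_J) auto
  ultimately show ?case by (simp add: contents_append eigen_snoc)
qed simp

lemma Q_content_inj:
  assumes "lattice ws" "length ws < n"
  shows "inj_on (\<lambda>a. Q (box_content (shape ws) a)) (addables ws)"
proof (rule inj_onI, rule ccontr)
  fix a b assume "a \<in> addables ws" "b \<in> addables ws" "a \<noteq> b"
    and e: "Q (box_content (shape ws) a) = Q (box_content (shape ws) b)"
  then have "2 \<le> \<bar>box_content (shape ws) a - box_content (shape ws) b\<bar>"
    "\<bar>box_content (shape ws) a - box_content (shape ws) b\<bar> \<le> int (length ws) + 1"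
    using addable_contents[OF assms(1)] by auto
  then show False using Q_neq[OF _ _] e assms(2) by force
qed

text \<open>The Lagrange polynomials of the exits sum to 1. Since distinct addable boxes have
  distinct contents, the sum over exits can be rewritten as a sum over boxes.\<close>

lemma E_branching:
  assumes "lattice ws" "length ws < n"
  shows "E ws = (\<Sum>a\<in>addables ws. E (ws @ [a]))"
proof -
  have "0 \<in> addables ws" by (simp add: addable_def)
  then have "exits ws \<noteq> {}" unfolding exits_def by blast
  then have "E ws = (\<Sum>s\<in>exits ws. poly_eval (lagrange (exits ws) s) (J (length ws)) * E ws)"
    using assms by (intro lagrange_decomposition) auto
  also have "\<dots> = (\<Sum>a\<in>addables ws. E (ws @ [a]))"
    unfolding E_snoc using sum.reindex[OF Q_content_inj[OF assms]] by (simp add: exits_def)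
  finally show ?thesis .
qed

definition words :: "nat \<Rightarrow> nat list set" where
  "words m = {ws. length ws = m \<and> lattice ws}"

lemma words_Suc: "words (Suc m) = (\<lambda>(ws, a). ws @ [a]) ` Sigma (words m) addables"
  by (auto simp: words_def lattice_append image_iff length_Suc_conv_rev)

lemma words_0 [simp]: "words 0 = {[]}"
  by (auto simp: words_def)

lemma finite_words [simp]: "finite (words m)"
proof (induction m)
  case (Suc m)
  have "finite (addables ws)" if "ws \<in> words m" for ws using that by (simp add: words_def)
  with Suc show ?case unfolding words_Suc by (intro finite_imageI finite_SigmaI)
qed simp

lemma sum_E: "m \<le> n \<Longrightarrow> (\<Sum>ws\<in>words m. E ws) = 1"
proof (induction m)
  case (Suc m)
  have fin: "finite (addables ws)" if "ws \<in> words m" for ws using that by (simp add: words_def)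
  have "(\<Sum>ws\<in>words (Suc m). E ws) = (\<Sum>(ws, a)\<in>Sigma (words m) addables. E (ws @ [a]))"
    unfolding words_Suc by (subst sum.reindex) (auto simp: inj_on_def case_prod_unfold)
  also have "\<dots> = (\<Sum>ws\<in>words m. \<Sum>a\<in>addables ws. E (ws @ [a]))"
    using fin by (subst sum.Sigma) auto
  also have "\<dots> = (\<Sum>ws\<in>words m. E ws)"
    using Suc by (intro sum.cong refl E_branching[symmetric]) (auto simp: words_def)
  finally show ?case using Suc by simp
qed simp

lemma contents_separate:
  assumes "lattice u" "lattice v" "length u = length v" "length u \<le> n" "u \<noteq> v"
  shows "\<exists>k<length u. Q (contents u ! k) \<noteq> Q (contents v ! k)"
  using assms
proof (induction u arbitrary: v rule: rev_induct)
  case (snoc a u)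
  then obtain v' b where v: "v = v' @ [b]" by (cases v rule: rev_cases) auto
  show ?case
  proof (cases "u = v'")
    case False
    then obtain k where "k < length u" "Q (contents u ! k) \<noteq> Q (contents v' ! k)"
      using snoc v by (auto simp: lattice_append)
    then show ?thesis using snoc v
      by (intro exI[of _ k]) (simp add: contents_append nth_append)
  next
    case True
    then have "Q (box_content (shape u) a) \<noteq> Q (box_content (shape u) b)"
      using snoc v inj_onD[OF Q_content_inj[of u], of a b] by (auto simp: lattice_append)
    then show ?thesis using True v
      by (intro exI[of _ "length u"]) (simp add: contents_append nth_append)
  qed
qed simp

lemma E_eigen_nth:
  "lattice v \<Longrightarrow> length v \<le> n \<Longrightarrow> k < length v \<Longrightarrow> J k * E v = Q (contents v ! k) *s E v"
  using E_eigen[of v] by (simp add: eigen_def)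

text \<open>If u and v differ, some \<open>J k\<close>, which commutes with \<open>E u\<close>,
  would act on \<open>E u * w\<close> by two different numbers. As the elements E sum to 1,
  \<open>E v\<close> alone must reproduce w.\<close>

lemma E_action:
  assumes "lattice u" "lattice v" "length u = length v" "length u \<le> n" "eigen (contents v) w"
  shows "E u * w = (if u = v then w else 0)"
proof -
  have ne: "E u * w = 0" if u: "lattice u" "length u = length v" "u \<noteq> v" for u
  proof -
    obtain k where k: "k < length u" "Q (contents u ! k) \<noteq> Q (contents v ! k)"
      using contents_separate[OF u(1) assms(2) u(2) _ u(3)] u(2) assms(3,4) by auto
    have "Q (contents u ! k) *s (E u * w) = J k * (E u * w)"
      using E_eigen_nth[of u k] u k assms by (simp add: mult.assoc[symmetric] scale_mult)
    also have "\<dots> = E u * (J k * w)"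
      using E_J[of u k] k assms u by (simp add: mult.assoc[symmetric])
    also have "\<dots> = Q (contents v ! k) *s (E u * w)"
      using assms(5) k u by (simp add: eigen_def mult_scale)
    finally show ?thesis using k(2) by simp
  qed
  have "w = (\<Sum>ws\<in>words (length v). E ws) * w" using sum_E assms by simp
  also have "\<dots> = (\<Sum>ws\<in>words (length v). if ws = v then E v * w else 0)"
    unfolding sum_distrib_right using ne by (intro sum.cong) (auto simp: words_def)
  also have "\<dots> = E v * w"
    by (subst sum.delta[OF finite_words]) (use assms in \<open>auto simp: words_def\<close>)
  finally show ?thesis using ne assms by auto
qed

lemma E_idem: "lattice u \<Longrightarrow> length u \<le> n \<Longrightarrow> E u * E u = E u"
  using E_action[of u u] E_eigen[of u] by simp

lemma E_snoc_E:
  assumes "lattice u" "length u < n"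
  shows "E (u @ [a]) * E u = E (u @ [a])"
  unfolding E_snoc using E_idem assms by (simp add: mult.assoc)


subsection \<open>The left ideal of an idempotent\<close>

lemma sort_path_step:
  assumes "Suc k < length ws" "ws ! k > ws ! Suc k" "sort_path (swap_at k ws) d"
    and "g = contents ws ! Suc k - contents ws ! k"
  shows "sort_path ws (tt k g * d)"
  using sort_path.step[OF assms(1-3)] assms(4) by simp

text \<open>
  Newman's argument: two descents of a word are joined by far commutativity or by the Yang--Baxter equation.
\<close>

lemma sort_path_unique:
  "sort_path ws d \<Longrightarrow> sort_path ws d' \<Longrightarrow> lattice ws \<Longrightarrow> length ws \<le> n \<Longrightarrow> d = d'"
proof (induction ws arbitrary: d d' rule: measure_induct_rule[of disorder])
  case (less ws)
  have diamond: "tt i (contents ws ! Suc i - contents ws ! i) * d1 =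
      tt j (contents ws ! Suc j - contents ws ! j) * d2"
    if ij: "i < j" "Suc i < length ws" "Suc j < length ws" "ws ! i > ws ! Suc i" "ws ! j > ws ! Suc j"
      and d: "sort_path (swap_at i ws) d1" "sort_path (swap_at j ws) d2" for i j d1 d2
  proof -
    define ci cj where "ci = contents ws ! Suc i - contents ws ! i"
      and "cj = contents ws ! Suc j - contents ws ! j"
    have l: "lattice (swap_at i ws)" "lattice (swap_at j ws)"
      using ij less.prems lattice_swap_at by blast+
    have c: "contents (swap_at i ws) = swap_at i (contents ws)" "contents (swap_at j ws) = swap_at j (contents ws)"
      using ij by (auto intro!: contents_swap_at)
    have IH: "a = b" if "k = i \<or> k = j" "sort_path (swap_at k ws) a" "sort_path (swap_at k ws) b" for k a b
      using less.IH[OF disorder_swap_at that(2,3)] that(1) ij l less.prems by auto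
    show ?thesis
    proof (cases "j = Suc i")
      case False
      then have far: "Suc i < j" using ij by simp
      define ws' where "ws' = swap_at j (swap_at i ws)"
      have ws'_alt: "swap_at i (swap_at j ws) = ws'"
        unfolding ws'_def using far ij by (intro swap_at_far)
      obtain d0 where d0: "sort_path ws' d0" using sort_path_exists by blast
      have "sort_path (swap_at i ws) (tt j cj * d0)"
        by (rule sort_path_step) (use far ij d0 in \<open>simp_all add: ws'_def nth_swap_at c cj_def\<close>)
      then have 1: "d1 = tt j cj * d0" using IH d by blast
      have "sort_path (swap_at j ws) (tt i ci * d0)"
        by (rule sort_path_step) (use far ij d0 in \<open>simp_all add: ws'_alt nth_swap_at c ci_def\<close>)
      then have 2: "d2 = tt i ci * d0" using IH d by blast
      show ?thesis unfolding 1 2 ci_def[symmetric] cj_def[symmetric]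
        using tt_far[of i j ci cj] far ij less.prems by (simp add: mult.assoc[symmetric])
    next
      case True
      \<comment> \<open>Overlapping descents mean three decreasing letters in a row. Both ways of
        reversing them take three exchanges and end in the same word, with the parameters
        \<open>ci\<close>, \<open>ci + cj\<close>, \<open>cj\<close> occurring in opposite orders:
        the two sides of the Yang-Baxter equation.\<close>
      let ?w1 = "swap_at j (swap_at i ws)" and ?w2 = "swap_at i (swap_at j ws)"
      define ws' where "ws' = swap_at i ?w1"
      have ws': "ws' = swap_at j ?w2" using ij True by (simp add: ws'_def swap_at_braid)
      obtain d0 where d0: "sort_path ws' d0" using sort_path_exists by blast
      have c1: "contents ?w1 = swap_at j (swap_at i (contents ws))"
        using ij True by (subst contents_swap_at) (auto simp: c[unfolded True] nth_swap_at)
      have c2: "contents ?w2 = swap_at i (swap_at j (contents ws))"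
        using ij True by (subst contents_swap_at) (auto simp: c[unfolded True] nth_swap_at)
      have p1: "sort_path ?w1 (tt i cj * d0)"
        by (rule sort_path_step) (use ij True d0 in \<open>simp_all add: ws'_def nth_swap_at c1[unfolded True] cj_def\<close>)
      have "sort_path (swap_at i ws) (tt j (ci + cj) * (tt i cj * d0))"
        by (rule sort_path_step) (use ij True p1[unfolded True] in \<open>simp_all add: nth_swap_at c[unfolded True] ci_def cj_def\<close>)
      then have 1: "d1 = tt j (ci + cj) * (tt i cj * d0)" using IH d by blast
      have p2: "sort_path ?w2 (tt j ci * d0)"
        by (rule sort_path_step) (use ij True d0 in \<open>simp_all add: ws' nth_swap_at c2[unfolded True] ci_def\<close>)
      have "sort_path (swap_at j ws) (tt i (ci + cj) * (tt j ci * d0))"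
        by (rule sort_path_step) (use ij True p2[unfolded True] in \<open>simp_all add: nth_swap_at c[unfolded True] ci_def cj_def\<close>)
      then have 2: "d2 = tt i (ci + cj) * (tt j ci * d0)" using IH d by blast
      have "Q ci \<noteq> 1" "Q cj \<noteq> 1"
        using content_differences[OF less.prems(3,4)] ij by (auto simp: ci_def cj_def)
      moreover have "Q (ci + cj) \<noteq> 1"
        using content_differences(1)[OF l(1), of j] ij True less.prems
        by (simp add: c[unfolded True] nth_swap_at ci_def cj_def)
      ultimately have "tt i ci * tt j (ci + cj) * tt i cj = tt j cj * tt i (ci + cj) * tt j ci"
        using yang_baxter[of i ci cj] ij True less.prems by simp
      then show ?thesis unfolding 1 2 ci_def[symmetric] cj_def[symmetric]
        by (simp only: mult.assoc[symmetric])
    qed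
  qed
  show ?case
  proof (cases "sorted ws")
    case True
    then have no: "\<not> (Suc k < length ws \<and> ws ! k > ws ! Suc k)" for k
      unfolding sorted_iff_nth_Suc using not_le by blast
    have "d = 1" using less.prems(1) no by (cases rule: sort_path.cases) auto
    moreover have "d' = 1" using less.prems(2) no by (cases rule: sort_path.cases) auto
    ultimately show ?thesis by simp
  next
    case False
    obtain i d1 where i: "Suc i < length ws" "ws ! i > ws ! Suc i" "sort_path (swap_at i ws) d1"
      "d = tt i (contents ws ! Suc i - contents ws ! i) * d1"
      using less.prems(1) False by (cases rule: sort_path.cases) auto
    obtain j d2 where j: "Suc j < length ws" "ws ! j > ws ! Suc j" "sort_path (swap_at j ws) d2"
      "d' = tt j (contents ws ! Suc j - contents ws ! j) * d2"
      using less.prems(2) False by (cases rule: sort_path.cases) auto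
    consider "i < j" | "j < i" | "i = j" by linarith
    then show ?thesis
    proof cases
      case 1
      then show ?thesis using diamond i j by simp
    next
      case 2
      then show ?thesis using diamond[of j i d2 d1] i j by simp
    next
      case 3
      have "d1 = d2"
        using less.IH[OF disorder_swap_at[OF i(1,2)] i(3)] j(3) 3 less.prems
          lattice_swap_at[OF less.prems(3) i(1,2)] by simp
      then show ?thesis using i j 3 by simp
    qed
  qed
qed

definition same_shape :: "nat list \<Rightarrow> nat list set" where
  "same_shape u = {v. lattice v \<and> mset v = mset u}"

lemma same_shape_length: "v \<in> same_shape u \<Longrightarrow> length v = length u"
  by (auto simp: same_shape_def dest: mset_eq_length)

lemma same_shape_subset: "same_shape u \<subseteq> words (length u)"
  using same_shape_length by (auto simp: words_def same_shape_def)

lemma finite_same_shape [simp]: "finite (same_shape u)"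
  using same_shape_subset finite_words finite_subset by blast

text \<open>The family is \<open>E u\<close> transported to each tableau of the shape, first down to
  the sorted word and then up. Independence of the chosen path makes \<open>tt k d\<close> map
  \<open>F v\<close> to a multiple of F at the exchanged word, up to the norm in one direction. The
  connecting elements x in both directions later give irreducibility.\<close>

lemma young_family:
  assumes "lattice u" "length u = n"
  obtains F where "F u = E u"
    and "\<And>v. v \<in> same_shape u \<Longrightarrow> eigen (contents v) (F v)"
    and "\<And>v. v \<in> same_shape u \<Longrightarrow> \<exists>x. F v = x * E u"
    and "\<And>v. v \<in> same_shape u \<Longrightarrow> \<exists>x. x * F v = E u"
    and "\<And>v k. v \<in> same_shape u \<Longrightarrow> k + 1 < n \<Longrightarrow>
      \<exists>v'\<in>same_shape u. \<exists>x z. S k * F v = x *s F v + z *s F v'"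
proof -
  define D where "D v = (THE d. sort_path v d)" for v
  have D: "sort_path v (D v)" if "lattice v" "length v \<le> n" for v
  proof -
    obtain d where "sort_path v d" using sort_path_exists by blast
    then show ?thesis
      unfolding D_def by (rule theI[where a = d]) (use \<open>sort_path v d\<close> sort_path_unique that in blast)
  qed
  have D_step: "D v = tt k (contents v ! Suc k - contents v ! k) * D (swap_at k v)"
    if "Suc k < length v" "v ! k > v ! Suc k" "lattice v" "length v \<le> n" for v k
    by (rule sort_path_unique[OF D[OF that(3,4)] sort_path.step[OF that(1,2) D] that(3,4)])
       (use that lattice_swap_at[of v k] in auto)
  obtain b where b: "b * D u = 1" "D u * b = 1" "eigen (contents (sort u)) (b * E u)"
    using sort_path_invertible[OF D, of u] E_eigen[of u] assms by (metis append_Nil2 add_0_right le_refl list.size(3))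
  define F where "F v = D v * (b * E u)" for v
  have len: "length v = n" and lat: "lattice v" if "v \<in> same_shape u" for v
    using same_shape_length[OF that] that assms by (auto simp: same_shape_def)
  have s: "sort v = sort u" if "v \<in> same_shape u" for v
    using that by (metis (mono_tags, lifting) mem_Collect_eq mset_sort properties_for_sort same_shape_def sorted_sort)
  have eig: "eigen (contents v) (F v)" if "v \<in> same_shape u" for v
    using sort_path_invertible[OF D, of v] b(3) lat[OF that] len[OF that] s[OF that] unfolding F_def
    by (metis append_Nil2 add_0_right le_refl list.size(3))
  show thesis
  proof (rule that[of F])
    show "F u = E u" using b by (simp add: F_def mult.assoc[symmetric])
    show "eigen (contents v) (F v)" if "v \<in> same_shape u" for v using eig that .
    show "\<exists>x. F v = x * E u" for v by (intro exI[of _ "D v * b"]) (simp add: F_def mult.assoc)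
    show "\<exists>x. x * F v = E u" if v: "v \<in> same_shape u" for v
    proof -
      obtain b' where "b' * D v = 1"
        using sort_path_invertible[OF D, of v] lat[OF v] len[OF v] by auto
      then have "D u * b' * F v = D u * b * E u"
        unfolding F_def by (metis mult.assoc mult_1)
      then show ?thesis using b(2) by auto
    qed
    show "\<exists>v'\<in>same_shape u. \<exists>x z. S k * F v = x *s F v + z *s F v'"
      if v: "v \<in> same_shape u" and k: "k + 1 < n" for v k
    proof -
      have kv: "Suc k < length v" using k len[OF v] by simp
      define d where "d = contents v ! k - contents v ! Suc k"
      have S: "S k * F v = - coef d *s F v + tt k d * F v"
        by (simp add: tt_def distrib_right scale_mult)
      show ?thesis
      proof (cases "v ! k \<noteq> v ! Suc k \<and> lattice (swap_at k v)")
        case True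
        then have v': "swap_at k v \<in> same_shape u" using v kv by (simp add: same_shape_def)
        have "\<exists>z. tt k d * F v = z *s F (swap_at k v)"
        proof (cases "v ! k > v ! Suc k")
          case True
          have "F v = tt k (- d) * F (swap_at k v)"
            using D_step[OF kv True lat[OF v]] len[OF v] by (simp add: F_def d_def mult.assoc)
          moreover have "Q (- d) \<noteq> 1"
            using content_differences(1)[OF lat[OF v] _ kv True] len[OF v] by (simp add: d_def)
          ultimately have "tt k d * F v = tt_norm (- d) *s F (swap_at k v)"
            using tt_mult(1)[OF k, of "- d"] by (simp add: mult.assoc[symmetric] scale_mult)
          then show ?thesis by blast
        next
          case False
          let ?v' = "swap_at k v"
          have "?v' ! k > ?v' ! Suc k" using False True kv by (simp add: nth_swap_at)
          moreover have "contents ?v' = swap_at k (contents v)" using True kv by (intro contents_swap_at) auto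
          ultimately have "D ?v' = tt k d * D v"
            using D_step[of k ?v'] kv True len[OF v] by (simp add: nth_swap_at d_def swap_at_swap_at)
          then have "tt k d * F v = 1 *s F ?v'" by (simp add: F_def mult.assoc)
          then show ?thesis by blast
        qed
        then show ?thesis using S v' by metis
      next
        case False
        \<comment> \<open>No exchange is possible here. \<open>tt k d * F v\<close> would have an
          eigenvalue sequence whose entry at k is adjacent to the content of an addable box, hence
          no exit, so it is 0 and \<open>S k\<close> acts on \<open>F v\<close> by a scalar.\<close>
        then have d: "\<bar>d\<bar> = 1" using contents_inadmissible[OF lat[OF v] kv] by (auto simp: d_def)
        let ?u = "take k v" and ?es = "swap_at k (contents v)"
        have c: "contents v = contents ?u @ [contents v ! k, contents v ! Suc k] @ drop (Suc (Suc k)) (contents v)"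
        proof -
          have "contents v = contents (?u @ drop k v)" by simp
          then have "take k (contents v) = contents ?u"
            using kv by (metis append_eq_conv_conj contents_append length_contents_from length_take min.absorb4 Suc_lessD)
          then show ?thesis using kv
            by (metis Cons_nth_drop_Suc append_Cons append_Nil append_take_drop_id length_contents_from Suc_lessD)
        qed
        have "swap_at k (contents v) = (contents ?u @ [contents v ! Suc k]) @ [contents v ! k] @ drop (Suc (Suc k)) (contents v)"
          by (subst c) (use kv swap_at_append[of "contents ?u" "contents v ! k" "contents v ! Suc k"] in simp)
        moreover have "eigen ?es (tt k d * F v)"
          unfolding d_def using eigen_tt[OF eig[OF v], of k] kv len[OF v] Q_neq_1[of d] d
          by (auto simp: d_def)
        ultimately have "eigen (contents ?u @ [contents v ! Suc k]) (tt k d * F v)"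
          using eigen_append1 by metis
        moreover have "Q (contents v ! Suc k) \<notin> exits ?u"
          using adjacent_not_exit[of ?u "v ! k" "contents v ! Suc k"] lattice_take[OF lat[OF v]]
            lattice_nth[OF lat[OF v], of k] nth_contents[of k v] kv len[OF v] d by (simp add: d_def)
        ultimately have "tt k d * F v = 0"
          using spectrum_zero spectrum_lattice[of ?u] lattice_take[OF lat[OF v]] kv len[OF v] by simp
        then show ?thesis using S v by (metis scale_zero_left)
      qed
    qed
  qed
qed


subsection \<open>Fusion\<close>

definition bx :: "nat \<Rightarrow> complex \<Rightarrow> 'a" where
  "bx k x = S k + (qd / (x - 1)) *s 1"

definition bx_norm :: "complex \<Rightarrow> complex" where
  "bx_norm x = 1 - qd / (x - 1) * (qd + qd / (x - 1))"

text \<open>For x different from 0 and 1 the number - (qd + qd / (x - 1)) is qd / (1 / x - 1), so up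
  to the norm this is the Baxterized generator at the inverse parameter.\<close>

definition bx_inv :: "nat \<Rightarrow> complex \<Rightarrow> 'a" where
  "bx_inv k x = inverse (bx_norm x) *s (S k - (qd + qd / (x - 1)) *s 1)"

lemma bx_inv:
  assumes "k + 1 < n" "bx_norm x \<noteq> 0"
  shows "bx k x * bx_inv k x = 1" "bx_inv k x * bx k x = 1"
proof -
  define g where "g = qd / (x - 1)"
  have "S k - (qd + g) *s 1 = S k + (- (qd + g)) *s 1" by (simp only: scale_minus_left) simp
  moreover have "qd + (g + - (qd + g)) = 0" "qd + (- (qd + g) + g) = 0"
    "1 + g * - (qd + g) = bx_norm x" "1 + - (qd + g) * g = bx_norm x"
    by (simp_all add: bx_norm_def g_def[symmetric] algebra_simps)
  ultimately have "(S k + g *s 1) * (S k - (qd + g) *s 1) = bx_norm x *s 1"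
    "(S k - (qd + g) *s 1) * (S k + g *s 1) = bx_norm x *s 1"
    by (simp_all only: S_shift_mult[OF assms(1)] scale_zero_left add_0_left)
  then show "bx k x * bx_inv k x = 1" "bx_inv k x * bx k x = 1"
    using assms(2) by (simp_all add: bx_def bx_inv_def g_def scale_mult mult_scale)
qed

text \<open>With \<open>v i\<close> in the role of u_{i+1} and x in that of u_j, the value at j - 1
  is Y_j. The recursion removes the outermost generator on each side and leaves x unchanged, which
  is the form needed for an induction on prefixes.\<close>

primrec fusion_factor :: "complex \<Rightarrow> (nat \<Rightarrow> complex) \<Rightarrow> complex \<Rightarrow> nat \<Rightarrow> 'a" where
  "fusion_factor c v x 0 = 1"
| "fusion_factor c v x (Suc i) = bx i (c * v i * x) * fusion_factor c v x i * bx_inv i (v i / x)"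

text \<open>This is \<open>E ws\<close> divided by x - y, where y is the next Jucys-Murphy element,
  written out over the eigenspaces of y.\<close>

definition resolvent :: "nat list \<Rightarrow> complex \<Rightarrow> 'a" where
  "resolvent ws x = (\<Sum>a\<in>addables ws. inverse (x - Q (box_content (shape ws) a)) *s E (ws @ [a]))"

lemma E_snoc_J:
  assumes "lattice ws" "addable (shape ws) a" "length ws < n"
  shows "J (length ws) * E (ws @ [a]) = Q (box_content (shape ws) a) *s E (ws @ [a])"
  using E_eigen[of "ws @ [a]"] assms by (simp add: lattice_append contents_append eigen_snoc)

lemma resolvent:
  assumes "lattice ws" "length ws < n" "x \<notin> exits ws"
  shows "(x *s 1 - J (length ws)) * resolvent ws x = E ws"
    and "resolvent ws x * (x *s 1 - J (length ws)) = E ws"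
    and "resolvent ws x * E ws = resolvent ws x"
proof -
  have "(x *s 1 - J (length ws)) * resolvent ws x = (\<Sum>a\<in>addables ws. E (ws @ [a]))"
    unfolding resolvent_def sum_distrib_left
  proof (rule sum.cong[OF refl])
    fix a assume a: "a \<in> addables ws"
    then have "x - Q (box_content (shape ws) a) \<noteq> 0" using assms(3) by (auto simp: exits_def)
    moreover have "(x *s 1 - J (length ws)) * E (ws @ [a]) = (x - Q (box_content (shape ws) a)) *s E (ws @ [a])"
      using E_snoc_J a assms by (simp add: left_diff_distrib scale_mult scale_left_diff_distrib)
    ultimately show "(x *s 1 - J (length ws)) * inverse (x - Q (box_content (shape ws) a)) *s E (ws @ [a])
        = E (ws @ [a])"
      by (simp add: mult_scale)
  qed
  then show 1: "(x *s 1 - J (length ws)) * resolvent ws x = E ws"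
    using E_branching assms by simp
  have "J (length ws) * resolvent ws x = resolvent ws x * J (length ws)"
    unfolding resolvent_def sum_distrib_left sum_distrib_right
    by (intro sum.cong refl) (use assms E_J in \<open>simp add: scale_mult mult_scale\<close>)
  then have "(x *s 1 - J (length ws)) * resolvent ws x = resolvent ws x * (x *s 1 - J (length ws))"
    by (simp add: left_diff_distrib right_diff_distrib scale_mult mult_scale)
  then show "resolvent ws x * (x *s 1 - J (length ws)) = E ws" using 1 by simp
  show "resolvent ws x * E ws = resolvent ws x"
    unfolding resolvent_def sum_distrib_right
    by (intro sum.cong refl) (use assms E_snoc_E in \<open>simp add: scale_mult\<close>)
qed

text \<open>From z = T y T one gets T y = z T', where T' = T - qd is the inverse of T. To the right
  of e, where y may be replaced by \<alpha>, the left generator turns c x y - 1 into (c x z - 1) T',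
  and the right one turns x - y into (x - z) T'. So the resolvent for y, flanked by T' and the
  inverse generator, becomes the resolvent for z. The exclusions on x keep the resolvents and
  inverses of all prefixes defined.\<close>

lemma E_fusion_factor:
  assumes "lattice ws" "length ws < n"
    and "\<And>k. k < length ws \<Longrightarrow> v k = Q (contents ws ! k)"
    and "\<And>k. k < length ws \<Longrightarrow> c * v k * x \<noteq> 1 \<and> bx_norm (v k / x) \<noteq> 0 \<and> v k \<noteq> x"
    and "\<And>k. k \<le> length ws \<Longrightarrow> x \<notin> exits (take k ws)"
    and "x \<noteq> 0" "c * x \<noteq> 1"
  shows "E ws * fusion_factor c v x (length ws) =
    ((x - 1) / (c * x - 1)) *s (((c * x) *s J (length ws) - 1) * resolvent ws x)"
  using assms(1-5)
proof (induction ws rule: rev_induct)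
  case Nil
  have ex: "exits [] = {1}" "addables [] = {0}"
    by (auto simp: exits_def addables_def addable_def box_content_def)
  have "E [0] = 1" using E_branching[of "[]"] Nil ex by simp
  moreover have "x \<noteq> 1" "c * x - 1 \<noteq> 0" using Nil(5)[of 0] ex assms(7) by auto
  moreover have "(c * x) *s (1 :: 'a) - 1 = (c * x - 1) *s 1" by (simp add: scale_left_diff_distrib)
  ultimately show ?case using ex
    by (simp only: list.size J.simps fusion_factor.simps E_Nil resolvent_def)
       (simp add: box_content_def scale_mult mult_scale)
next
  case (snoc r ws)
  let ?k = "length ws" and ?us = "ws @ [r]"
  define \<alpha> y z e T G G' g where "\<alpha> = Q (box_content (shape ws) r)" and "y = J ?k" and "z = J (Suc ?k)"
    and "e = E ?us" and "T = S ?k" and "G = resolvent ws x" and "G' = resolvent ?us x"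
    and "g = qd / (\<alpha> / x - 1)"
  define \<kappa> where "\<kappa> = (x - 1) / (c * x - 1)"
  have k: "?k + 1 < n" using snoc by simp
  have l: "lattice ws" "addable (shape ws) r" using snoc by (auto simp: lattice_append)
  have va: "v ?k = \<alpha>" using snoc(4)[of ?k] by (simp add: contents_append nth_append \<alpha>_def)
  have ne: "c * \<alpha> * x \<noteq> 1" "bx_norm (\<alpha> / x) \<noteq> 0" "\<alpha> \<noteq> x" using snoc(5)[of ?k] va by auto
  have xe: "x \<notin> exits ws" "x \<notin> exits ?us" using snoc(6)[of ?k] snoc(6)[of "Suc ?k"] by auto
  have IH: "E ws * fusion_factor c v x ?k = \<kappa> *s (((c * x) *s y - 1) * G)"
    unfolding \<kappa>_def y_def G_def
  proof (rule snoc.IH)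
    show "v j = Q (contents ws ! j)" if "j < length ws" for j
      using snoc(4)[of j] that by (simp add: contents_append nth_append)
    show "x \<notin> exits (take j ws)" if "j \<le> length ws" for j using snoc(6)[of j] that by simp
  qed (use l snoc in auto)
  have ee: "e * e = e" unfolding e_def using snoc by (intro E_idem) auto
  have eE: "e * E ws = e" unfolding e_def using l k by (intro E_snoc_E) auto
  have ye: "y * e = \<alpha> *s e" unfolding y_def e_def \<alpha>_def using l k by (intro E_snoc_J) auto
  have ey: "e * y = \<alpha> *s e"
    using ye E_J[of ?us ?k] k by (simp add: y_def e_def)
  have ez: "z * e = e * z" unfolding e_def z_def using k by (intro E_J) auto
  have TE: "T * E ws = E ws * T" unfolding T_def using k by (intro E_S) auto
  have Ty: "T * y = z * T - qd *s z" unfolding T_def y_def z_def using S_J k by simp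
  have G: "(x *s 1 - y) * G = E ws" "G * E ws = G"
    unfolding G_def y_def using resolvent[of ws x] l xe k by auto
  have G': "G' * (x *s 1 - z) = e" "G' * e = G'"
    unfolding G'_def z_def e_def using resolvent[of ?us x] snoc(2) xe k by auto
  have bE: "bx ?k t * E ws = E ws * bx ?k t" for t
    using TE by (simp add: bx_def T_def distrib_left distrib_right scale_mult mult_scale)
  \<comment> \<open>The left generator passes the numerator: its constant h satisfies h c x \<alpha>
    = qd + h, so that together with T y = z T - qd z the terms group into a multiple of T -
    qd.\<close>
  have c1: "e * bx ?k (c * \<alpha> * x) * ((c * x) *s y - 1) = ((c * x) *s z - 1) * (e * (T - qd *s 1))"
  proof -
    define h where "h = qd / (c * \<alpha> * x - 1)"
    have h: "h * (c * x * \<alpha>) = qd + h" 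
    proof -
      define t where "t = c * \<alpha> * x"
      have "a / (t - 1) * t = a + a / (t - 1)" for a
        using ne(1) unfolding t_def[symmetric] by (simp add: field_simps)
      moreover have "c * x * \<alpha> = t" by (simp add: t_def)
      ultimately show ?thesis unfolding h_def t_def[symmetric] by (simp only:)
    qed
    have b: "bx ?k (c * \<alpha> * x) = T + h *s 1" by (simp only: bx_def T_def h_def)
    have "e * bx ?k (c * \<alpha> * x) * ((c * x) *s y - 1) =
        (c * x) *s (e * (T * y)) - e * T + (h * (c * x * \<alpha>)) *s e - h *s e"
      unfolding b
      by (simp add: distrib_left distrib_right right_diff_distrib scale_mult mult_scale ey mult.assoc
          scale_right_distrib mult_ac)
    also have "\<dots> = (c * x) *s (e * z * T) - (c * x * qd) *s (e * z) - e * T + qd *s e"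
      unfolding h Ty by (simp add: right_diff_distrib mult_scale scale_right_diff_distrib scale_left_distrib mult.assoc)
    also have "\<dots> = ((c * x) *s z - 1) * (e * (T - qd *s 1))"
      unfolding ez[symmetric]
      by (simp add: left_diff_distrib right_diff_distrib scale_mult mult_scale scale_right_diff_distrib mult.assoc)
    finally show ?thesis .
  qed
  \<comment> \<open>The right generator passes the denominator in the same way. The constant g at
    parameter \<alpha> / x satisfies g (\<alpha> - x) = qd x.\<close>
  have c2: "(x *s 1 - z) * (e * (T - qd *s 1)) = e * bx ?k (\<alpha> / x) * (x *s 1 - y)"
  proof -
    have g: "g * x - g * \<alpha> = - (qd * x)"
    proof -
      have "\<alpha> / x - 1 = (\<alpha> - x) / x" using assms(6) by (simp add: diff_divide_distrib)
      then have "g * (\<alpha> - x) = qd * x" using ne(3) unfolding g_def by simp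
      then show ?thesis by (simp only: right_diff_distrib) (metis minus_diff_eq)
    qed
    have "e * bx ?k (\<alpha> / x) * (x *s 1 - y) = x *s (e * T) - e * (T * y) + (g * x - g * \<alpha>) *s e"
      by (simp add: bx_def T_def[symmetric] g_def[symmetric] distrib_left distrib_right right_diff_distrib
          scale_mult mult_scale ey mult.assoc scale_left_diff_distrib scale_right_distrib mult.commute[of x])
    also have "\<dots> = x *s (e * T) - e * z * T + qd *s (e * z) - (qd * x) *s e"
      unfolding Ty g by (simp add: right_diff_distrib mult_scale mult.assoc scale_minus_left del: scale_left_diff_distrib)
    also have "\<dots> = (x *s 1 - z) * (e * (T - qd *s 1))"
      unfolding ez[symmetric]
      by (simp add: left_diff_distrib right_diff_distrib scale_mult mult_scale scale_right_diff_distrib mult.assoc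
          mult.commute)
    finally show ?thesis ..
  qed
  \<comment> \<open>Solving the previous identity for the resolvent of z: multiplication by
    \<open>G'\<close> on the left and by G on the right removes the two linear factors, and
    \<open>bx_inv\<close> removes the generator.\<close>
  have c3: "e * (T - qd *s 1) * G * bx_inv ?k (\<alpha> / x) = G'"
  proof -
    have "G' * ((x *s 1 - z) * (e * (T - qd *s 1))) = G' * e * bx ?k (\<alpha> / x) * (x *s 1 - y)"
      unfolding c2 by (simp only: mult.assoc)
    then have "e * (T - qd *s 1) = G' * bx ?k (\<alpha> / x) * (x *s 1 - y)"
      using G' ee by (simp only: mult.assoc[symmetric])
    then have "e * (T - qd *s 1) * G = G' * bx ?k (\<alpha> / x) * E ws"
      using G(1) by (simp only: mult.assoc)
    also have "\<dots> = G' * (e * E ws) * bx ?k (\<alpha> / x)"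
      using bE G'(2) by (metis mult.assoc)
    also have "\<dots> = G' * bx ?k (\<alpha> / x)" using eE G' by simp
    finally show ?thesis using bx_inv(1)[OF k ne(2)] by (simp add: mult.assoc)
  qed
  have "e * fusion_factor c v x (Suc ?k) =
      e * (bx ?k (c * \<alpha> * x) * (E ws * fusion_factor c v x ?k)) * bx_inv ?k (\<alpha> / x)"
  proof -
    have "e * (bx ?k (c * \<alpha> * x) * (E ws * fusion_factor c v x ?k)) =
        e * E ws * bx ?k (c * \<alpha> * x) * fusion_factor c v x ?k"
      using bE by (metis mult.assoc)
    then show ?thesis using eE va by (simp add: mult.assoc)
  qed
  also have "\<dots> = \<kappa> *s (e * bx ?k (c * \<alpha> * x) * ((c * x) *s y - 1) * G * bx_inv ?k (\<alpha> / x))"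
    unfolding IH by (simp only: mult_scale scale_mult mult.assoc)
  also have "\<dots> = \<kappa> *s (((c * x) *s z - 1) * (e * (T - qd *s 1) * G * bx_inv ?k (\<alpha> / x)))"
    unfolding c1 by (simp only: mult.assoc)
  also have "\<dots> = \<kappa> *s (((c * x) *s z - 1) * G')" unfolding c3 ..
  finally show ?case by (simp add: e_def z_def G'_def \<kappa>_def)
qed

end


section \<open>The Hecke algebras as one ring type\<close>

abbreviation hecke_class :: "nat \<Rightarrow> complex \<Rightarrow> nc_poly \<Rightarrow> nc_poly set" where
  "hecke_class n q f \<equiv> hecke_ideal n q +>\<^bsub>free_algebra n\<^esub> f"

lemma free_algebra_simps [simp]:
  "\<one>\<^bsub>free_algebra n\<^esub> = 1" "\<zero>\<^bsub>free_algebra n\<^esub> = 0"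
  "x \<oplus>\<^bsub>free_algebra n\<^esub> y = x + y" "x \<otimes>\<^bsub>free_algebra n\<^esub> y = x * y"
  by (simp_all add: free_algebra_def)

lemma free_scalar_closed [simp]: "free_scalar a \<in> carrier (free_algebra n)"
  by (auto simp: free_algebra_def free_scalar_def zero_gen_word_def split: if_splits)

lemma free_gen_closed: "i \<in> {1..<n} \<Longrightarrow> free_gen i \<in> carrier (free_algebra n)"
  by (auto simp: free_algebra_def free_gen_def split: if_splits)

lemma free_algebra_closed:
  assumes "x \<in> carrier (free_algebra n)" "y \<in> carrier (free_algebra n)"
  shows "x + y \<in> carrier (free_algebra n)" "x * y \<in> carrier (free_algebra n)"
  using ring.ring_simprules(1,5)[OF ring_free_algebra assms] by simp_all

lemma hecke_class_hom: "hecke_class n q \<in> Ring.ring_hom (free_algebra n) (hecke n q)"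
  unfolding hecke_def by (rule ideal.rcos_ring_hom[OF ideal_hecke_ideal])

lemma hecke_class_closed: "x \<in> carrier (free_algebra n) \<Longrightarrow> hecke_class n q x \<in> carrier (hecke n q)"
  by (rule ring_hom_closed[OF hecke_class_hom])

lemma hecke_class_add: "x \<in> carrier (free_algebra n) \<Longrightarrow> y \<in> carrier (free_algebra n) \<Longrightarrow>
    hecke_class n q (x + y) = hecke_class n q x \<oplus>\<^bsub>hecke n q\<^esub> hecke_class n q y"
  using ring_hom_add[OF hecke_class_hom[of n q], of x y] by simp

lemma hecke_class_mult: "x \<in> carrier (free_algebra n) \<Longrightarrow> y \<in> carrier (free_algebra n) \<Longrightarrow>
    hecke_class n q (x * y) = hecke_class n q x \<otimes>\<^bsub>hecke n q\<^esub> hecke_class n q y"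
  using ring_hom_mult[OF hecke_class_hom[of n q], of x y] by simp

lemma hecke_class_one: "hecke_class n q 1 = \<one>\<^bsub>hecke n q\<^esub>"
  using ring_hom_one[OF hecke_class_hom[of n q]] by simp

lemma hecke_class_zero: "hecke_class n q 0 = \<zero>\<^bsub>hecke n q\<^esub>"
  using ring_hom_zero[OF hecke_class_hom[of n q] ring_free_algebra ring_hecke] by simp

lemma hecke_class_surj:
  assumes "h \<in> carrier (hecke n q)"
  obtains f where "f \<in> carrier (free_algebra n)" "h = hecke_class n q f"
  using assms by (auto simp: hecke_def FactRing_def A_RCOSETS_def')

lemma hecke_class_eq:
  assumes "x \<in> carrier (free_algebra n)" "y \<in> carrier (free_algebra n)" "x - y \<in> hecke_ideal n q"
  shows "hecke_class n q x = hecke_class n q y"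
proof -
  interpret I: ideal "hecke_ideal n q" "free_algebra n" by (rule ideal_hecke_ideal)
  have c: "x - y \<in> carrier (free_algebra n)" using assms(3) I.a_subset by blast
  have "hecke_class n q (x - y) = hecke_class n q 0"
    using I.a_rcos_const[OF assms(3)] hecke_class_zero[of n q] by (simp add: hecke_def FactRing_def)
  then have "hecke_class n q ((x - y) + y) = hecke_class n q (0 + y)"
    using c assms I.zero_closed by (simp only: hecke_class_add free_algebra_simps)
  then show ?thesis by simp
qed

lemma free_scalar_simps: "free_scalar (a + b) = free_scalar a + free_scalar b"
  "free_scalar (a * b) = free_scalar a * free_scalar b" "free_scalar 1 = 1" "free_scalar 0 = 0"
  by (simp_all add: free_scalar_def single_add mult_single)

lemma update_eq_add: "w \<notin> Poly_Mapping.keys f \<Longrightarrow> Poly_Mapping.update w b f = f + Poly_Mapping.single w b"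
  by (rule poly_mapping_eqI)
     (auto simp: lookup_update lookup_add lookup_single in_keys_iff)

lemma free_scalar_commute: "free_scalar a * f = f * free_scalar a"
proof (induction f rule: update_induct)
  case (update f w b)
  then show ?case
    by (simp add: update_eq_add distrib_left distrib_right free_scalar_def mult_single mult.commute)
qed simp

lemma free_algebra_induct [consumes 1]:
  assumes "f \<in> carrier (free_algebra n)"
    and scalar: "\<And>a. P (free_scalar a)" and gen: "\<And>i. i \<in> {1..<n} \<Longrightarrow> P (free_gen i)"
    and add: "\<And>f g. f \<in> carrier (free_algebra n) \<Longrightarrow> g \<in> carrier (free_algebra n) \<Longrightarrow> P f \<Longrightarrow> P g \<Longrightarrow> P (f + g)"
    and mult: "\<And>f g. f \<in> carrier (free_algebra n) \<Longrightarrow> g \<in> carrier (free_algebra n) \<Longrightarrow> P f \<Longrightarrow> P g \<Longrightarrow> P (f * g)"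
  shows "P f"
proof -
  have word: "Poly_Mapping.single (Word l) b \<in> carrier (free_algebra n) \<and> P (Poly_Mapping.single (Word l) b)"
    if "set l \<subseteq> {1..<n}" for l b
    using that
  proof (induction l)
    case Nil
    have "Poly_Mapping.single (Word []) b = free_scalar b" by (simp add: free_scalar_def zero_gen_word_def)
    then show ?case using scalar by simp
  next
    case (Cons i l)
    have "Poly_Mapping.single (Word (i # l)) b = free_gen i * Poly_Mapping.single (Word l) b"
      by (simp add: free_gen_def mult_single plus_gen_word_def)
    then show ?case using Cons gen free_gen_closed mult free_algebra_closed by auto
  qed
  have "f \<in> carrier (free_algebra n) \<longrightarrow> P f"
  proof (induction f rule: update_induct)
    case const
    then show ?case using scalar[of 0] by (simp add: free_scalar_simps)
  next
    case (update f w b)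
    show ?case
    proof
      assume "Poly_Mapping.update w b f \<in> carrier (free_algebra n)"
      then have "\<forall>v\<in>insert w (Poly_Mapping.keys f). set (letters v) \<subseteq> {1..<n}"
        using update by (auto simp: free_algebra_def keys_update split: if_splits)
      then have "f \<in> carrier (free_algebra n)" "set (letters w) \<subseteq> {1..<n}" by (auto simp: free_algebra_def)
      then show "P (Poly_Mapping.update w b f)"
        using update word[of "letters w" b] add by (simp add: update_eq_add)
    qed
  qed
  then show ?thesis using assms(1) by simp
qed

lemma hecke_scalar_closed [simp]: "hecke_scalar n q a \<in> carrier (hecke n q)"
  by (simp add: hecke_scalar_def hecke_class_closed)

lemma hecke_T_closed: "i \<in> {1..<n} \<Longrightarrow> hecke_T n q i \<in> carrier (hecke n q)"
  by (simp add: hecke_T_def hecke_class_closed free_gen_closed)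

lemma hecke_scalar_simps:
  "hecke_scalar n q (a + b) = hecke_scalar n q a \<oplus>\<^bsub>hecke n q\<^esub> hecke_scalar n q b"
  "hecke_scalar n q (a * b) = hecke_scalar n q a \<otimes>\<^bsub>hecke n q\<^esub> hecke_scalar n q b"
  "hecke_scalar n q 1 = \<one>\<^bsub>hecke n q\<^esub>" "hecke_scalar n q 0 = \<zero>\<^bsub>hecke n q\<^esub>"
  by (simp_all add: hecke_scalar_def free_scalar_simps hecke_class_add hecke_class_mult hecke_class_one hecke_class_zero)

lemma hecke_scalar_commute:
  "h \<in> carrier (hecke n q) \<Longrightarrow> hecke_scalar n q a \<otimes>\<^bsub>hecke n q\<^esub> h = h \<otimes>\<^bsub>hecke n q\<^esub> hecke_scalar n q a"
  by (elim hecke_class_surj)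
     (simp add: hecke_scalar_def hecke_class_mult[symmetric] free_scalar_commute)

lemma hecke_induct [consumes 1, case_names scalar gen add mult]:
  assumes "h \<in> carrier (hecke n q)"
    and scalar: "\<And>a. P (hecke_scalar n q a)" and gen: "\<And>i. i \<in> {1..<n} \<Longrightarrow> P (hecke_T n q i)"
    and add: "\<And>x y. x \<in> carrier (hecke n q) \<Longrightarrow> y \<in> carrier (hecke n q) \<Longrightarrow> P x \<Longrightarrow> P y \<Longrightarrow> P (x \<oplus>\<^bsub>hecke n q\<^esub> y)"
    and mult: "\<And>x y. x \<in> carrier (hecke n q) \<Longrightarrow> y \<in> carrier (hecke n q) \<Longrightarrow> P x \<Longrightarrow> P y \<Longrightarrow> P (x \<otimes>\<^bsub>hecke n q\<^esub> y)"
  shows "P h"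
proof -
  obtain f where f: "f \<in> carrier (free_algebra n)" "h = hecke_class n q f"
    using assms(1) by (rule hecke_class_surj)
  from f(1) have "P (hecke_class n q f)"
  proof (induction f rule: free_algebra_induct)
    case (3 f g)
    then show ?case using add by (simp add: hecke_class_add hecke_class_closed)
  next
    case (4 f g)
    then show ?case using mult by (simp add: hecke_class_mult hecke_class_closed)
  qed (use scalar gen in \<open>simp_all add: hecke_scalar_def hecke_T_def\<close>)
  then show ?thesis using f by simp
qed

lemma hecke_relation_class:
  assumes "x - y \<in> hecke_relations n q" "x \<in> carrier (free_algebra n)" "y \<in> carrier (free_algebra n)"
  shows "hecke_class n q x = hecke_class n q y"
  using assms ring.genideal_self[OF ring_free_algebra hecke_relations_carrier, of n q]
  by (intro hecke_class_eq) (auto simp: hecke_ideal_def)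

lemma hecke_braid:
  assumes "i \<in> {1..<n}" "i + 1 \<in> {1..<n}"
  shows "hecke_T n q i \<otimes>\<^bsub>hecke n q\<^esub> hecke_T n q (i + 1) \<otimes>\<^bsub>hecke n q\<^esub> hecke_T n q i =
    hecke_T n q (i + 1) \<otimes>\<^bsub>hecke n q\<^esub> hecke_T n q i \<otimes>\<^bsub>hecke n q\<^esub> hecke_T n q (i + 1)"
proof -
  note g = free_gen_closed[OF assms(1)] free_gen_closed[OF assms(2)]
  have "hecke_class n q (free_gen i * free_gen (i+1) * free_gen i) =
      hecke_class n q (free_gen (i+1) * free_gen i * free_gen (i+1))"
    using assms by (intro hecke_relation_class free_algebra_closed g) (unfold hecke_relations_def, blast)
  then show ?thesis using g by (simp add: hecke_T_def hecke_class_mult free_algebra_closed del: One_nat_def)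
qed

lemma hecke_far:
  assumes "i \<in> {1..<n}" "j \<in> {1..<n}" "i + 1 < j"
  shows "hecke_T n q i \<otimes>\<^bsub>hecke n q\<^esub> hecke_T n q j = hecke_T n q j \<otimes>\<^bsub>hecke n q\<^esub> hecke_T n q i"
proof -
  note g = free_gen_closed[OF assms(1)] free_gen_closed[OF assms(2)]
  have "\<bar>int i - int j\<bar> > 1" using assms(3) by simp
  then have "free_gen i * free_gen j - free_gen j * free_gen i \<in> hecke_relations n q"
    using assms(1,2) unfolding hecke_relations_def by blast
  then have "hecke_class n q (free_gen i * free_gen j) = hecke_class n q (free_gen j * free_gen i)"
    by (intro hecke_relation_class free_algebra_closed g)
  then show ?thesis using g by (simp add: hecke_T_def hecke_class_mult)
qed

lemma hecke_quadratic:
  assumes "i \<in> {1..<n}"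
  shows "hecke_T n q i \<otimes>\<^bsub>hecke n q\<^esub> hecke_T n q i =
    hecke_scalar n q (q - inverse q) \<otimes>\<^bsub>hecke n q\<^esub> hecke_T n q i \<oplus>\<^bsub>hecke n q\<^esub> \<one>\<^bsub>hecke n q\<^esub>"
proof -
  note g = free_gen_closed[OF assms(1)]
  have one: "1 \<in> carrier (free_algebra n)" using free_scalar_closed[of 1 n] by (simp add: free_scalar_simps)
  have "free_gen i * free_gen i - (free_scalar (q - inverse q) * free_gen i + 1) \<in> hecke_relations n q"
    using assms unfolding hecke_relations_def diff_diff_eq[symmetric] by blast
  then have "hecke_class n q (free_gen i * free_gen i) =
      hecke_class n q (free_scalar (q - inverse q) * free_gen i + 1)"
    by (intro hecke_relation_class free_algebra_closed g one free_scalar_closed)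
  then show ?thesis using g one
    by (simp add: hecke_T_def hecke_scalar_def hecke_class_mult hecke_class_add hecke_class_one free_algebra_closed)
qed

text \<open>
  The Hecke algebras depend on parameters, so they are not types. Their product over all parameters is
  a ring type to which the results about \<^locale>\<open>hecke_algebra\<close> apply: at the parameters of interest the
  generators are the \<open>T\<^sub>i\<close>, at all other parameters the scalar \<open>q\<close>, which satisfies the same relations.
\<close>

typedef hecke_family =
  "{f :: nat \<times> complex \<Rightarrow> nc_poly set. \<forall>p. f p \<in> carrier (hecke (fst p) (snd p))}"
  morphisms coord Family
  by (rule exI[of _ "\<lambda>p. hecke_scalar (fst p) (snd p) 0"]) simp

lemma coord_closed [simp]: "coord x (n, q) \<in> carrier (hecke n q)"
  using coord[of x] by auto

lemma coord_Family:
  "(\<And>n q. f (n, q) \<in> carrier (hecke n q)) \<Longrightarrow> coord (Family f) = f"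
  by (subst Family_inverse) auto

lemma hecke_family_eqI: "(\<And>n q. coord x (n, q) = coord y (n, q)) \<Longrightarrow> x = y"
  by (simp add: coord_inject[symmetric] fun_eq_iff)

instantiation hecke_family :: ring_1
begin

definition "0 = Family (\<lambda>p. \<zero>\<^bsub>hecke (fst p) (snd p)\<^esub>)"
definition "1 = Family (\<lambda>p. \<one>\<^bsub>hecke (fst p) (snd p)\<^esub>)"
definition "x + y = Family (\<lambda>p. coord x p \<oplus>\<^bsub>hecke (fst p) (snd p)\<^esub> coord y p)"
definition "x * y = Family (\<lambda>p. coord x p \<otimes>\<^bsub>hecke (fst p) (snd p)\<^esub> coord y p)"
definition "- x = Family (\<lambda>p. \<ominus>\<^bsub>hecke (fst p) (snd p)\<^esub> coord x p)"
definition "x - y = Family (\<lambda>p. coord x p \<ominus>\<^bsub>hecke (fst p) (snd p)\<^esub> coord y p)"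

lemma coord_simps:
  "coord 0 (n, q) = \<zero>\<^bsub>hecke n q\<^esub>"
  "coord 1 (n, q) = \<one>\<^bsub>hecke n q\<^esub>"
  "coord (x + y) (n, q) = coord x (n, q) \<oplus>\<^bsub>hecke n q\<^esub> coord y (n, q)"
  "coord (x * y) (n, q) = coord x (n, q) \<otimes>\<^bsub>hecke n q\<^esub> coord y (n, q)"
  "coord (- x) (n, q) = \<ominus>\<^bsub>hecke n q\<^esub> coord x (n, q)"
  "coord (x - y) (n, q) = coord x (n, q) \<ominus>\<^bsub>hecke n q\<^esub> coord y (n, q)"
proof -
  have c: "\<zero>\<^bsub>hecke n q\<^esub> \<in> carrier (hecke n q)" "\<one>\<^bsub>hecke n q\<^esub> \<in> carrier (hecke n q)"
    "coord x (n, q) \<oplus>\<^bsub>hecke n q\<^esub> coord y (n, q) \<in> carrier (hecke n q)"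
    "coord x (n, q) \<otimes>\<^bsub>hecke n q\<^esub> coord y (n, q) \<in> carrier (hecke n q)"
    "\<ominus>\<^bsub>hecke n q\<^esub> coord x (n, q) \<in> carrier (hecke n q)"
    "coord x (n, q) \<ominus>\<^bsub>hecke n q\<^esub> coord y (n, q) \<in> carrier (hecke n q)" for n q
  proof -
    interpret H: ring "hecke n q" by (rule ring_hecke)
    show "\<zero>\<^bsub>hecke n q\<^esub> \<in> carrier (hecke n q)" "\<one>\<^bsub>hecke n q\<^esub> \<in> carrier (hecke n q)"
      "coord x (n, q) \<oplus>\<^bsub>hecke n q\<^esub> coord y (n, q) \<in> carrier (hecke n q)"
      "coord x (n, q) \<otimes>\<^bsub>hecke n q\<^esub> coord y (n, q) \<in> carrier (hecke n q)"
      "\<ominus>\<^bsub>hecke n q\<^esub> coord x (n, q) \<in> carrier (hecke n q)"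
      "coord x (n, q) \<ominus>\<^bsub>hecke n q\<^esub> coord y (n, q) \<in> carrier (hecke n q)"
      by simp_all
  qed
  show "coord 0 (n, q) = \<zero>\<^bsub>hecke n q\<^esub>"
    unfolding zero_hecke_family_def by (subst coord_Family) (simp_all add: c)
  show "coord 1 (n, q) = \<one>\<^bsub>hecke n q\<^esub>"
    unfolding one_hecke_family_def by (subst coord_Family) (simp_all add: c)
  show "coord (x + y) (n, q) = coord x (n, q) \<oplus>\<^bsub>hecke n q\<^esub> coord y (n, q)"
    unfolding plus_hecke_family_def by (subst coord_Family) (simp_all add: c)
  show "coord (x * y) (n, q) = coord x (n, q) \<otimes>\<^bsub>hecke n q\<^esub> coord y (n, q)"
    unfolding times_hecke_family_def by (subst coord_Family) (simp_all add: c)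
  show "coord (- x) (n, q) = \<ominus>\<^bsub>hecke n q\<^esub> coord x (n, q)"
    unfolding uminus_hecke_family_def by (subst coord_Family) (simp_all add: c)
  show "coord (x - y) (n, q) = coord x (n, q) \<ominus>\<^bsub>hecke n q\<^esub> coord y (n, q)"
    unfolding minus_hecke_family_def by (subst coord_Family) (simp_all add: c)
qed

instance
proof
  fix x y z :: hecke_family
  show "x + y + z = x + (y + z)"
    by (rule hecke_family_eqI) (simp add: coord_simps ring.ring_simprules[OF ring_hecke])
  show "x + y = y + x"
    by (rule hecke_family_eqI) (simp add: coord_simps ring.ring_simprules[OF ring_hecke])
  show "0 + x = x"
    by (rule hecke_family_eqI) (simp add: coord_simps ring.ring_simprules[OF ring_hecke])
  show "- x + x = 0"
    by (rule hecke_family_eqI) (simp add: coord_simps ring.ring_simprules[OF ring_hecke])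
  show "x - y = x + - y"
    by (rule hecke_family_eqI) (simp add: coord_simps ring.ring_simprules[OF ring_hecke] a_minus_def)
  show "x * y * z = x * (y * z)"
    by (rule hecke_family_eqI) (simp add: coord_simps ring.ring_simprules[OF ring_hecke])
  show "1 * x = x" "x * 1 = x"
    by (rule hecke_family_eqI, simp add: coord_simps ring.ring_simprules[OF ring_hecke] monoid.r_one[OF ring.is_monoid[OF ring_hecke]])+
  show "(x + y) * z = x * z + y * z" "x * (y + z) = x * y + x * z"
    by (rule hecke_family_eqI, simp add: coord_simps ring.ring_simprules[OF ring_hecke])+
  \<comment> \<open>One nontrivial coordinate suffices. At n = 0 there are neither generators nor
    relations, so the ideal is zero and the quotient does not collapse.\<close>
  show "(0 :: hecke_family) \<noteq> 1"
  proof
    interpret R: ring "free_algebra 0" by (rule ring_free_algebra)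
    interpret I: ideal "hecke_ideal 0 0" "free_algebra 0" by (rule ideal_hecke_ideal)
    assume "(0 :: hecke_family) = 1"
    then have "coord 0 (0, 0) = coord 1 (0, 0)" by simp
    then have e: "hecke_class 0 0 1 = hecke_ideal 0 0"
      by (simp add: coord_simps hecke_def FactRing_def)
    have "hecke_relations 0 0 = {}" by (simp add: hecke_relations_def)
    then have "hecke_ideal 0 0 \<subseteq> {0}"
      unfolding hecke_ideal_def using R.genideal_minimal[OF R.zeroideal, of "{}"] by simp
    moreover have "1 \<in> hecke_class 0 0 1"
      using I.a_rcos_self R.one_closed by simp
    ultimately show False using e by auto
  qed
qed

end

definition family_scale :: "complex \<Rightarrow> hecke_family \<Rightarrow> hecke_family" where
  "family_scale a x = Family (\<lambda>p. hecke_scalar (fst p) (snd p) a \<otimes>\<^bsub>hecke (fst p) (snd p)\<^esub> coord x p)"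

lemma coord_scale: "coord (family_scale a x) (n, q) = hecke_scalar n q a \<otimes>\<^bsub>hecke n q\<^esub> coord x (n, q)"
  unfolding family_scale_def
  by (subst coord_Family) (simp_all add: ring.ring_simprules[OF ring_hecke])

interpretation family: complex_algebra family_scale
proof
  note r = ring.ring_simprules[OF ring_hecke]
  fix a b x y
  show "family_scale a (x + y) = family_scale a x + family_scale a y"
    by (rule hecke_family_eqI) (simp add: coord_scale coord_simps r)
  show "family_scale (a + b) x = family_scale a x + family_scale b x"
    by (rule hecke_family_eqI) (simp add: coord_scale coord_simps hecke_scalar_simps r)
  show "family_scale a (family_scale b x) = family_scale (a * b) x"
    by (rule hecke_family_eqI) (simp add: coord_scale coord_simps hecke_scalar_simps r)
  show "family_scale 1 x = x"
    by (rule hecke_family_eqI) (simp add: coord_scale coord_simps hecke_scalar_simps r)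
  show "family_scale a x * y = family_scale a (x * y)"
    by (rule hecke_family_eqI) (simp add: coord_scale coord_simps r)
  show "x * family_scale a y = family_scale a (x * y)"
    by (rule hecke_family_eqI) (simp add: coord_scale coord_simps r(11)[symmetric] hecke_scalar_commute[symmetric])
qed

definition family_gen :: "nat \<Rightarrow> complex \<Rightarrow> nat \<Rightarrow> hecke_family" where
  "family_gen n q k = Family (\<lambda>p. if p = (n, q) \<and> k + 1 < n then hecke_T n q (Suc k)
     else hecke_scalar (fst p) (snd p) q)"

lemma coord_gen: "coord (family_gen n q k) (m, r) =
    (if (m, r) = (n, q) \<and> k + 1 < n then hecke_T n q (Suc k) else hecke_scalar m r q)"
  unfolding family_gen_def by (subst coord_Family) (auto simp: hecke_T_closed)

lemma hecke_algebra_family: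
  assumes "generic_parameter n q"
  shows "hecke_algebra family_scale (family_gen n q) n q"
proof
  note r = ring.ring_simprules[OF ring_hecke]
  show "generic_parameter n q" by fact
  show "family_gen n q k * family_gen n q (Suc k) * family_gen n q k =
      family_gen n q (Suc k) * family_gen n q k * family_gen n q (Suc k)" if "k + 2 < n" for k
    by (rule hecke_family_eqI)
       (use that hecke_braid[of "Suc k" n q] in \<open>simp add: coord_simps coord_gen\<close>)
  show "family_gen n q i * family_gen n q j = family_gen n q j * family_gen n q i"
    if "i + 1 < j" "j + 1 < n" for i j
    by (rule hecke_family_eqI)
       (use that hecke_far[of "Suc i" n "Suc j" q] in \<open>simp add: coord_simps coord_gen\<close>)
  show "family_gen n q k * family_gen n q k = family_scale (q - inverse q) (family_gen n q k) + 1"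
    if "k + 1 < n" for k
  proof (rule hecke_family_eqI)
    fix m r
    have "q * q = (q - inverse q) * q + 1" using assms by (simp add: generic_parameter_def field_simps)
    then have "hecke_scalar m r q \<otimes>\<^bsub>hecke m r\<^esub> hecke_scalar m r q =
        hecke_scalar m r (q - inverse q) \<otimes>\<^bsub>hecke m r\<^esub> hecke_scalar m r q \<oplus>\<^bsub>hecke m r\<^esub> \<one>\<^bsub>hecke m r\<^esub>"
      by (metis hecke_scalar_simps(1,2,3))
    then show "coord (family_gen n q k * family_gen n q k) (m, r) =
        coord (family_scale (q - inverse q) (family_gen n q k) + 1) (m, r)"
      using that hecke_quadratic[of "Suc k" n q] by (auto simp: coord_simps coord_scale coord_gen)
  qed
qed


section \<open>Tableaux as words\<close>

definition diagram :: "(nat \<Rightarrow> nat) \<Rightarrow> (nat \<times> nat) set" where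
  "diagram f = {(a, b). 1 \<le> a \<and> 1 \<le> b \<and> b \<le> f (a - 1)}"

definition tableau_of :: "nat list \<Rightarrow> tableau" where
  "tableau_of ws = map (\<lambda>j. diagram (shape (take (Suc j) ws))) [0..<length ws]"

lemma length_tableau_of [simp]: "length (tableau_of ws) = length ws"
  by (simp add: tableau_of_def)

lemma nth_tableau_of: "j < length ws \<Longrightarrow> tableau_of ws ! j = diagram (shape (take (Suc j) ws))"
  by (simp add: tableau_of_def)

lemma tableau_of_snoc: "tableau_of (ws @ [a]) = tableau_of ws @ [diagram (shape (ws @ [a]))]"
  by (simp add: tableau_of_def del: shape_simps)

lemma diagram_0 [simp]: "diagram (\<lambda>_. 0) = {}"
  by (auto simp: diagram_def)

lemma diagram_add_box:
  "diagram (add_box f r) = insert (Suc r, Suc (f r)) (diagram f)" "(Suc r, Suc (f r)) \<notin> diagram f"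
  by (auto simp: diagram_def add_box_def le_Suc_eq split: if_splits)

lemma diagram_inj: "diagram f = diagram g \<Longrightarrow> f = g"
proof
  fix a assume e: "diagram f = diagram g"
  have "b \<le> f a \<longleftrightarrow> b \<le> g a" for b
  proof (cases "b = 0")
    case False
    have "(Suc a, b) \<in> diagram f \<longleftrightarrow> (Suc a, b) \<in> diagram g" using e by simp
    then show ?thesis using False by (simp add: diagram_def)
  qed simp
  then show "f a = g a" by (metis le_antisym le_refl)
qed

lemma finite_diagram: "finite (diagram (shape ws))"
  by (induction ws rule: rev_induct) (simp_all add: diagram_add_box)

lemma young_diagram_shape:
  assumes "lattice ws"
  shows "young_diagram (diagram (shape ws))"
  unfolding young_diagram_def
proof (intro conjI ballI finite_diagram)
  fix x assume "x \<in> diagram (shape ws)"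
  then obtain a b where x: "x = (a, b)" "1 \<le> a" "1 \<le> b" "b \<le> shape ws (a - 1)" by (auto simp: diagram_def)
  have "(i, j) \<in> diagram (shape ws)" if "i \<in> {1..a}" "j \<in> {1..b}" for i j
  proof -
    have "shape ws (a - 1) \<le> shape ws (i - 1)" using that by (intro shape_antimono[OF assms]) auto
    then have "j \<le> shape ws (i - 1)" using that x by simp
    then show ?thesis using that by (simp add: diagram_def)
  qed
  then show "case x of (a, b) \<Rightarrow> 1 \<le> a \<and> 1 \<le> b \<and> {1..a} \<times> {1..b} \<subseteq> diagram (shape ws)"
    using x by auto
qed

text \<open>The boxes to the left of the new one must be present, which determines its column; the
  box above it must be present, which makes its row addable.\<close>

lemma young_diagram_insert:
  assumes "young_diagram (insert x (diagram f))" "x \<notin> diagram f"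
  obtains r where "addable f r" "x = (Suc r, Suc (f r))"
proof -
  obtain a b where x: "x = (a, b)" by fastforce
  have ab: "1 \<le> a" "1 \<le> b" "{1..a} \<times> {1..b} \<subseteq> insert x (diagram f)"
    using assms(1) x by (auto simp: young_diagram_def)
  then have nb: "b > f (a - 1)" using assms(2) x by (auto simp: diagram_def)
  have b: "b = Suc (f (a - 1))"
  proof (rule ccontr)
    assume "b \<noteq> Suc (f (a - 1))"
    then have "b \<ge> 2" using nb by simp
    then have "(a, b - 1) \<in> {1..a} \<times> {1..b}" using ab by auto
    moreover have "(a, b - 1) \<noteq> x" using x \<open>b \<ge> 2\<close> by simp
    ultimately have "(a, b - 1) \<in> diagram f" using ab(3) by blast
    then show False using nb \<open>b \<noteq> Suc (f (a - 1))\<close> by (auto simp: diagram_def)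
  qed
  have "addable f (a - 1)"
  proof (cases "a = 1")
    case False
    then have "(a - 1, b) \<in> {1..a} \<times> {1..b}" using ab by auto
    moreover have "(a - 1, b) \<noteq> x" using x ab(1) by simp
    ultimately have "(a - 1, b) \<in> diagram f" using ab(3) by blast
    then show ?thesis using b by (auto simp: addable_def diagram_def)
  qed (simp add: addable_def)
  then show ?thesis using that[of "a - 1"] x b ab by simp
qed

lemma standard_tableau_of:
  assumes "lattice ws" "length ws = n"
  shows "standard_tableau n (tableau_of ws)"
  unfolding standard_tableau_def
proof (intro conjI ballI impI allI)
  show "length (tableau_of ws) = n" using assms by simp
next
  fix D assume "D \<in> set (tableau_of ws)"
  then show "young_diagram D" using assms young_diagram_shape lattice_take by (auto simp: tableau_of_def)
next
  assume "1 \<le> n"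
  then obtain v where "ws = 0 # v" using assms by (cases ws) (auto simp: addable_def)
  then show "tableau_of ws ! 0 = {(1, 1)}"
    by (subst nth_tableau_of) (auto simp: diagram_def shape_def split: if_splits)
next
  fix j assume "j + 1 < n"
  then show "\<exists>x. x \<notin> tableau_of ws ! j \<and> tableau_of ws ! (j + 1) = insert x (tableau_of ws ! j)"
    using assms diagram_add_box[where f = "shape (take (Suc j) ws)" and r = "ws ! Suc j"]
    by (auto simp: nth_tableau_of take_Suc_conv_app_nth[of "Suc j"])
qed

lemma standard_tableau_word:
  assumes "standard_tableau n U" "n \<ge> 1"
  obtains ws where "lattice ws" "length ws = n" "U = tableau_of ws"
proof -
  have "\<exists>ws. lattice ws \<and> length ws = Suc m \<and> U = tableau_of ws" if "standard_tableau (Suc m) U" for m U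
    using that
  proof (induction m arbitrary: U)
    case 0
    then obtain D where "U = [D]" by (auto simp: standard_tableau_def length_Suc_conv)
    moreover have "tableau_of [0] = [{(1, 1)}]"
      by (auto simp: tableau_of_def diagram_def shape_def split: if_splits)
    ultimately show ?case using 0 by (intro exI[of _ "[0]"]) (auto simp: standard_tableau_def addable_def)
  next
    case (Suc m)
    then obtain U' D where U: "U = U' @ [D]" "length U' = Suc m"
      by (metis length_Suc_conv_rev standard_tableau_def)
    have "standard_tableau (Suc m) U'"
      unfolding standard_tableau_def
    proof (intro conjI ballI impI allI)
      show "U' ! 0 = {(1, 1)}" using Suc.prems U by (auto simp: standard_tableau_def nth_append)
      fix j assume j: "j + 1 < Suc m"
      then have "\<exists>x. x \<notin> U ! j \<and> U ! (j + 1) = insert x (U ! j)"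
        using Suc.prems by (simp add: standard_tableau_def)
      then show "\<exists>x. x \<notin> U' ! j \<and> U' ! (j + 1) = insert x (U' ! j)"
        using U j by (simp add: nth_append)
    qed (use Suc.prems U in \<open>auto simp: standard_tableau_def\<close>)
    then obtain ws where ws: "lattice ws" "length ws = Suc m" "U' = tableau_of ws" using Suc.IH by blast
    have last: "U' ! m = diagram (shape ws)" using ws by (simp add: nth_tableau_of)
    obtain x where x: "x \<notin> U ! m" "U ! (m + 1) = insert x (U ! m)"
      using Suc.prems unfolding standard_tableau_def by (metis Suc_eq_plus1 lessI)
    have D: "D = insert x (diagram (shape ws))" "x \<notin> diagram (shape ws)"
      using x U last by (auto simp: nth_append)
    moreover have "young_diagram D" using Suc.prems U by (auto simp: standard_tableau_def)
    ultimately obtain r where r: "addable (shape ws) r" "x = (Suc r, Suc (shape ws r))"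
      using young_diagram_insert by metis
    have "U = tableau_of (ws @ [r])" using U ws D r by (simp add: tableau_of_snoc diagram_add_box)
    moreover have "lattice (ws @ [r])" using ws r by (simp add: lattice_append)
    ultimately show ?case using ws by (intro exI[of _ "ws @ [r]"]) simp
  qed
  then show ?thesis using assms that by (cases n) auto
qed

lemma added_box_tableau_of:
  assumes "lattice ws" "k < length ws"
  shows "added_box (tableau_of ws) (Suc k) = (Suc (ws ! k), Suc (shape (take k ws) (ws ! k)))"
proof -
  let ?f = "shape (take k ws)" and ?x = "(Suc (ws ! k), Suc (shape (take k ws) (ws ! k)))"
  have 1: "tableau_of ws ! k = insert ?x (diagram ?f)" "?x \<notin> diagram ?f"
    using assms diagram_add_box[where f = ?f and r = "ws ! k"] by (auto simp: nth_tableau_of take_Suc_conv_app_nth)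
  \<comment> \<open>For the first box the guard drops the condition, in agreement with the empty
    diagram of the empty prefix; this makes one formula valid for all k.\<close>
  have 2: "(Suc k \<ge> 2 \<longrightarrow> x \<notin> tableau_of ws ! (Suc k - 2)) \<longleftrightarrow> x \<notin> diagram ?f" for x
    using assms by (cases k) (auto simp: nth_tableau_of)
  show ?thesis unfolding added_box_def 2 using 1 by (intro the_equality) auto
qed

lemma q_content_tableau_of:
  assumes "lattice ws" "k < length ws"
  shows "q_content q (tableau_of ws) (Suc k) = q powi (2 * contents ws ! k)"
  using assms by (simp add: q_content_def added_box_tableau_of nth_contents box_content_def)

lemma last_tableau_of: "ws \<noteq> [] \<Longrightarrow> last (tableau_of ws) = diagram (shape ws)"
  by (cases ws rule: rev_cases) (simp_all add: tableau_of_snoc)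

lemma tableau_of_inj: "tableau_of u = tableau_of v \<Longrightarrow> u = v"
proof (induction u arbitrary: v rule: rev_induct)
  case Nil
  then show ?case by (metis length_0_conv length_tableau_of)
next
  case (snoc a u)
  then have "length v = Suc (length u)" by (metis length_append_singleton length_tableau_of)
  then obtain v' b where v: "v = v' @ [b]" by (auto simp: length_Suc_conv_rev)
  have "tableau_of u = tableau_of v'" "diagram (shape (u @ [a])) = diagram (shape (v' @ [b]))"
    using snoc.prems v by (simp_all add: tableau_of_snoc del: shape_simps)
  then have "u = v'" "mset (u @ [a]) = mset (v' @ [b])"
    using snoc.IH diagram_inj shape_eq_iff by blast+
  then show ?case using v by simp
qed

context hecke_algebra
begin

lemma tableaux_of_shape_eq:
  assumes "lattice u" "length u = m" "m \<ge> 1"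
  shows "tableaux_of_shape m (diagram (shape u)) = tableau_of ` same_shape u"
proof (intro equalityI subsetI)
  fix V assume "V \<in> tableaux_of_shape m (diagram (shape u))"
  then have V: "standard_tableau m V" "last V = diagram (shape u)" by (auto simp: tableaux_of_shape_def)
  then obtain v where v: "lattice v" "length v = m" "V = tableau_of v"
    using standard_tableau_word assms by blast
  have "v \<noteq> []" using v assms by auto
  then have "diagram (shape v) = diagram (shape u)" using V(2) by (simp add: v(3) last_tableau_of)
  then have "mset v = mset u" using diagram_inj shape_eq_iff by blast
  then show "V \<in> tableau_of ` same_shape u" using v by (auto simp: same_shape_def)
next
  fix V assume "V \<in> tableau_of ` same_shape u"
  then obtain v where v: "lattice v" "mset v = mset u" "V = tableau_of v" by (auto simp: same_shape_def)
  then have len: "length v = m" using assms by (metis mset_eq_length)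
  have "shape v = shape u" using v shape_eq_iff by blast
  moreover have "v \<noteq> []" using len assms by auto
  ultimately have "last V = diagram (shape u)" by (simp add: v(3) last_tableau_of)
  then show "V \<in> tableaux_of_shape m (diagram (shape u))"
    using v len standard_tableau_of by (auto simp: tableaux_of_shape_def)
qed

lemma J_prod_list: "J k = prod_list (map S (rev [0..<k] @ [0..<k]))"
proof (induction k)
  case (Suc k)
  then show ?case by (simp add: J.simps(2) mult.assoc)
qed simp

end

section \<open>The component of the product ring at the given parameters\<close>

locale generic_hecke =
  fixes n :: nat and q :: complex
  assumes generic_q: "generic_parameter n q"

sublocale generic_hecke \<subseteq> hecke_algebra family_scale "family_gen n q" n q
  by (rule hecke_algebra_family[OF generic_q])

context generic_hecke
begin

notation family_scale (infixr \<open>*s\<close> 75)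

definition proj :: "hecke_family \<Rightarrow> nc_poly set" where
  "proj x = coord x (n, q)"

text \<open>Extension by zero to the other coordinates. It respects sums, products and scalars but
  not the unit: the image of the unit is the central idempotent that cuts out this factor, so
  multiplying an embedded element by x only involves \<open>proj x\<close>.\<close>

definition embed :: "nc_poly set \<Rightarrow> hecke_family" where
  "embed h = Family (\<lambda>p. if p = (n, q) then h else \<zero>\<^bsub>hecke (fst p) (snd p)\<^esub>)"

lemma proj_closed [simp]: "proj x \<in> carrier (hecke n q)"
  by (simp add: proj_def)

lemma proj_simps:
  "proj 0 = \<zero>\<^bsub>hecke n q\<^esub>" "proj 1 = \<one>\<^bsub>hecke n q\<^esub>"
  "proj (x + y) = proj x \<oplus>\<^bsub>hecke n q\<^esub> proj y" "proj (x * y) = proj x \<otimes>\<^bsub>hecke n q\<^esub> proj y"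
  "proj (x - y) = proj x \<ominus>\<^bsub>hecke n q\<^esub> proj y"
  "proj (a *s x) = hecke_scalar n q a \<otimes>\<^bsub>hecke n q\<^esub> proj x"
  by (simp_all add: proj_def coord_simps coord_scale)

lemma proj_scalar: "proj (a *s 1) = hecke_scalar n q a"
  by (simp add: proj_simps monoid.r_one[OF ring.is_monoid[OF ring_hecke]])

lemma proj_gen: "k + 1 < n \<Longrightarrow> proj (family_gen n q k) = hecke_T n q (Suc k)"
  by (simp add: proj_def coord_gen)

lemma coord_embed:
  "h \<in> carrier (hecke n q) \<Longrightarrow> coord (embed h) (m, r) = (if (m, r) = (n, q) then h else \<zero>\<^bsub>hecke m r\<^esub>)"
  unfolding embed_def by (subst coord_Family) (auto simp: ring.ring_simprules(2)[OF ring_hecke])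

lemma proj_embed [simp]: "h \<in> carrier (hecke n q) \<Longrightarrow> proj (embed h) = h"
  by (simp add: proj_def coord_embed)

lemma hecke_prod_proj: "hecke_prod n q (map proj xs) = proj (prod_list xs)"
  by (induction xs) (simp_all add: hecke_prod_def proj_simps)

lemma proj_J:
  assumes "k < n"
  shows "proj (J k) = jucys_murphy n q (Suc k)"
proof -
  have 1: "map (hecke_T n q) [1..<Suc k] = map (\<lambda>i. proj (family_gen n q i)) [0..<k]"
    using assms by (intro nth_equalityI) (auto simp: proj_gen simp del: upt_Suc)
  have 2: "map (hecke_T n q) (rev [1..<Suc k]) = map (\<lambda>i. proj (family_gen n q i)) (rev [0..<k])"
    unfolding rev_map[symmetric] 1 ..
  show ?thesis
    unfolding jucys_murphy_def map_append 1 2 J_prod_list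
    using hecke_prod_proj[of "map (family_gen n q) (rev [0..<k] @ [0..<k])"] by (simp add: comp_def)
qed

end


section \<open>Representations\<close>

subsection \<open>Vectors and matrices\<close>

lemma mat_eqI_vec:
  assumes "A \<in> carrier_mat d d" "B \<in> carrier_mat d d"
    and "\<And>x :: complex vec. x \<in> carrier_vec d \<Longrightarrow> A *\<^sub>v x = B *\<^sub>v x"
  shows "A = B"
proof (rule eq_matI)
  fix i j assume ij: "i < dim_row B" "j < dim_col B"
  have "(A *\<^sub>v unit_vec d j) $ i = A $$ (i, j)" "(B *\<^sub>v unit_vec d j) $ i = B $$ (i, j)"
    using assms(1,2) ij by (auto simp: scalar_prod_right_unit[of j d])
  then show "A $$ (i, j) = B $$ (i, j)" using assms(3)[of "unit_vec d j"] by simp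
qed (use assms in auto)

lemma mult_mat_zero_vec: "A \<in> carrier_mat d d \<Longrightarrow> A *\<^sub>v 0\<^sub>v d = (0\<^sub>v d :: complex vec)"
  by (intro eq_vecI) auto

lemma zero_mat_mult_vec: "x \<in> carrier_vec d \<Longrightarrow> 0\<^sub>m d d *\<^sub>v x = (0\<^sub>v d :: complex vec)"
  by (intro eq_vecI) auto

lemma scalar_mat_mult_vec: "x \<in> carrier_vec d \<Longrightarrow> (a \<cdot>\<^sub>m 1\<^sub>m d) *\<^sub>v x = a \<cdot>\<^sub>v (x :: complex vec)"
  by (intro eq_vecI) auto

lemma smult_vec_eq_0:
  assumes "(v :: complex vec) \<in> carrier_vec d" "a \<cdot>\<^sub>v v = 0\<^sub>v d"
  shows "a = 0 \<or> v = 0\<^sub>v d"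
proof -
  have "a * v $ i = 0" if "i < d" for i
    using arg_cong[OF assms(2), of "\<lambda>v. v $ i"] assms(1) that by simp
  then show ?thesis using assms(1) by (cases "a = 0") (auto intro!: eq_vecI)
qed

lemma subspace_vec_iff:
  "VectorSpace.subspace class_ring W (module_vec TYPE(complex) d) \<longleftrightarrow>
     W \<subseteq> carrier_vec d \<and> 0\<^sub>v d \<in> W \<and> (\<forall>v\<in>W. \<forall>w\<in>W. v + w \<in> W) \<and> (\<forall>c. \<forall>v\<in>W. c \<cdot>\<^sub>v v \<in> W)"
  by (auto simp: subspace_def submodule_def vec_vs vec_module module_vec_simps class_ring_simps)

abbreviation vec_span :: "nat \<Rightarrow> complex vec set \<Rightarrow> complex vec set" where
  "vec_span d \<equiv> LinearCombinations.module.span class_ring (module_vec TYPE(complex) d)"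

abbreviation vec_basis :: "nat \<Rightarrow> complex vec set \<Rightarrow> bool" where
  "vec_basis d \<equiv> vectorspace.basis class_ring (module_vec TYPE(complex) d)"

lemma span_vec_subspace:
  assumes "A \<subseteq> carrier_vec d"
  shows "VectorSpace.subspace class_ring (vec_span d A) (module_vec TYPE(complex) d)" "A \<subseteq> vec_span d A"
proof -
  interpret V: vec_space "TYPE(complex)" d .
  show "VectorSpace.subspace class_ring (vec_span d A) (module_vec TYPE(complex) d)" "A \<subseteq> vec_span d A"
    using V.span_is_subspace V.in_own_span assms by simp_all
qed

lemma vec_basisD:
  assumes "vec_basis d A"
  shows "A \<subseteq> carrier_vec d" "vec_span d A = carrier_vec d"
proof -
  interpret V: vec_space "TYPE(complex)" d .
  show "A \<subseteq> carrier_vec d" "vec_span d A = carrier_vec d" using assms by (auto simp: V.basis_def)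
qed

lemma span_vec_subset:
  assumes "A \<subseteq> W" "VectorSpace.subspace class_ring W (module_vec TYPE(complex) d)"
  shows "vec_span d A \<subseteq> W"
  using module.span_is_subset[OF vec_module assms(1)] assms(2) by (auto simp: subspace_def)

text \<open>Applied to a vanishing linear combination, the operator \<open>P v\<close> isolates the
  term of v, so its coefficient is 0.\<close>

lemma basis_vecI:
  fixes P :: "complex vec \<Rightarrow> complex mat"
  assumes A: "finite A" "A \<subseteq> carrier_vec d" "0\<^sub>v d \<notin> A"
    and P: "\<And>v. v \<in> A \<Longrightarrow> P v \<in> carrier_mat d d"
      "\<And>v w. v \<in> A \<Longrightarrow> w \<in> A \<Longrightarrow> P v *\<^sub>v w = (if v = w then w else 0\<^sub>v d)"
    and span: "vec_span d A = carrier_vec d"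
  shows "vec_basis d A"
proof -
  interpret V: vec_space "TYPE(complex)" d .
  have "V.lin_indpt A"
  proof (rule V.finite_lin_indpt2)
    fix a :: "complex vec \<Rightarrow> complex" assume "V.lincomb a A = 0\<^sub>v d"
    have "a v = 0" if v: "v \<in> A" for v
    proof -
      have "B \<subseteq> A \<Longrightarrow> V.lincomb a B \<in> carrier_vec d \<and>
          P v *\<^sub>v V.lincomb a B = (if v \<in> B then a v \<cdot>\<^sub>v v else 0\<^sub>v d)" if "finite B" for B
        using that
      proof (induction B rule: finite_induct)
        case empty
        then show ?case using P(1)[OF v] by (simp add: V.lincomb_def mult_mat_zero_vec)
      next
        case (insert w B)
        have w: "w \<in> carrier_vec d" "w \<in> A" using insert A by auto
        have "V.lincomb a (insert w B) = a w \<cdot>\<^sub>v w + V.lincomb a B"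
          unfolding V.lincomb_def using insert A by (subst V.finsum_insert) auto
        moreover have "P v *\<^sub>v (a w \<cdot>\<^sub>v w + V.lincomb a B) = a w \<cdot>\<^sub>v (P v *\<^sub>v w) + P v *\<^sub>v V.lincomb a B"
          using insert w P(1)[OF v]
          by (subst mult_add_distrib_mat_vec[of _ d d]) (auto simp: mult_mat_vec[of _ d d])
        ultimately show ?case using insert w P(2)[OF v w(2)] A v by auto
      qed
      from this[OF A(1)] have "P v *\<^sub>v 0\<^sub>v d = a v \<cdot>\<^sub>v v" using v \<open>V.lincomb a A = 0\<^sub>v d\<close> by simp
      then have "a v \<cdot>\<^sub>v v = 0\<^sub>v d" using P(1)[OF v] by (simp add: mult_mat_zero_vec)
      then show "a v = 0" using smult_vec_eq_0[of v d] v A by auto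
    qed
    then show "\<forall>v\<in>A. a v = 0" by blast
  qed (use A in auto)
  then show ?thesis unfolding V.basis_def using A span by simp
qed


context generic_hecke
begin

subsection \<open>The action of the idempotents\<close>

context
  fixes d :: nat and \<rho> :: "nc_poly set \<Rightarrow> complex mat"
  assumes rep: "hecke_rep n q d \<rho>"
begin

lemma rep_hom: "\<rho> \<in> Ring.ring_hom (hecke n q) (ring_mat TYPE(complex) d ())"
  and rep_scalar: "\<rho> (hecke_scalar n q a) = a \<cdot>\<^sub>m 1\<^sub>m d"
  using rep by (auto simp: hecke_rep_def)

lemma rep_closed: "h \<in> carrier (hecke n q) \<Longrightarrow> \<rho> h \<in> carrier_mat d d"
  using ring_hom_closed[OF rep_hom] by (simp add: ring_mat_simps)

definition act :: "hecke_family \<Rightarrow> complex vec \<Rightarrow> complex vec" where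
  "act x v = \<rho> (proj x) *\<^sub>v v"

lemma act_closed [simp]: "v \<in> carrier_vec d \<Longrightarrow> act x v \<in> carrier_vec d"
  using rep_closed[of "proj x"] by (simp add: act_def)

lemma act_add: "v \<in> carrier_vec d \<Longrightarrow> act (x + y) v = act x v + act y v"
  using ring_hom_add[OF rep_hom, of "proj x" "proj y"] rep_closed[of "proj x"] rep_closed[of "proj y"]
  by (simp add: act_def proj_simps ring_mat_simps add_mult_distrib_mat_vec[of _ d d])

lemma act_mult: "v \<in> carrier_vec d \<Longrightarrow> act (x * y) v = act x (act y v)"
  using ring_hom_mult[OF rep_hom, of "proj x" "proj y"] rep_closed[of "proj x"] rep_closed[of "proj y"]
  by (simp add: act_def proj_simps ring_mat_simps assoc_mult_mat_vec[of _ d d _ d])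

lemma act_1: "v \<in> carrier_vec d \<Longrightarrow> act 1 v = v"
  using ring_hom_one[OF rep_hom] by (simp add: act_def proj_simps ring_mat_simps)

lemma act_scale: "v \<in> carrier_vec d \<Longrightarrow> act (a *s x) v = a \<cdot>\<^sub>v act x v"
proof -
  assume v: "v \<in> carrier_vec d"
  have "act (a *s 1) w = a \<cdot>\<^sub>v w" if "w \<in> carrier_vec d" for w
    using that by (simp add: act_def proj_scalar rep_scalar scalar_mat_mult_vec)
  then show ?thesis using act_mult[OF v, of "a *s 1" x] v by (simp add: scale_mult)
qed

lemma act_0: "v \<in> carrier_vec d \<Longrightarrow> act 0 v = 0\<^sub>v d"
  using Ring.ring_hom_zero[OF rep_hom ring_hecke ring_mat]
  by (simp add: act_def proj_simps ring_mat_simps zero_mat_mult_vec)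

lemma act_smult_vec: "v \<in> carrier_vec d \<Longrightarrow> act x (a \<cdot>\<^sub>v v) = a \<cdot>\<^sub>v act x v"
  using mult_mat_vec[OF rep_closed[of "proj x"]] by (simp add: act_def)

lemma act_add_vec:
  "v \<in> carrier_vec d \<Longrightarrow> w \<in> carrier_vec d \<Longrightarrow> act x (v + w) = act x v + act x w"
  using mult_add_distrib_mat_vec[OF rep_closed[of "proj x"]] by (simp add: act_def)

lemma act_zero_vec: "act x (0\<^sub>v d) = 0\<^sub>v d"
  using mult_mat_zero_vec[OF rep_closed[of "proj x"]] by (simp add: act_def)

text \<open>The argument of \<open>E_action\<close> for a vector of a representation in place of an
  element of the algebra.\<close>

lemma act_E:
  assumes "lattice u" "lattice w" "length u = n" "length w = n" and v: "v \<in> carrier_vec d"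
    and eig: "\<And>k. k < n \<Longrightarrow> act (J k) v = Q (contents w ! k) \<cdot>\<^sub>v v"
  shows "act (E u) v = (if u = w then v else 0\<^sub>v d)"
proof -
  have ne: "act (E u) v = 0\<^sub>v d" if u: "lattice u" "length u = n" "u \<noteq> w" for u
  proof -
    obtain k where k: "k < n" "Q (contents u ! k) \<noteq> Q (contents w ! k)"
      using contents_separate[OF u(1) assms(2)] u assms by auto
    have "Q (contents u ! k) \<cdot>\<^sub>v act (E u) v = act (J k * E u) v"
      using E_eigen_nth[of u k] u k v by (simp add: act_scale)
    also have "\<dots> = act (E u) (act (J k) v)" using E_J[of u k] u k v by (simp add: act_mult)
    also have "\<dots> = Q (contents w ! k) \<cdot>\<^sub>v act (E u) v" using eig[OF k(1)] v by (simp add: act_smult_vec)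
    finally have e: "Q (contents u ! k) \<cdot>\<^sub>v act (E u) v = Q (contents w ! k) \<cdot>\<^sub>v act (E u) v" .
    have "(Q (contents u ! k) - Q (contents w ! k)) \<cdot>\<^sub>v act (E u) v = 0\<^sub>v d"
    proof (rule eq_vecI)
      have dim: "dim_vec (act (E u) v) = d" using act_closed[OF v, of "E u"] by auto
      show "dim_vec ((Q (contents u ! k) - Q (contents w ! k)) \<cdot>\<^sub>v act (E u) v) = dim_vec (0\<^sub>v d :: complex vec)"
        by (simp add: dim)
      fix i assume "i < dim_vec (0\<^sub>v d :: complex vec)"
      then show "((Q (contents u ! k) - Q (contents w ! k)) \<cdot>\<^sub>v act (E u) v) $ i = 0\<^sub>v d $ i"
        using arg_cong[OF e, of "\<lambda>x. x $ i"] dim by (simp add: left_diff_distrib)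
    qed
    then show ?thesis using smult_vec_eq_0[OF act_closed[OF v]] k(2) by fastforce
  qed
  have "act (\<Sum>ws\<in>A. E ws) v = 0\<^sub>v d" if "finite A" "A \<subseteq> words n - {w}" for A
    using that
  proof (induction A rule: finite_induct)
    case (insert x A)
    then show ?case using ne[of x] v by (simp add: act_add words_def)
  qed (simp add: act_0 v)
  from this[of "words n - {w}"] have 0: "act (\<Sum>ws\<in>words n - {w}. E ws) v = 0\<^sub>v d" by simp
  have "1 = E w + (\<Sum>ws\<in>words n - {w}. E ws)"
    using sum_E[of n] sum.remove[OF finite_words, of w n E] assms by (simp add: words_def)
  then have "v = act (E w) v + 0\<^sub>v d" using 0 v by (metis act_1 act_add)
  then have "act (E w) v = v" using act_closed[OF v, of "E w"] by simp
  then show ?thesis using ne assms by auto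
qed

lemma invariant_subspace:
  assumes W: "VectorSpace.subspace class_ring W (module_vec TYPE(complex) d)"
    and gen: "\<And>k w. k + 1 < n \<Longrightarrow> w \<in> W \<Longrightarrow> act (family_gen n q k) w \<in> W"
    and h: "h \<in> carrier (hecke n q)"
  shows "\<forall>w\<in>W. \<rho> h *\<^sub>v w \<in> W"
  using h
proof (induction h rule: hecke_induct)
  case (scalar a)
  then show ?case using W
    by (auto simp: subspace_vec_iff rep_scalar scalar_mat_mult_vec)
next
  case (gen i)
  then show ?case using assms(2)[of "i - 1"] proj_gen[of "i - 1"] by (auto simp: act_def)
next
  case (add x y)
  then show ?case using W ring_hom_add[OF rep_hom add(1,2)] rep_closed[OF add(1)] rep_closed[OF add(2)]
    by (auto simp: subspace_vec_iff ring_mat_simps add_mult_distrib_mat_vec[of _ d d])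
next
  case (mult x y)
  then show ?case using W ring_hom_mult[OF rep_hom mult(1,2)] rep_closed[OF mult(1)] rep_closed[OF mult(2)]
    by (auto simp: subspace_vec_iff ring_mat_simps assoc_mult_mat_vec[of _ d d _ d])
qed

lemma young_basis_vec_closed:
  assumes "young_basis n q D d \<rho> v" "V \<in> tableaux_of_shape n D"
  shows "v V \<in> carrier_vec d"
  using assms vec_basisD(1) by (fastforce simp: young_basis_def)

text \<open>Choose x that \<open>E u\<close> does not kill and apply the family of
  \<open>young_family\<close> to it. The resulting vectors are nonzero, since each can be led back
  to \<open>E u\<close> applied to x; they are separated by the idempotents; and their span is
  stable under the generators, hence everything by irreducibility. So they form a Young
  basis.\<close>

lemma labelled_if_E_nonzero:
  assumes irr: "irreducible_rep n q d \<rho>" and u: "lattice u" "length u = n"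
    and nz: "\<rho> (proj (E u)) \<noteq> 0\<^sub>m d d" and n: "n \<ge> 1"
  shows "labelled_rep n q (diagram (shape u)) d \<rho>"
proof -
  obtain x where x: "x \<in> carrier_vec d" "act (E u) x \<noteq> 0\<^sub>v d"
    using mat_eqI_vec[of "\<rho> (proj (E u))" d "0\<^sub>m d d"] rep_closed nz by (auto simp: act_def zero_mat_mult_vec)
  obtain F where F: "F u = E u"
    "\<And>v. v \<in> same_shape u \<Longrightarrow> eigen (contents v) (F v)"
    "\<And>v. v \<in> same_shape u \<Longrightarrow> \<exists>x. x * F v = E u"
    "\<And>v k. v \<in> same_shape u \<Longrightarrow> k + 1 < n \<Longrightarrow>
      \<exists>v'\<in>same_shape u. \<exists>x z. family_gen n q k * F v = x *s F v + z *s F v'"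
    using young_family[OF u] by metis
  define f where "f w = act (F w) x" for w
  define A where "A = f ` same_shape u"
  have fc: "f w \<in> carrier_vec d" for w using x by (simp add: f_def)
  have fnz: "f w \<noteq> 0\<^sub>v d" if w: "w \<in> same_shape u" for w
  proof -
    obtain r where "r * F w = E u" using F(3)[OF w] by blast
    then have "act r (f w) = act (E u) x" using x by (simp add: f_def act_mult[symmetric])
    then show ?thesis using x act_zero_vec by metis
  qed
  have len: "length w = n" "lattice w" if "w \<in> same_shape u" for w
    using same_shape_length[OF that] that u by (auto simp: same_shape_def)
  have fE: "act (E v) (f w) = (if v = w then f w else 0\<^sub>v d)"
    if "v \<in> same_shape u" "w \<in> same_shape u" for v w
    using E_action[of v w "F w"] F(2) that len x
    by (simp add: f_def act_mult[symmetric] act_0)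
  have fJ: "act (J k) (f w) = Q (contents w ! k) \<cdot>\<^sub>v f w" if "w \<in> same_shape u" "k < n" for k w
    using F(2)[OF that(1)] that len x by (simp add: f_def act_mult[symmetric] eigen_def act_scale)
  have inj: "inj_on f (same_shape u)"
    using fE fnz by (intro inj_onI) metis
  let ?W = "vec_span d A"
  have AC: "A \<subseteq> carrier_vec d" using fc by (auto simp: A_def)
  have Wsub: "VectorSpace.subspace class_ring ?W (module_vec TYPE(complex) d)"
    using span_vec_subspace AC by simp
  have AW: "A \<subseteq> ?W" using span_vec_subspace AC by simp
  have WC: "?W \<subseteq> carrier_vec d" using Wsub by (simp add: subspace_vec_iff)
  have gen: "act (family_gen n q k) w \<in> ?W" if k: "k + 1 < n" and w: "w \<in> ?W" for k w
  proof -
    \<comment> \<open>The vectors that a generator sends into the span form a subspace, so stability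
      needs checking only on the spanning vectors.\<close>
    let ?N = "{w \<in> carrier_vec d. act (family_gen n q k) w \<in> ?W}"
    have "VectorSpace.subspace class_ring ?N (module_vec TYPE(complex) d)"
      using Wsub by (auto simp: subspace_vec_iff act_add_vec act_smult_vec act_zero_vec)
    moreover have "A \<subseteq> ?N"
    proof
      fix y assume "y \<in> A"
      then obtain v where v: "v \<in> same_shape u" "y = f v" by (auto simp: A_def)
      then obtain v' a b where v': "v' \<in> same_shape u" "family_gen n q k * F v = a *s F v + b *s F v'"
        using F(4)[OF v(1) k] by blast
      have "act (family_gen n q k) y = a \<cdot>\<^sub>v f v + b \<cdot>\<^sub>v f v'"
        using v v' x by (simp add: f_def act_mult[symmetric] act_add act_scale)
      moreover have "f v \<in> ?W" "f v' \<in> ?W" using AW v v' by (auto simp: A_def)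
      ultimately show "y \<in> ?N" using Wsub v fc by (simp add: subspace_vec_iff)
    qed
    ultimately show ?thesis using span_vec_subset w by blast
  qed
  have uu: "u \<in> same_shape u" using u by (simp add: same_shape_def)
  have W: "?W = carrier_vec d"
  proof -
    have "\<forall>h\<in>carrier (hecke n q). \<forall>w\<in>?W. \<rho> h *\<^sub>v w \<in> ?W" using invariant_subspace[OF Wsub gen] by blast
    then have "?W = {0\<^sub>v d} \<or> ?W = carrier_vec d" using irr Wsub unfolding irreducible_rep_def by blast
    moreover have "f u \<in> ?W" "f u \<noteq> 0\<^sub>v d" using AW fnz uu by (auto simp: A_def)
    ultimately show ?thesis by blast
  qed
  have basis: "vec_basis d A"
  proof (rule basis_vecI[where P = "\<lambda>v. \<rho> (proj (E (inv_into (same_shape u) f v)))"])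
    fix v w assume "v \<in> A" "w \<in> A"
    then show "\<rho> (proj (E (inv_into (same_shape u) f v))) *\<^sub>v w = (if v = w then w else 0\<^sub>v d)"
      using fE inj by (auto simp: A_def act_def inj_on_eq_iff)
  next
    show "0\<^sub>v d \<notin> A" using fnz unfolding A_def by (metis imageE)
  qed (use AC W rep_closed in \<open>auto simp: A_def\<close>)
  define g where "g V = f (inv_into UNIV tableau_of V)" for V
  have inv: "inv_into UNIV tableau_of (tableau_of w) = w" for w
    using tableau_of_inj by (intro inv_f_f) (auto simp: inj_def)
  have shape: "tableaux_of_shape n (diagram (shape u)) = tableau_of ` same_shape u"
    using tableaux_of_shape_eq u n by simp
  have "young_basis n q (diagram (shape u)) d \<rho> g"
    unfolding young_basis_def shape
  proof (intro conjI ballI)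
    show "inj_on g (tableau_of ` same_shape u)"
      using inj by (auto simp: g_def inv inj_on_def)
    have "g ` tableau_of ` same_shape u = A" by (auto simp: g_def inv A_def image_image)
    then show "vec_basis d (g ` tableau_of ` same_shape u)"
      using basis by simp
    fix V j assume "V \<in> tableau_of ` same_shape u" and j: "j \<in> {1..n}"
    then obtain w where w: "w \<in> same_shape u" "V = tableau_of w" by blast
    obtain k where k: "j = Suc k" "k < n" using j by (cases j) auto
    show "\<rho> (jucys_murphy n q j) *\<^sub>v g V = q_content q V j \<cdot>\<^sub>v g V"
      using fJ[OF w(1) k(2)] proj_J[OF k(2)] q_content_tableau_of[of w k q] len[OF w(1)] k w
      by (simp add: g_def inv act_def Q_def)
  qed
  then show ?thesis using irr unfolding labelled_rep_def by blast
qed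

end

lemma is_tableau_idempotent_E:
  assumes u: "lattice u" "length u = n" and n: "n \<ge> 1"
  shows "is_tableau_idempotent n q (tableau_of u) (proj (E u))"
  unfolding is_tableau_idempotent_def
proof (intro conjI allI impI ballI)
  have last: "last (tableau_of u) = diagram (shape u)" using u n by (intro last_tableau_of) auto
  have shape: "tableaux_of_shape n (diagram (shape u)) = tableau_of ` same_shape u"
    using tableaux_of_shape_eq u n by simp
  show "proj (E u) \<in> carrier (hecke n q)" by simp
  show "\<rho> (proj (E u)) = 0\<^sub>m d d"
    if "irreducible_rep n q d \<rho> \<and> \<not> labelled_rep n q (last (tableau_of u)) d \<rho>" for d \<rho>
    using labelled_if_E_nonzero[of d \<rho> u] that u n last by (auto simp: irreducible_rep_def)
  fix d \<rho> v V
  assume A: "irreducible_rep n q d \<rho> \<and> young_basis n q (last (tableau_of u)) d \<rho> v"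
    and V: "V \<in> tableaux_of_shape n (last (tableau_of u))"
  then have rep: "hecke_rep n q d \<rho>" by (simp add: irreducible_rep_def)
  obtain w where w: "w \<in> same_shape u" "V = tableau_of w" using V last shape by auto
  then have lw: "lattice w" "length w = n" using same_shape_length[of w u] u by (auto simp: same_shape_def)
  have "act \<rho> (J k) (v V) = Q (contents w ! k) \<cdot>\<^sub>v v V" if k: "k < n" for k
  proof -
    have "\<rho> (jucys_murphy n q (Suc k)) *\<^sub>v v V = q_content q V (Suc k) \<cdot>\<^sub>v v V"
      using A V k by (auto simp: young_basis_def)
    then show ?thesis using q_content_tableau_of[of w k q] w lw k
      by (simp add: act_def[OF rep] proj_J Q_def)
  qed
  moreover have "v V \<in> carrier_vec d" using young_basis_vec_closed[OF rep] A V by blast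
  ultimately have "act \<rho> (E u) (v V) = (if u = w then v V else 0\<^sub>v d)"
    using act_E[OF rep u(1) lw(1) u(2) lw(2)] by blast
  moreover have "u = w \<longleftrightarrow> V = tableau_of u" using w tableau_of_inj by blast
  ultimately show "\<rho> (proj (E u)) *\<^sub>v v V = (if V = tableau_of u then v V else 0\<^sub>v d)"
    by (simp add: act_def[OF rep])
qed


subsection \<open>Uniqueness of the idempotent\<close>

lemma embed_simps:
  assumes "g \<in> carrier (hecke n q)" "h \<in> carrier (hecke n q)"
  shows "embed (g \<oplus>\<^bsub>hecke n q\<^esub> h) = embed g + embed h"
    and "embed (g \<otimes>\<^bsub>hecke n q\<^esub> h) = embed g * embed h"
    and "embed (hecke_scalar n q a \<otimes>\<^bsub>hecke n q\<^esub> h) = a *s embed h"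
  using assms ring_hecke
  by (auto intro!: hecke_family_eqI simp: coord_embed coord_simps coord_scale ring.ring_simprules)

lemma mult_embed: "h \<in> carrier (hecke n q) \<Longrightarrow> x * embed h = embed (proj x \<otimes>\<^bsub>hecke n q\<^esub> h)"
  using ring_hecke by (auto intro!: hecke_family_eqI simp: coord_embed coord_simps proj_def ring.ring_simprules)

lemma embed_proj_mult: "embed (proj x) * embed (proj y) = x * embed (proj y)"
  using mult_embed[of "proj y" x] embed_simps(2)[of "proj x" "proj y"] by simp

lemma embed_proj_simps:
  "embed (proj (x + y)) = embed (proj x) + embed (proj y)" "embed (proj (a *s x)) = a *s embed (proj x)"
  using embed_simps(1,3)[OF proj_closed proj_closed] by (simp_all add: proj_simps)

lemma embed_scalar_mult:
  "h \<in> carrier (hecke n q) \<Longrightarrow> embed (hecke_scalar n q a) * embed h = a *s embed h"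
  using embed_simps(2,3)[of "hecke_scalar n q a" h] by simp

lemma embed_inj:
  "g \<in> carrier (hecke n q) \<Longrightarrow> h \<in> carrier (hecke n q) \<Longrightarrow> embed g = embed h \<Longrightarrow> g = h"
  by (metis proj_embed)

lemma embed_0: "embed \<zero>\<^bsub>hecke n q\<^esub> = 0"
  by (rule hecke_family_eqI) (simp add: coord_embed coord_simps ring.ring_simprules(2)[OF ring_hecke])

text \<open>
  A family \<open>f\<close> of linearly independent elements whose span is stable under the generators turns left
  multiplication into matrices.
\<close>

definition combination :: "nat \<Rightarrow> (nat \<Rightarrow> hecke_family) \<Rightarrow> complex vec \<Rightarrow> hecke_family" where
  "combination d f x = (\<Sum>i<d. x $ i *s f i)"

definition matrix_of :: "nat \<Rightarrow> (nat \<Rightarrow> hecke_family) \<Rightarrow> nc_poly set \<Rightarrow> complex mat \<Rightarrow> bool" where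
  "matrix_of d f h M \<longleftrightarrow> M \<in> carrier_mat d d \<and>
     (\<forall>x\<in>carrier_vec d. combination d f (M *\<^sub>v x) = embed h * combination d f x)"

lemma combination_add:
  "x \<in> carrier_vec d \<Longrightarrow> y \<in> carrier_vec d \<Longrightarrow>
   combination d f (x + y) = combination d f x + combination d f y"
  by (simp add: combination_def scale_left_distrib sum.distrib)

lemma combination_smult: "x \<in> carrier_vec d \<Longrightarrow> combination d f (a \<cdot>\<^sub>v x) = a *s combination d f x"
  by (simp add: combination_def scale_sum_right)

lemma combination_unit: "i < d \<Longrightarrow> combination d f (unit_vec d i) = f i"
proof -
  assume i: "i < d"
  have "combination d f (unit_vec d i) = (\<Sum>j<d. if j = i then f i else 0)"
    unfolding combination_def by (intro sum.cong) (auto simp: i)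
  then show ?thesis using i by simp
qed

lemma matrix_ofI:
  assumes M: "M \<in> carrier_mat d d"
    and "\<And>j. j < d \<Longrightarrow> embed h * f j = (\<Sum>i<d. M $$ (i, j) *s f i)"
  shows "matrix_of d f h M"
  unfolding matrix_of_def
proof (intro conjI ballI M)
  fix x :: "complex vec" assume x: "x \<in> carrier_vec d"
  have "combination d f (M *\<^sub>v x) = (\<Sum>i<d. \<Sum>j<d. (x $ j * M $$ (i, j)) *s f i)"
    using M x by (auto simp: combination_def scalar_prod_def scale_sum_left[symmetric] lessThan_atLeast0
        mult.commute intro!: sum.cong)
  also have "\<dots> = (\<Sum>j<d. \<Sum>i<d. (x $ j * M $$ (i, j)) *s f i)" by (rule sum.swap)
  also have "\<dots> = (\<Sum>j<d. x $ j *s (embed h * f j))"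
    using assms(2) by (auto simp: scale_sum_right intro!: sum.cong)
  also have "\<dots> = embed h * combination d f x"
    by (simp add: combination_def sum_distrib_left mult_scale)
  finally show "combination d f (M *\<^sub>v x) = embed h * combination d f x" .
qed

text \<open>The elements e take the place of a dual basis: left multiplication by \<open>e i\<close>
  keeps \<open>f i\<close> and kills the other members. This yields coordinates, and with them
  uniqueness of matrices.\<close>

context
  fixes d :: nat and f :: "nat \<Rightarrow> hecke_family" and e :: "nat \<Rightarrow> hecke_family"
  assumes f_nonzero: "i < d \<Longrightarrow> f i \<noteq> 0"
    and f_embed: "i < d \<Longrightarrow> \<exists>h\<in>carrier (hecke n q). f i = embed h"
    and dual: "i < d \<Longrightarrow> j < d \<Longrightarrow> e i * f j = (if i = j then f j else 0)"
    and stable: "k + 1 < n \<Longrightarrow> \<exists>M. matrix_of d f (hecke_T n q (Suc k)) M"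
begin

lemma dual_combination: "j < d \<Longrightarrow> e j * combination d f x = x $ j *s f j"
proof -
  assume j: "j < d"
  have "e j * combination d f x = (\<Sum>i<d. if i = j then x $ j *s f j else 0)"
    unfolding combination_def sum_distrib_left using dual j by (intro sum.cong) (auto simp: mult_scale)
  then show ?thesis using j by simp
qed

lemma combination_inj:
  assumes "x \<in> carrier_vec d" "y \<in> carrier_vec d" "combination d f x = combination d f y"
  shows "x = y"
proof (rule eq_vecI)
  fix i assume "i < dim_vec y"
  then have i: "i < d" using assms by auto
  then have "x $ i *s f i = y $ i *s f i" using dual_combination assms(3) by metis
  then show "x $ i = y $ i" using f_nonzero[OF i] by simp
qed (use assms in auto)

lemma matrix_of_unique: "matrix_of d f h M \<Longrightarrow> matrix_of d f h M' \<Longrightarrow> M = M'"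
  by (rule mat_eqI_vec[of _ d]) (auto simp: matrix_of_def intro!: combination_inj)

lemma embed_scalar_combination: "embed (hecke_scalar n q a) * combination d f x = a *s combination d f x"
  unfolding combination_def sum_distrib_left scale_sum_right
proof (rule sum.cong[OF refl])
  fix i assume "i \<in> {..<d}"
  then obtain h where "h \<in> carrier (hecke n q)" "f i = embed h" using f_embed by auto
  then show "embed (hecke_scalar n q a) * x $ i *s f i = a *s x $ i *s f i"
    by (simp add: mult_scale embed_scalar_mult mult.commute)
qed

lemma matrix_of_scalar: "matrix_of d f (hecke_scalar n q a) (a \<cdot>\<^sub>m 1\<^sub>m d)"
  by (auto simp: matrix_of_def scalar_mat_mult_vec combination_smult embed_scalar_combination)

lemma matrix_of_mult:
  assumes "g \<in> carrier (hecke n q)" "h \<in> carrier (hecke n q)" "matrix_of d f g M" "matrix_of d f h M'"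
  shows "matrix_of d f (g \<otimes>\<^bsub>hecke n q\<^esub> h) (M * M')"
  using assms by (auto simp: matrix_of_def embed_simps mult.assoc assoc_mult_mat_vec[of _ d d _ d])

lemma matrix_of_add:
  assumes "g \<in> carrier (hecke n q)" "h \<in> carrier (hecke n q)" "matrix_of d f g M" "matrix_of d f h M'"
  shows "matrix_of d f (g \<oplus>\<^bsub>hecke n q\<^esub> h) (M + M')"
  using assms
  by (auto simp: matrix_of_def embed_simps distrib_right add_mult_distrib_mat_vec[of _ d d]
      combination_add[of _ d])

lemma matrix_of_exists: "h \<in> carrier (hecke n q) \<Longrightarrow> \<exists>M. matrix_of d f h M"
proof (induction h rule: hecke_induct)
  case (gen i)
  then show ?case using stable[of "i - 1"] by auto
qed (use matrix_of_scalar matrix_of_mult matrix_of_add in blast)+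

definition ideal_rep :: "nc_poly set \<Rightarrow> complex mat" where
  "ideal_rep h = (THE M. matrix_of d f h M)"

lemma ideal_rep: "h \<in> carrier (hecke n q) \<Longrightarrow> matrix_of d f h (ideal_rep h)"
  unfolding ideal_rep_def using matrix_of_exists matrix_of_unique by (metis theI)

lemma ideal_rep_eqI: "matrix_of d f h M \<Longrightarrow> ideal_rep h = M"
  unfolding ideal_rep_def using matrix_of_unique by blast

lemma hecke_rep_ideal_rep: "hecke_rep n q d ideal_rep"
  unfolding hecke_rep_def
proof (intro conjI allI)
  show "ideal_rep (hecke_scalar n q a) = a \<cdot>\<^sub>m 1\<^sub>m d" for a by (rule ideal_rep_eqI[OF matrix_of_scalar])
  from this[of 1] have "ideal_rep \<one>\<^bsub>hecke n q\<^esub> = 1 \<cdot>\<^sub>m 1\<^sub>m d" by (simp add: hecke_scalar_simps)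
  also have "\<dots> = 1\<^sub>m d" by (rule eq_matI) auto
  finally have "ideal_rep \<one>\<^bsub>hecke n q\<^esub> = 1\<^sub>m d" .
  then show "ideal_rep \<in> Ring.ring_hom (hecke n q) (ring_mat TYPE(complex) d ())"
  proof (intro ring_hom_memI, unfold ring_mat_simps)
    fix g h assume gh: "g \<in> carrier (hecke n q)" "h \<in> carrier (hecke n q)"
    show "ideal_rep g \<in> carrier_mat d d" using ideal_rep[OF gh(1)] by (simp add: matrix_of_def)
    show "ideal_rep (g \<otimes>\<^bsub>hecke n q\<^esub> h) = ideal_rep g * ideal_rep h"
      by (intro ideal_rep_eqI matrix_of_mult gh ideal_rep)
    show "ideal_rep (g \<oplus>\<^bsub>hecke n q\<^esub> h) = ideal_rep g + ideal_rep h"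
      by (intro ideal_rep_eqI matrix_of_add gh ideal_rep)
  qed
qed

text \<open>A nonzero vector of an invariant subspace has a nonzero coordinate j. Multiplication by
  \<open>e j\<close> isolates it, and a connecting element carries \<open>f j\<close> to any
  \<open>f i\<close>, so the subspace contains all unit vectors.\<close>

lemma irreducible_ideal_rep:
  assumes "d > 0" and conn: "\<And>i j. i < d \<Longrightarrow> j < d \<Longrightarrow> \<exists>x. x * f j = f i"
  shows "irreducible_rep n q d ideal_rep"
  unfolding irreducible_rep_def
proof (intro conjI allI impI hecke_rep_ideal_rep assms(1))
  fix W
  assume W: "VectorSpace.subspace class_ring W (module_vec TYPE(complex) d) \<and>
    (\<forall>h\<in>carrier (hecke n q). \<forall>w\<in>W. ideal_rep h *\<^sub>v w \<in> W)"
  then have sub: "W \<subseteq> carrier_vec d" "0\<^sub>v d \<in> W" "\<And>v w. v \<in> W \<Longrightarrow> w \<in> W \<Longrightarrow> v + w \<in> W"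
    "\<And>c v. v \<in> W \<Longrightarrow> c \<cdot>\<^sub>v v \<in> W"
    by (auto simp: subspace_vec_iff)
  have inW: "y \<in> W" if "w \<in> W" "y \<in> carrier_vec d" "combination d f y = x * combination d f w" for x y w
  proof -
    have w: "w \<in> carrier_vec d" using that sub by auto
    have "embed (proj x) * combination d f w = x * combination d f w"
      unfolding combination_def sum_distrib_left
    proof (rule sum.cong[OF refl])
      fix i assume "i \<in> {..<d}"
      then obtain h where "h \<in> carrier (hecke n q)" "f i = embed h" using f_embed by auto
      then show "embed (proj x) * w $ i *s f i = x * w $ i *s f i"
        using embed_proj_mult[of x "embed h"] by (simp add: mult_scale)
    qed
    then have "combination d f (ideal_rep (proj x) *\<^sub>v w) = combination d f y"
      using ideal_rep[of "proj x"] w that(3) by (simp add: matrix_of_def)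
    moreover have "ideal_rep (proj x) *\<^sub>v w \<in> carrier_vec d"
      using ideal_rep[of "proj x"] w unfolding matrix_of_def by (metis mult_mat_vec_carrier proj_closed)
    ultimately have "ideal_rep (proj x) *\<^sub>v w = y" using combination_inj that by blast
    then show ?thesis using W that(1) proj_closed[of x] by metis
  qed
  show "W = {0\<^sub>v d} \<or> W = carrier_vec d"
  proof (rule disjCI)
    assume "W \<noteq> carrier_vec d"
    show "W = {0\<^sub>v d}"
    proof (rule ccontr)
      assume "W \<noteq> {0\<^sub>v d}"
      then obtain w where w: "w \<in> W" "w \<noteq> 0\<^sub>v d" using sub by blast
      then have "w \<in> carrier_vec d" using sub by auto
      then obtain j where j: "j < d" "w $ j \<noteq> 0" using w(2) by (auto simp: vec_eq_iff)
      have unit: "unit_vec d i \<in> W" if i: "i < d" for i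
      proof -
        obtain x where x: "x * f j = f i" using conn i j by blast
        have "combination d f (w $ j \<cdot>\<^sub>v unit_vec d i) = (x * e j) * combination d f w"
          using i x dual_combination[OF j(1)]
          by (simp add: combination_smult combination_unit mult.assoc mult_scale)
        then have "w $ j \<cdot>\<^sub>v unit_vec d i \<in> W" using inW w by simp
        then have "inverse (w $ j) \<cdot>\<^sub>v (w $ j \<cdot>\<^sub>v unit_vec d i) \<in> W" by (rule sub)
        then show ?thesis using j(2) by (simp add: smult_smult_assoc)
      qed
      have "x \<in> W" if x: "x \<in> carrier_vec d" for x
      proof -
        have "vec d (\<lambda>i. if i < k then x $ i else 0) \<in> W" if "k \<le> d" for k
          using that
        proof (induction k)
          case 0
          have "vec d (\<lambda>i. if i < 0 then x $ i else 0) = 0\<^sub>v d" by (intro eq_vecI) auto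
          then show ?case using sub by simp
        next
          case (Suc k)
          have "vec d (\<lambda>i. if i < Suc k then x $ i else 0) =
              vec d (\<lambda>i. if i < k then x $ i else 0) + x $ k \<cdot>\<^sub>v unit_vec d k"
            using Suc by (intro eq_vecI) (auto simp: less_Suc_eq)
          then show ?case using Suc sub unit by simp
        qed
        from this[of d] have "vec d (\<lambda>i. if i < d then x $ i else 0) \<in> W" by simp
        moreover have "vec d (\<lambda>i. if i < d then x $ i else 0) = x" using x by (intro eq_vecI) auto
        ultimately show ?thesis by simp
      qed
      then show False using \<open>W \<noteq> carrier_vec d\<close> sub by blast
    qed
  qed
qed

lemma ideal_rep_cancel:
  assumes "g \<in> carrier (hecke n q)" "h \<in> carrier (hecke n q)" "ideal_rep g = ideal_rep h" "i < d"
  shows "embed g * f i = embed h * f i"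
  using ideal_rep[OF assms(1)] ideal_rep[OF assms(2)] assms(3,4) combination_unit[OF assms(4), of f]
  unfolding matrix_of_def by (metis unit_vec_carrier)

end

section \<open>Elements are determined by the irreducible representations\<close>

lemma is_tableau_idempotent_same_image:
  assumes e: "is_tableau_idempotent n q U e" "is_tableau_idempotent n q U e'"
    and irr: "irreducible_rep n q d \<rho>"
  shows "\<rho> e = \<rho> e'"
proof (cases "labelled_rep n q (last U) d \<rho>")
  case False
  then have "\<rho> e = 0\<^sub>m d d" "\<rho> e' = 0\<^sub>m d d" using e irr unfolding is_tableau_idempotent_def by blast+
  then show ?thesis by simp
next
  case True
  then obtain v where v: "young_basis n q (last U) d \<rho> v" by (auto simp: labelled_rep_def)
  have rep: "hecke_rep n q d \<rho>" using irr by (simp add: irreducible_rep_def)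
  have c: "\<rho> e \<in> carrier_mat d d" "\<rho> e' \<in> carrier_mat d d"
    using rep_closed[OF rep] e by (auto simp: is_tableau_idempotent_def)
  have on_basis: "\<rho> e *\<^sub>v v V = \<rho> e' *\<^sub>v v V" if "V \<in> tableaux_of_shape n (last U)" for V
  proof -
    have "\<rho> e *\<^sub>v v V = (if V = U then v V else 0\<^sub>v d)" "\<rho> e' *\<^sub>v v V = (if V = U then v V else 0\<^sub>v d)"
      using e irr v that unfolding is_tableau_idempotent_def by blast+
    then show ?thesis by simp
  qed
  define A where "A = v ` tableaux_of_shape n (last U)"
  have A: "A \<subseteq> carrier_vec d" "vec_span d A = carrier_vec d"
    using v vec_basisD[of d A] by (auto simp: young_basis_def A_def)
  let ?N = "{x \<in> carrier_vec d. \<rho> e *\<^sub>v x = \<rho> e' *\<^sub>v x}"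
  have "VectorSpace.subspace class_ring ?N (module_vec TYPE(complex) d)"
    using c by (auto simp: subspace_vec_iff mult_mat_zero_vec mult_add_distrib_mat_vec[of _ d d]
        mult_mat_vec[of _ d d])
  moreover have "A \<subseteq> ?N" using A(1) on_basis by (auto simp: A_def)
  ultimately have "carrier_vec d \<subseteq> ?N" using span_vec_subset A(2) by metis
  then show ?thesis using c by (intro mat_eqI_vec[of _ d]) auto
qed

text \<open>If \<open>E w\<close> is not zero in the Hecke algebra, its left ideal, written in
  matrices for the basis of \<open>young_family\<close>, is one of the irreducible representations
  on which g and h agree. Evaluating at the basis member \<open>E w\<close> itself gives the claim.
  The zero case is separated because the basis members must not vanish.\<close>

lemma ideal_of_E_separates:
  assumes w: "w \<in> words n" and g: "g \<in> carrier (hecke n q)" "h \<in> carrier (hecke n q)"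
    and eq: "\<And>d \<rho>. irreducible_rep n q d \<rho> \<Longrightarrow> \<rho> g = \<rho> h"
  shows "embed g * embed (proj (E w)) = embed h * embed (proj (E w))"
proof (cases "proj (E w) = \<zero>\<^bsub>hecke n q\<^esub>")
  case True
  then show ?thesis by (simp add: embed_0)
next
  case False
  have lw: "lattice w" "length w = n" using w by (auto simp: words_def)
  obtain F where F: "F w = E w"
    "\<And>v. v \<in> same_shape w \<Longrightarrow> eigen (contents v) (F v)"
    "\<And>v. v \<in> same_shape w \<Longrightarrow> \<exists>x. F v = x * E w"
    "\<And>v. v \<in> same_shape w \<Longrightarrow> \<exists>x. x * F v = E w"
    "\<And>v k. v \<in> same_shape w \<Longrightarrow> k + 1 < n \<Longrightarrow>
      \<exists>v'\<in>same_shape w. \<exists>x z. family_gen n q k * F v = x *s F v + z *s F v'"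
    by (rule young_family[OF lw]) blast
  obtain vs where vs: "set vs = same_shape w" "distinct vs"
    using finite_distinct_list[OF finite_same_shape] by blast
  define d where "d = length vs"
  \<comment> \<open>The other coordinates of the product ring are cut off: there the generators are
    scalars, and an element could be nonzero without being so in \<open>hecke n q\<close>.\<close>
  define f where "f i = embed (proj (F (vs ! i)))" for i
  have mem: "vs ! i \<in> same_shape w" if "i < d" for i
    using nth_mem[of i vs] that unfolding d_def vs(1) .
  have lat: "lattice v" "length v = n" if "v \<in> same_shape w" for v
    using same_shape_length[OF that] that lw by (auto simp: same_shape_def)
  have xf: "x * f i = embed (proj (x * F (vs ! i)))" for x i
    unfolding f_def using mult_embed[of "proj (F (vs ! i))" x] by (simp add: proj_simps)
  obtain i0 where i0: "i0 < d" "vs ! i0 = w"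
    using vs(1) lw in_set_conv_nth[of w vs] by (auto simp: d_def same_shape_def)
  have conn: "\<exists>x. x * f j = f i" if ij: "i < d" "j < d" for i j
  proof -
    obtain x y where "x * F (vs ! j) = E w" "F (vs ! i) = y * E w"
      using F(3)[OF mem[OF ij(1)]] F(4)[OF mem[OF ij(2)]] by blast
    then have "y * x * F (vs ! j) = F (vs ! i)" by (simp add: mult.assoc)
    then have "y * x * f j = f i" unfolding xf by (simp add: f_def)
    then show ?thesis by blast
  qed
  have nz: "f i \<noteq> 0" if i: "i < d" for i
  proof
    assume "f i = 0"
    moreover obtain x where "x * f i = f i0" using conn i i0 by blast
    ultimately have "f i0 = 0" by (metis mult_zero_right)
    then have "proj (E w) = proj 0" using i0 F(1) by (metis f_def proj_closed proj_embed)
    then show False using False by (simp add: proj_simps)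
  qed
  have dual: "E (vs ! i) * f j = (if i = j then f j else 0)" if "i < d" "j < d" for i j
  proof -
    have "E (vs ! i) * F (vs ! j) = (if vs ! i = vs ! j then F (vs ! j) else 0)"
      using E_action F(2) lat mem that by simp
    moreover have "vs ! i = vs ! j \<longleftrightarrow> i = j" using vs(2) that by (simp add: nth_eq_iff_index_eq d_def)
    ultimately show ?thesis unfolding xf by (simp add: f_def proj_simps embed_0)
  qed
  have stable: "\<exists>M. matrix_of d f (hecke_T n q (Suc k)) M" if k: "k + 1 < n" for k
  proof -
    have "\<exists>\<sigma> x z. \<sigma> < d \<and> family_gen n q k * f j = x *s f j + z *s f \<sigma>" if j: "j < d" for j
    proof -
      obtain v' x z where v': "v' \<in> same_shape w"
        "family_gen n q k * F (vs ! j) = x *s F (vs ! j) + z *s F v'"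
        using F(5)[OF mem[OF j] k] by blast
      obtain \<sigma> where \<sigma>: "\<sigma> < d" "vs ! \<sigma> = v'" using v'(1) vs(1) by (metis d_def in_set_conv_nth)
      have "family_gen n q k * f j = x *s f j + z *s f \<sigma>"
        unfolding xf v'(2) by (simp add: embed_proj_simps f_def \<sigma>)
      then show ?thesis using \<sigma> by blast
    qed
    then obtain \<sigma> x z where s: "\<And>j. j < d \<Longrightarrow> \<sigma> j < d"
      "\<And>j. j < d \<Longrightarrow> family_gen n q k * f j = x j *s f j + z j *s f (\<sigma> j)"
      by metis
    \<comment> \<open>The two entries of a column are added, not distinguished by cases, because
      \<sigma> j may coincide with j.\<close>
    let ?M = "mat d d (\<lambda>(i, j). (if i = j then x j else 0) + (if i = \<sigma> j then z j else 0))"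
    have "matrix_of d f (hecke_T n q (Suc k)) ?M"
    proof (rule matrix_ofI)
      fix j assume j: "j < d"
      have "(\<Sum>i<d. ?M $$ (i, j) *s f i) =
          (\<Sum>i<d. (if i = j then x j *s f j else 0) + (if i = \<sigma> j then z j *s f (\<sigma> j) else 0))"
        using j by (intro sum.cong) (auto simp: scale_left_distrib)
      also have "\<dots> = x j *s f j + z j *s f (\<sigma> j)"
        using j s(1)[OF j] by (simp add: sum.distrib)
      also have "\<dots> = embed (hecke_T n q (Suc k)) * f j"
        unfolding s(2)[OF j, symmetric] proj_gen[OF k, symmetric] unfolding f_def
        by (rule embed_proj_mult[symmetric])
      finally show "embed (hecke_T n q (Suc k)) * f j = (\<Sum>i<d. ?M $$ (i, j) *s f i)" ..
    qed simp
    then show ?thesis by blast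
  qed
  have f_embed: "\<exists>h\<in>carrier (hecke n q). f i = embed h" for i
    unfolding f_def using proj_closed by blast
  have "irreducible_rep n q d (ideal_rep d f)"
    using irreducible_ideal_rep[of d f "\<lambda>i. E (vs ! i)"] nz f_embed dual stable conn i0 by blast
  then have "ideal_rep d f g = ideal_rep d f h" by (rule eq)
  then have "embed g * f i0 = embed h * f i0"
    using ideal_rep_cancel[of d f "\<lambda>i. E (vs ! i)" g h i0] nz f_embed dual stable g i0 by blast
  then show ?thesis using i0 F(1) by (simp add: f_def)
qed

theorem tableau_idempotent_E:
  assumes u: "lattice u" "length u = n" and n: "n \<ge> 1"
  shows "tableau_idempotent n q (tableau_of u) = proj (E u)"
  unfolding tableau_idempotent_def
proof (rule the_equality)
  show E: "is_tableau_idempotent n q (tableau_of u) (proj (E u))"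
    by (rule is_tableau_idempotent_E[OF assms])
  fix e assume e: "is_tableau_idempotent n q (tableau_of u) e"
  then have c: "e \<in> carrier (hecke n q)" by (simp add: is_tableau_idempotent_def)
  have decomp: "embed g = (\<Sum>w\<in>words n. embed g * embed (proj (E w)))" if g: "g \<in> carrier (hecke n q)" for g
  proof -
    have "embed g * x = embed g * embed (proj x)" for x
      using ring_hecke g
      by (auto intro!: hecke_family_eqI simp: coord_embed coord_simps proj_def ring.ring_simprules)
    then have "(\<Sum>w\<in>words n. embed g * embed (proj (E w))) = embed g * (\<Sum>w\<in>words n. E w)"
      by (simp add: sum_distrib_left)
    then show ?thesis using sum_E[of n] by simp
  qed
  have "embed e = (\<Sum>w\<in>words n. embed e * embed (proj (E w)))" by (rule decomp[OF c])
  also have "\<dots> = (\<Sum>w\<in>words n. embed (proj (E u)) * embed (proj (E w)))"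
    by (intro sum.cong refl ideal_of_E_separates c proj_closed is_tableau_idempotent_same_image[OF e E])
  also have "\<dots> = embed (proj (E u))" by (rule decomp[OF proj_closed, symmetric])
  finally have "embed e = embed (proj (E u))" .
  then show "e = proj (E u)" using embed_inj c by simp
qed

end


section \<open>Evaluation of rational functions\<close>

lemma poly_functions_subst:
  assumes "p \<in> poly_functions n" "\<And>i. i \<in> {1..n} \<Longrightarrow> (\<lambda>u. s u i) \<in> poly_functions n"
  shows "(\<lambda>u. p (s u)) \<in> poly_functions n"
  using assms(1)
proof induction
  case (var i)
  then show ?case by (rule assms(2))
qed (auto intro: poly_functions.intros)

lemma poly_functions_diff:
  assumes "p \<in> poly_functions n" "r \<in> poly_functions n"
  shows "(\<lambda>u. p u - r u) \<in> poly_functions n"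
proof -
  have "(\<lambda>u. p u + (- 1) * r u) \<in> poly_functions n"
    by (intro poly_functions.add poly_functions.mult poly_functions.const assms)
  then show ?thesis by simp
qed

lemma poly_functions_prod:
  "finite A \<Longrightarrow> (\<And>a. a \<in> A \<Longrightarrow> p a \<in> poly_functions n) \<Longrightarrow> (\<lambda>u. \<Prod>a\<in>A. p a u) \<in> poly_functions n"
  by (induction A rule: finite_induct) (auto intro: poly_functions.intros)

lemmas poly_functions_intros =
  poly_functions.add poly_functions.mult poly_functions_diff poly_functions.const poly_functions.var

lemma poly_functions_line:
  assumes "p \<in> poly_functions n"
  shows "\<exists>P. \<forall>t. p (\<lambda>i. u i + t * (v i - u i)) = poly P t"
  using assms
proof induction
  case (const a)
  show ?case by (intro exI[of _ "[:a:]"]) simp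
next
  case (var i)
  show ?case by (intro exI[of _ "[:u i, v i - u i:]"]) simp
next
  case (add p r)
  then obtain P R where "\<forall>t. p (\<lambda>i. u i + t * (v i - u i)) = poly P t"
    "\<forall>t. r (\<lambda>i. u i + t * (v i - u i)) = poly R t" by blast
  then show ?case by (intro exI[of _ "P + R"]) simp
next
  case (mult p r)
  then obtain P R where "\<forall>t. p (\<lambda>i. u i + t * (v i - u i)) = poly P t"
    "\<forall>t. r (\<lambda>i. u i + t * (v i - u i)) = poly R t" by blast
  then show ?case by (intro exI[of _ "P * R"]) simp
qed

text \<open>On the line through a point where p does not vanish and one where r does not, both
  functions become nonzero polynomials in one variable, and their product has a non-root.\<close>

lemma poly_functions_domain:
  assumes "p \<in> poly_functions n" "r \<in> poly_functions n" "\<exists>u. p u \<noteq> 0" "\<exists>u. r u \<noteq> 0"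
  shows "\<exists>u. p u * r u \<noteq> 0"
proof -
  obtain u v where uv: "p u \<noteq> 0" "r v \<noteq> 0" using assms by blast
  obtain P where P: "\<And>t. p (\<lambda>i. u i + t * (v i - u i)) = poly P t"
    using poly_functions_line[OF assms(1), of u v] by blast
  obtain R where R: "\<And>t. r (\<lambda>i. u i + t * (v i - u i)) = poly R t"
    using poly_functions_line[OF assms(2), of u v] by blast
  have "poly P 0 \<noteq> 0" "poly R 1 \<noteq> 0" using P[of 0] R[of 1] uv by auto
  then have "P * R \<noteq> 0" by auto
  then obtain t where "poly (P * R) t \<noteq> 0" using poly_all_0_iff_0 by blast
  then show ?thesis using P R by (intro exI[of _ "\<lambda>i. u i + t * (v i - u i)"]) auto
qed

lemma generically_mono:
  "generically n P \<Longrightarrow> (\<And>u. P u \<Longrightarrow> R u) \<Longrightarrow> generically n R"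
  unfolding generically_def by blast

lemma generically_conj:
  assumes "generically n P" "generically n R"
  shows "generically n (\<lambda>u. P u \<and> R u)"
proof -
  obtain p r where "p \<in> poly_functions n" "r \<in> poly_functions n" "\<exists>u. p u \<noteq> 0" "\<exists>u. r u \<noteq> 0"
    "\<And>u. p u \<noteq> 0 \<Longrightarrow> P u" "\<And>u. r u \<noteq> 0 \<Longrightarrow> R u"
    using assms unfolding generically_def by metis
  then show ?thesis
    unfolding generically_def
    by (intro bexI[of _ "\<lambda>u. p u * r u"] conjI poly_functions_domain poly_functions.mult) auto
qed

lemma generically_nonzero: "p \<in> poly_functions n \<Longrightarrow> \<exists>u. p u \<noteq> 0 \<Longrightarrow> generically n (\<lambda>u. p u \<noteq> 0)"
  unfolding generically_def by blast

lemma generically_avoid: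
  assumes "finite B" "j \<in> {1..n}"
  shows "generically n (\<lambda>u. u j \<notin> B)"
proof -
  have "(\<lambda>u. \<Prod>b\<in>B. u j - b) \<in> poly_functions n"
    using assms by (intro poly_functions_prod poly_functions_intros) auto
  moreover obtain b where "b \<notin> B" using assms(1) ex_new_if_finite infinite_UNIV_char_0 by blast
  then have "\<exists>u :: nat \<Rightarrow> complex. (\<Prod>b\<in>B. u j - b) \<noteq> 0"
    using assms(1) by (intro exI[of _ "\<lambda>_. b"]) auto
  ultimately show ?thesis
    using generically_nonzero[of "\<lambda>u. \<Prod>b\<in>B. u j - b"] assms(1)
    by (auto elim!: generically_mono)
qed

context generic_hecke
begin

section \<open>Rational functions with values in the product ring\<close>

inductive_set family_polys :: "((nat \<Rightarrow> complex) \<Rightarrow> hecke_family) set" where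
  monom: "p \<in> poly_functions n \<Longrightarrow> (\<lambda>u. p u *s h) \<in> family_polys"
| add: "f \<in> family_polys \<Longrightarrow> g \<in> family_polys \<Longrightarrow> (\<lambda>u. f u + g u) \<in> family_polys"

lemma family_polys_proj: "f \<in> family_polys \<Longrightarrow> (\<lambda>u. proj (f u)) \<in> hecke_poly_functions n q"
  by (induction rule: family_polys.induct) (auto simp: proj_simps intro: hecke_poly_functions.intros)

lemma family_polys_scale:
  assumes "r \<in> poly_functions n" "f \<in> family_polys"
  shows "(\<lambda>u. r u *s f u) \<in> family_polys"
  using assms(2)
proof induction
  case (monom p h)
  show ?case using family_polys.monom[OF poly_functions.mult[OF assms(1) monom], of h] by simp
next
  case (add f g)
  then show ?case using family_polys.add by (simp add: scale_right_distrib)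
qed

lemma family_polys_mult:
  assumes "f \<in> family_polys" "g \<in> family_polys"
  shows "(\<lambda>u. f u * g u) \<in> family_polys"
  using assms(1)
proof induction
  case (monom p h)
  have "(\<lambda>u. h * g u) \<in> family_polys"
    using assms(2)
  proof induction
    case (monom p' h')
    show ?case using family_polys.monom[OF monom, of "h * h'"] by (simp add: mult_scale)
  next
    case (add f' g')
    then show ?case using family_polys.add by (simp add: distrib_left)
  qed
  then show ?case using family_polys_scale[OF monom] by (simp add: scale_mult)
next
  case (add f' g')
  then show ?case using family_polys.add by (simp add: distrib_right)
qed

lemma family_polys_subst:
  assumes "f \<in> family_polys" "\<And>i. i \<in> {1..n} \<Longrightarrow> (\<lambda>u. s u i) \<in> poly_functions n"
  shows "(\<lambda>u. f (s u)) \<in> family_polys"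
  using assms(1)
proof induction
  case (monom p h)
  have "(\<lambda>u. p (s u)) \<in> poly_functions n"
    by (rule poly_functions_subst[OF monom, where s = s]) (rule assms(2))
  then show ?case by (rule family_polys.monom)
qed (rule family_polys.add)

lemma family_polys_const: "(\<lambda>u. h) \<in> family_polys"
  using family_polys.monom[OF poly_functions.const[of 1 n], of h] by simp

text \<open>The equation is demanded off the zeros of p only, which keeps the conventions for
  division by zero out. The denominator is an argument because evaluation depends on whether it
  survives a substitution.\<close>

definition quotient_form :: "((nat \<Rightarrow> complex) \<Rightarrow> hecke_family) \<Rightarrow> ((nat \<Rightarrow> complex) \<Rightarrow> complex) \<Rightarrow> bool" where
  "quotient_form f p \<longleftrightarrow> p \<in> poly_functions n \<and>
     (\<exists>N\<in>family_polys. \<forall>u. p u \<noteq> 0 \<longrightarrow> f u = inverse (p u) *s N u)"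

lemma quotient_form_const: "quotient_form (\<lambda>u. h) (\<lambda>u. 1)"
  unfolding quotient_form_def
  by (intro conjI bexI[of _ "\<lambda>u. h"] family_polys_const poly_functions.const) auto

lemma quotient_form_scalar:
  assumes "a \<in> poly_functions n" "b \<in> poly_functions n"
  shows "quotient_form (\<lambda>u. (a u / b u) *s h) b"
  unfolding quotient_form_def
  by (intro conjI bexI[of _ "\<lambda>u. a u *s h"] family_polys.monom assms)
     (auto simp: field_simps)

lemma quotient_form_mult:
  assumes "quotient_form f p" "quotient_form g r"
  shows "quotient_form (\<lambda>u. f u * g u) (\<lambda>u. p u * r u)"
proof -
  obtain N M where "N \<in> family_polys" "\<And>u. p u \<noteq> 0 \<Longrightarrow> f u = inverse (p u) *s N u"
    "M \<in> family_polys" "\<And>u. r u \<noteq> 0 \<Longrightarrow> g u = inverse (r u) *s M u"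
    using assms unfolding quotient_form_def by metis
  then show ?thesis
    using assms unfolding quotient_form_def
    by (intro conjI bexI[of _ "\<lambda>u. N u * M u"] family_polys_mult poly_functions.mult)
       (auto simp: scale_mult mult_scale mult.commute)
qed

lemma quotient_form_add:
  assumes "quotient_form f p" "quotient_form g r"
  shows "quotient_form (\<lambda>u. f u + g u) (\<lambda>u. p u * r u)"
proof -
  obtain N M where NM: "N \<in> family_polys" "\<And>u. p u \<noteq> 0 \<Longrightarrow> f u = inverse (p u) *s N u"
    "M \<in> family_polys" "\<And>u. r u \<noteq> 0 \<Longrightarrow> g u = inverse (r u) *s M u"
    using assms unfolding quotient_form_def by metis
  have "f u + g u = inverse (p u * r u) *s (r u *s N u + p u *s M u)" if "p u * r u \<noteq> 0" for u
  proof -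
    have "inverse (p u * r u) * r u = inverse (p u)" "inverse (p u * r u) * p u = inverse (r u)"
      using that by auto
    then show ?thesis using NM that by (simp only: scale_right_distrib scale_scale) auto
  qed
  then show ?thesis
    using assms NM unfolding quotient_form_def
    by (intro conjI bexI[of _ "\<lambda>u. r u *s N u + p u *s M u"] family_polys.add family_polys_scale
        poly_functions.mult) auto
qed

lemma quotient_form_subst:
  assumes "quotient_form f p" "\<And>i. i \<in> {1..n} \<Longrightarrow> (\<lambda>u. s u i) \<in> poly_functions n"
  shows "quotient_form (\<lambda>u. f (s u)) (\<lambda>u. p (s u))"
proof -
  obtain N where N: "N \<in> family_polys" "\<And>u. p u \<noteq> 0 \<Longrightarrow> f u = inverse (p u) *s N u"
    and p: "p \<in> poly_functions n"
    using assms(1) unfolding quotient_form_def by blast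
  have "(\<lambda>u. p (s u)) \<in> poly_functions n"
    by (rule poly_functions_subst[OF p, where s = s]) (rule assms(2))
  moreover have "(\<lambda>u. N (s u)) \<in> family_polys"
    by (rule family_polys_subst[OF N(1), where s = s]) (rule assms(2))
  ultimately show ?thesis unfolding quotient_form_def
  proof (intro conjI bexI[where x = "\<lambda>u. N (s u)"] allI impI)
    show "f (s u) = inverse (p (s u)) *s N (s u)" if "p (s u) \<noteq> 0" for u by (rule N(2)[OF that])
  qed
qed

text \<open>Enlarging the denominator by r discards the points where f and g might differ.\<close>

lemma quotient_form_cong:
  assumes "quotient_form f p" "r \<in> poly_functions n" "\<And>u. r u \<noteq> 0 \<Longrightarrow> f u = g u"
  shows "quotient_form g (\<lambda>u. p u * r u)"
proof -
  obtain N where N: "N \<in> family_polys" "\<And>u. p u \<noteq> 0 \<Longrightarrow> f u = inverse (p u) *s N u"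
    and p: "p \<in> poly_functions n"
    using assms(1) unfolding quotient_form_def by blast
  have "g u = inverse (p u * r u) *s (r u *s N u)" if "p u * r u \<noteq> 0" for u
    using N(2)[of u] assms(3)[of u] that by simp
  then show ?thesis
    unfolding quotient_form_def
    by (intro conjI bexI[of _ "\<lambda>u. r u *s N u"] family_polys_scale poly_functions.mult N p assms(2)) blast
qed

lemma evaluates_atI:
  assumes "quotient_form f p" "\<exists>u. p (u(k := a)) \<noteq> 0" "k \<in> {1..n}"
    and F: "generically n (\<lambda>u. F u = proj (f u))" and G: "generically n (\<lambda>u. G u = proj (f (u(k := a))))"
  shows "evaluates_at n q k a F G"
proof -
  obtain N where N: "N \<in> family_polys" "\<And>u. p u \<noteq> 0 \<Longrightarrow> f u = inverse (p u) *s N u"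
    and p: "p \<in> poly_functions n"
    using assms(1) unfolding quotient_form_def by blast
  have s: "(\<lambda>u. p (u(k := a))) \<in> poly_functions n"
  proof (rule poly_functions_subst[OF p])
    show "(\<lambda>u. (u(k := a)) i) \<in> poly_functions n" if "i \<in> {1..n}" for i
      using that by (cases "i = k") (auto intro: poly_functions.intros)
  qed
  have qv: "proj (f u) = quotient_value n q (\<lambda>u. proj (N u)) p u" if "p u \<noteq> 0" for u
    using N(2)[OF that] by (simp add: quotient_value_def proj_simps)
  have "\<exists>u. p u \<noteq> 0" using assms(2) by blast
  then have "generically n (\<lambda>u. F u = quotient_value n q (\<lambda>u. proj (N u)) p u)"
    using generically_conj[OF F generically_nonzero[OF p]] qv by (auto elim!: generically_mono)
  moreover have "generically n (\<lambda>u. G u = quotient_value n q (\<lambda>u. proj (N u)) p (u(k := a)))"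
    using generically_conj[OF G generically_nonzero[OF s assms(2)]] qv by (auto elim!: generically_mono)
  ultimately show ?thesis
    unfolding evaluates_at_def using family_polys_proj[OF N(1)] p assms(2) by blast
qed

end


lemma generically_ball:
  "finite A \<Longrightarrow> (\<And>a. a \<in> A \<Longrightarrow> generically n (P a)) \<Longrightarrow> generically n (\<lambda>u. \<forall>a\<in>A. P a u)"
proof (induction A rule: finite_induct)
  case empty
  show ?case unfolding generically_def
    by (intro bexI[of _ "\<lambda>u. 1"] poly_functions.const) auto
next
  case (insert a A)
  then have "generically n (\<lambda>u. P a u \<and> (\<forall>b\<in>A. P b u))" by (intro generically_conj) auto
  then show ?case by simp
qed

context generic_hecke
begin

section \<open>Regularity of the fusion factors under substitution\<close>

lemma bx_norm_eq: "x \<noteq> 1 \<Longrightarrow> bx_norm x = (x - Q 1) * (x - Q (- 1)) / (x - 1)\<^sup>2"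
  unfolding bx_norm_def by (rule baxter_norm_eq)

lemma bx_norm_nonzero:
  assumes "y \<noteq> 0" "x \<noteq> y" "x \<noteq> Q 1 * y" "x \<noteq> Q (- 1) * y"
  shows "bx_norm (x / y) \<noteq> 0"
proof -
  have "x / y \<noteq> 1" "x / y \<noteq> Q 1" "x / y \<noteq> Q (- 1)" using assms by (auto simp: field_simps)
  then show ?thesis by (simp add: bx_norm_eq)
qed

text \<open>Clearing the inner fractions makes the denominators polynomial in x and y: the norm
  contributes the lines x = q^2 y and x = q^(-2) y, and the scalar inside contributes x = y.\<close>

lemma bx_inv_quotient:
  assumes "y \<noteq> 0" "x \<noteq> y"
  shows "bx_inv i (x / y) = (((x - y) * (x - y)) / ((x - Q 1 * y) * (x - Q (- 1) * y))) *s
    (family_gen n q i + (- (qd * x) / (x - y)) *s 1)"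
proof -
  have xy: "x - y \<noteq> 0" "x / y \<noteq> 1" "x / y - 1 = (x - y) / y"
    using assms by (auto simp: field_simps)
  have "bx_norm (x / y) = ((x / y - Q 1) * (x / y - Q (- 1))) / ((x - y) / y)\<^sup>2"
    using bx_norm_eq[OF xy(2)] xy(3) by simp
  also have "\<dots> = ((x - Q 1 * y) * (x - Q (- 1) * y)) / ((x - y) * (x - y))"
  proof -
    have "x / y - Q 1 = (x - Q 1 * y) / y" "x / y - Q (- 1) = (x - Q (- 1) * y) / y"
      using assms(1) by (simp_all add: diff_divide_distrib)
    then show ?thesis using assms(1) by (simp add: power2_eq_square)
  qed
  finally have norm: "inverse (bx_norm (x / y)) =
      ((x - y) * (x - y)) / ((x - Q 1 * y) * (x - Q (- 1) * y))" by simp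
  have "a + a / (x / y - 1) = a * x / (x - y)" for a
  proof -
    have "a + a * y / (x - y) = (a * (x - y) + a * y) / (x - y)"
      using xy(1) by (simp only: add_divide_distrib) simp
    then show ?thesis using xy(3) by (simp add: right_diff_distrib)
  qed
  then show ?thesis unfolding bx_inv_def norm by (simp only: minus_divide_left[symmetric] scale_minus_left) simp
qed

text \<open>The denominator does not vanish identically after the substitution s. This is the
  condition under which rational functions may be substituted into, and it is stable under sums and
  products since polynomial functions form a domain.\<close>

definition regular :: "((nat \<Rightarrow> complex) \<Rightarrow> nat \<Rightarrow> complex) \<Rightarrow> ((nat \<Rightarrow> complex) \<Rightarrow> hecke_family) \<Rightarrow> bool" where
  "regular s f \<longleftrightarrow> (\<exists>p. quotient_form f p \<and> (\<exists>u. p (s u) \<noteq> 0))"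

definition substitution :: "((nat \<Rightarrow> complex) \<Rightarrow> nat \<Rightarrow> complex) \<Rightarrow> bool" where
  "substitution s \<longleftrightarrow> (\<forall>i\<in>{1..n}. (\<lambda>u. s u i) \<in> poly_functions n)"

lemma substitution_poly:
  "substitution s \<Longrightarrow> p \<in> poly_functions n \<Longrightarrow> (\<lambda>u. p (s u)) \<in> poly_functions n"
  by (rule poly_functions_subst) (auto simp: substitution_def)

lemma substitution_domain:
  assumes "substitution s" "p \<in> poly_functions n" "r \<in> poly_functions n"
    and "\<exists>u. p (s u) \<noteq> 0" "\<exists>u. r (s u) \<noteq> 0"
  shows "\<exists>u. p (s u) * r (s u) \<noteq> 0"
  by (rule poly_functions_domain[OF substitution_poly[OF assms(1,2)] substitution_poly[OF assms(1,3)] assms(4,5)])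

lemma regular_const: "regular s (\<lambda>u. h)"
  unfolding regular_def using quotient_form_const by (intro exI[of _ "\<lambda>u. 1"]) auto

lemma regular_scalar:
  "a \<in> poly_functions n \<Longrightarrow> b \<in> poly_functions n \<Longrightarrow> \<exists>u. b (s u) \<noteq> 0 \<Longrightarrow> regular s (\<lambda>u. (a u / b u) *s h)"
  unfolding regular_def using quotient_form_scalar by (intro exI[of _ b]) auto

lemma quotient_form_denominator: "quotient_form f p \<Longrightarrow> p \<in> poly_functions n"
  by (simp add: quotient_form_def)

lemma regular_mult:
  assumes "substitution s" "regular s f" "regular s g"
  shows "regular s (\<lambda>u. f u * g u)"
proof -
  obtain p r where pr: "quotient_form f p" "\<exists>u. p (s u) \<noteq> 0" "quotient_form g r" "\<exists>u. r (s u) \<noteq> 0"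
    using assms unfolding regular_def by blast
  then have "\<exists>u. p (s u) * r (s u) \<noteq> 0"
    using substitution_domain assms(1) quotient_form_denominator by blast
  then show ?thesis unfolding regular_def using quotient_form_mult[OF pr(1,3)] by blast
qed

lemma regular_add:
  assumes "substitution s" "regular s f" "regular s g"
  shows "regular s (\<lambda>u. f u + g u)"
proof -
  obtain p r where pr: "quotient_form f p" "\<exists>u. p (s u) \<noteq> 0" "quotient_form g r" "\<exists>u. r (s u) \<noteq> 0"
    using assms unfolding regular_def by blast
  then have "\<exists>u. p (s u) * r (s u) \<noteq> 0"
    using substitution_domain assms(1) quotient_form_denominator by blast
  then show ?thesis unfolding regular_def using quotient_form_add[OF pr(1,3)] by blast
qed

lemma regular_cong:
  assumes "substitution s" "regular s f" "r \<in> poly_functions n" "\<exists>u. r (s u) \<noteq> 0"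
    and "\<And>u. r u \<noteq> 0 \<Longrightarrow> f u = g u"
  shows "regular s g"
proof -
  obtain p where p: "quotient_form f p" "\<exists>u. p (s u) \<noteq> 0" using assms(2) unfolding regular_def by blast
  then have "\<exists>u. p (s u) * r (s u) \<noteq> 0"
    using substitution_domain assms(1,3,4) quotient_form_denominator by blast
  then show ?thesis unfolding regular_def using quotient_form_cong[OF p(1) assms(3,5)] by blast
qed

lemma regular_sum:
  assumes "substitution s" "finite A" "\<And>a. a \<in> A \<Longrightarrow> regular s (f a)"
  shows "regular s (\<lambda>u. \<Sum>a\<in>A. f a u)"
  using assms(2,3)
  by (induction A rule: finite_induct) (simp_all add: regular_const regular_add[OF assms(1)])

lemma regular_prod_list:
  "substitution s \<Longrightarrow> (\<And>a. a \<in> set xs \<Longrightarrow> regular s (f a)) \<Longrightarrow> regular s (\<lambda>u. prod_list (map (\<lambda>a. f a u) xs))"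
  by (induction xs) (auto intro: regular_const regular_mult)

definition fusion_Y_family :: "complex \<Rightarrow> nat \<Rightarrow> (nat \<Rightarrow> complex) \<Rightarrow> hecke_family" where
  "fusion_Y_family c j u = fusion_factor c (\<lambda>k. u (Suc k)) (u j) (j - 1)"

lemma fusion_factor_prod_list: "fusion_factor c v x m =
    prod_list (map (\<lambda>i. bx i (c * v i * x)) (rev [0..<m]) @ map (\<lambda>i. bx_inv i (v i / x)) [0..<m])"
  by (induction m) (simp_all add: mult.assoc)

lemma proj_bx: "k + 1 < n \<Longrightarrow> proj (bx k x) = baxterized n q (Suc k) x"
  by (simp add: bx_def baxterized_def proj_simps proj_gen monoid.r_one[OF ring.is_monoid[OF ring_hecke]])

lemma proj_bx_inv:
  assumes "k + 1 < n" "bx_norm x \<noteq> 0"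
  shows "proj (bx_inv k x) = inv\<^bsub>hecke n q\<^esub> (baxterized n q (Suc k) x)"
  unfolding proj_bx[OF assms(1), symmetric]
  by (rule monoid.inv_char[symmetric, OF ring.is_monoid[OF ring_hecke]])
     (simp_all add: bx_inv[OF assms] proj_simps(2,4)[symmetric])

lemma proj_fusion_Y:
  assumes "j \<in> {1..n}" "\<And>i. i \<in> {1..<j} \<Longrightarrow> bx_norm (u i / u j) \<noteq> 0"
  shows "proj (fusion_Y_family c j u) = fusion_Y n q c j u"
proof -
  obtain m where j: "j = Suc m" using assms(1) by (cases j) auto
  have 1: "map (\<lambda>i. baxterized n q i (c * u i * u j)) [1..<j] = map (\<lambda>i. proj (bx i (c * u (Suc i) * u j))) [0..<m]"
    using assms(1) j by (intro nth_equalityI) (auto simp: proj_bx simp del: upt_Suc)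
  have 2: "map (\<lambda>i. inv\<^bsub>hecke n q\<^esub> (baxterized n q i (u i / u j))) [1..<j] =
      map (\<lambda>i. proj (bx_inv i (u (Suc i) / u j))) [0..<m]"
  proof (intro nth_equalityI)
    fix i assume "i < length (map (\<lambda>i. inv\<^bsub>hecke n q\<^esub> (baxterized n q i (u i / u j))) [1..<j])"
    then have i: "i < m" using j by (simp del: upt_Suc)
    then have "proj (bx_inv i (u (Suc i) / u j)) = inv\<^bsub>hecke n q\<^esub> (baxterized n q (Suc i) (u (Suc i) / u j))"
      using assms j by (intro proj_bx_inv) auto
    then show "map (\<lambda>i. inv\<^bsub>hecke n q\<^esub> (baxterized n q i (u i / u j))) [1..<j] ! i =
        map (\<lambda>i. proj (bx_inv i (u (Suc i) / u j))) [0..<m] ! i"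
      using i j by (simp del: upt_Suc)
  qed (use j in simp)
  have "fusion_Y n q c j u = hecke_prod n q (map proj
      (map (\<lambda>i. bx i (c * u (Suc i) * u j)) (rev [0..<m]) @ map (\<lambda>i. bx_inv i (u (Suc i) / u j)) [0..<m]))"
    unfolding fusion_Y_def 2 rev_map[symmetric] 1 by (simp add: rev_map comp_def)
  then show ?thesis
    unfolding hecke_prod_proj fusion_Y_family_def fusion_factor_prod_list using j by simp
qed

section \<open>Successive evaluation at the contents\<close>

context
  fixes c :: complex and ws :: "nat list"
  assumes ws: "lattice ws" "length ws = n" and n_pos: "n \<ge> 1"
    and c: "\<And>k. k \<in> {1..n} \<Longrightarrow> c * (q_content q (tableau_of ws) k)\<^sup>2 \<noteq> 1"
begin

abbreviation cc :: "nat \<Rightarrow> complex" where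
  "cc \<equiv> q_content q (tableau_of ws)"

lemma cc_eq: "i < n \<Longrightarrow> cc (Suc i) = Q (contents ws ! i)"
  using q_content_tableau_of[OF ws(1), of i q] ws(2) by (simp add: Q_def)

lemma cc_nonzero: "i \<in> {1..n} \<Longrightarrow> cc i \<noteq> 0"
  by (cases i) (auto simp: cc_eq)

definition prefactor :: "nat \<Rightarrow> complex \<Rightarrow> complex" where
  "prefactor j x = (x - cc j) / (c * x * cc j - 1) * ((c * x - 1) / (x - 1))"

definition specialize :: "nat \<Rightarrow> (nat \<Rightarrow> complex) \<Rightarrow> nat \<Rightarrow> complex" where
  "specialize k u i = (if i \<in> {1..k} then cc i else u i)"

definition tail :: "nat \<Rightarrow> (nat \<Rightarrow> complex) \<Rightarrow> hecke_family" where
  "tail k u = prod_list (map (\<lambda>j. prefactor j (u j) *s fusion_Y_family c j u) [Suc k..<Suc n])"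

lemma substitution_specialize: "substitution (specialize k)"
  unfolding substitution_def specialize_def
proof
  fix i assume "i \<in> {1..n}"
  then show "(\<lambda>u. if i \<in> {1..k} then cc i else u i) \<in> poly_functions n"
    by (cases "i \<in> {1..k}") (simp_all add: poly_functions.intros)
qed

lemma substitution_single: "substitution (\<lambda>u. u(k := x))"
  unfolding substitution_def
proof
  fix i assume "i \<in> {1..n}"
  then show "(\<lambda>u. (u(k := x)) i) \<in> poly_functions n"
    by (cases "i = k") (simp_all add: poly_functions.intros)
qed

text \<open>The variable u_j is still free, whereas each earlier variable is either free or a
  nonzero content. Hence no denominator vanishes identically after the first k variables are
  fixed.\<close>

lemma regular_fusion_factor:
  assumes "j \<in> {Suc k..n}" "m < j"
  shows "regular (specialize k) (\<lambda>u. fusion_factor c (\<lambda>i. u (Suc i)) (u j) m)"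
  using assms(2)
proof (induction m)
  case 0
  show ?case by (simp add: regular_const)
next
  case (Suc m)
  \<comment> \<open>At the point with u_j = 0 and all other free variables 1, the denominators
    reduce to -1 or to powers of the nonzero value of u_{m+1}.\<close>
  let ?s = "specialize k" and ?a = "Suc m" and ?w = "(\<lambda>_. 1 :: complex)(j := 0)"
  have ja: "j \<in> {1..n}" "?a \<in> {1..n}" using assms Suc by auto
  have w: "?s ?w j = 0" "?s ?w ?a \<noteq> 0"
    using assms(1) Suc cc_nonzero[OF ja(2)] by (auto simp: specialize_def)
  note S = substitution_specialize[of k]
  have 1: "regular ?s (\<lambda>u. bx m (c * u ?a * u j))"
    unfolding bx_def
    using w ja by (intro regular_add regular_const regular_scalar S poly_functions_intros exI[of _ ?w]) auto
  have 2: "regular ?s (\<lambda>u. bx_inv m (u ?a / u j))"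
  proof (rule regular_cong[OF S])
    let ?f = "\<lambda>u. ((((u ?a - u j) * (u ?a - u j)) / ((u ?a - Q 1 * u j) * (u ?a - Q (- 1) * u j))) *s 1)
      * (family_gen n q m + (- (qd * u ?a) / (u ?a - u j)) *s 1)"
    have "(\<lambda>u. - (qd * u ?a)) \<in> poly_functions n"
      using poly_functions.mult[OF poly_functions.const[of "- qd"] poly_functions.var[OF ja(2)]]
      by (simp only: mult_minus_left)
    then show "regular ?s ?f"
      using w ja
      by (intro regular_mult regular_add regular_const regular_scalar S poly_functions_intros exI[of _ ?w]) auto
    show "(\<lambda>u. u j * (u ?a - u j)) \<in> poly_functions n" using ja by (intro poly_functions_intros)
    \<comment> \<open>The factor u_j does vanish at the previous witness. Each factor gets its own
      witness, and the domain property combines them.\<close>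
    show "\<exists>u. ?s u j * (?s u ?a - ?s u j) \<noteq> 0"
    proof (rule substitution_domain[OF S, where p = "\<lambda>u. u j" and r = "\<lambda>u. u ?a - u j"])
      show "(\<lambda>u. u j) \<in> poly_functions n" using ja(1) by (rule poly_functions.var)
      show "(\<lambda>u. u ?a - u j) \<in> poly_functions n" by (intro poly_functions_intros ja)
      show "\<exists>u. ?s u j \<noteq> 0" using assms(1) by (intro exI[of _ "\<lambda>_. 1"]) (simp add: specialize_def)
      show "\<exists>u. ?s u ?a - ?s u j \<noteq> 0" using w by (intro exI[of _ ?w]) simp
    qed
    show "?f u = bx_inv m (u ?a / u j)" if "u j * (u ?a - u j) \<noteq> 0" for u
      using that bx_inv_quotient[of "u j" "u ?a" m] by (simp add: scale_mult)
  qed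
  have "regular ?s (\<lambda>u. bx m (c * u ?a * u j) * fusion_factor c (\<lambda>i. u (Suc i)) (u j) m * bx_inv m (u ?a / u j))"
    using Suc by (intro regular_mult S 1 2) auto
  then show ?case by simp
qed

lemma regular_tail: "regular (specialize k) (tail k)"
proof -
  note S = substitution_specialize[of k]
  have "regular (specialize k) (\<lambda>u. prefactor j (u j) *s fusion_Y_family c j u)" if "j \<in> set [Suc k..<Suc n]" for j
  proof -
    have j: "j \<in> {Suc k..n}" "j \<in> {1..n}" using that by auto
    have "regular (specialize k) (\<lambda>u. (((u j - cc j) * (c * u j - 1)) / ((c * u j * cc j - 1) * (u j - 1))) *s 1)"
      using j by (intro regular_scalar poly_functions_intros exI[of _ "\<lambda>_. 0"]) (auto simp: specialize_def)
    then have "regular (specialize k) (\<lambda>u. ((((u j - cc j) * (c * u j - 1)) / ((c * u j * cc j - 1) * (u j - 1))) *s 1)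
        * fusion_Y_family c j u)"
      unfolding fusion_Y_family_def using j by (intro regular_mult S regular_fusion_factor) auto
    then show ?thesis by (simp add: prefactor_def scale_mult)
  qed
  then show ?thesis unfolding tail_def by (intro regular_prod_list S)
qed

lemma tail_Suc:
  assumes "k < n"
  shows "tail k u = (prefactor (Suc k) (u (Suc k)) *s fusion_Y_family c (Suc k) u) * tail (Suc k) u"
proof -
  have "[Suc k..<Suc n] = Suc k # [Suc (Suc k)..<Suc n]" using assms by (simp add: upt_conv_Cons)
  then show ?thesis by (simp add: tail_def del: upt_Suc)
qed

lemma prod_list_scale: "prod_list (map (\<lambda>j. a j *s y j) js) = prod_list (map a js) *s prod_list (map y js)"
  by (induction js) (simp_all add: scale_mult mult_scale mult.commute)

text \<open>Off the zeros of the norms, the ring inverses of the Baxterized generators are given by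
  \<open>bx_inv\<close>. It remains to distribute the scalar prefactors over the factors
  Y_j.\<close>

lemma fusion_Psi_eq_tail: "generically n (\<lambda>u. fusion_Psi n q c (tableau_of ws) u = proj (tail 0 u))"
proof -
  let ?A = "{(i, j). i \<in> {1..n} \<and> j \<in> {1..n} \<and> i < j}"
  have fin: "finite ?A" by (rule finite_subset[of _ "{1..n} \<times> {1..n}"]) auto
  have "generically n (\<lambda>u. \<forall>ij\<in>?A. bx_norm (u (fst ij) / u (snd ij)) \<noteq> 0)"
  proof (rule generically_ball[OF fin])
    fix ij assume "ij \<in> ?A"
    then obtain i j where ij: "ij = (i, j)" "i \<in> {1..n}" "j \<in> {1..n}" "i < j" by blast
    let ?p = "\<lambda>u. u j * ((u i - u j) * ((u i - Q 1 * u j) * (u i - Q (- 1) * u j)))"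
    have w: "\<exists>u. u i - z * u j \<noteq> 0" for z :: complex
      using ij by (intro exI[of _ "(\<lambda>_. 1)(j := 0)"]) simp
    have "generically n (\<lambda>u. ?p u \<noteq> 0)"
    proof (rule generically_nonzero)
      show "\<exists>u. ?p u \<noteq> 0"
        using ij w[of 1] w by (intro poly_functions_domain poly_functions_intros) (auto intro: exI[of _ "\<lambda>_. 1"])
    qed (intro poly_functions_intros ij)
    then show "generically n (\<lambda>u. bx_norm (u (fst ij) / u (snd ij)) \<noteq> 0)"
      by (rule generically_mono) (simp add: ij bx_norm_nonzero)
  qed
  then show ?thesis
  proof (rule generically_mono)
    fix u :: "nat \<Rightarrow> complex" assume u: "\<forall>ij\<in>?A. bx_norm (u (fst ij) / u (snd ij)) \<noteq> 0"
    have "map (\<lambda>j. fusion_Y n q c j u) [1..<n + 1] = map proj (map (\<lambda>j. fusion_Y_family c j u) [1..<n + 1])"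
      using u by (auto simp: comp_def intro!: proj_fusion_Y[symmetric] simp del: upt_Suc)
    then have "fusion_Psi n q c (tableau_of ws) u = proj ((\<Prod>k = 1..n. prefactor k (u k)) *s
        prod_list (map (\<lambda>j. fusion_Y_family c j u) [1..<n + 1]))"
      by (simp only: fusion_Psi_def hecke_prod_proj proj_simps prefactor_def)
    also have "(\<Prod>k = 1..n. prefactor k (u k)) = prod_list (map (\<lambda>j. prefactor j (u j)) [1..<n + 1])"
      by (simp add: prod.distinct_set_conv_list[symmetric] atLeastLessThanSuc_atLeastAtMost del: upt_Suc)
    finally show "fusion_Psi n q c (tableau_of ws) u = proj (tail 0 u)"
      by (simp add: tail_def prod_list_scale del: upt_Suc)
  qed
qed

text \<open>The product of \<open>E (take k ws)\<close> with the factor number k + 1 and its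
  prefactor, split according to the possible next boxes. In the summand of the box of the tableau
  numerator and denominator cancel, which is recorded by the coefficient 1; the other coefficients
  vanish at x = \<open>cc (Suc k)\<close>.\<close>

definition head :: "nat \<Rightarrow> complex \<Rightarrow> hecke_family" where
  "head k x = (\<Sum>a\<in>addables (take k ws).
     (if a = ws ! k then 1
      else ((x - cc (Suc k)) * (c * x * Q (box_content (shape (take k ws)) a) - 1)) /
        ((c * x * cc (Suc k) - 1) * (x - Q (box_content (shape (take k ws)) a))))
     *s E (take k ws @ [a]))"

lemma addables_take:
  assumes "k < n"
  shows "lattice (take k ws)" "length (take k ws) = k" "ws ! k \<in> addables (take k ws)"
    and "cc (Suc k) = Q (box_content (shape (take k ws)) (ws ! k))"
  using assms ws lattice_take lattice_nth cc_eq nth_contents[of k ws] by auto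

lemma cc_neq_exit:
  assumes "k < n" "a \<in> addables (take k ws)" "a \<noteq> ws ! k"
  shows "cc (Suc k) \<noteq> Q (box_content (shape (take k ws)) a)"
  using inj_onD[OF Q_content_inj, of "take k ws" a "ws ! k"] addables_take[OF assms(1)] assms by auto

text \<open>The hypothesis on c keeps c x c_{k+1} - 1 nonzero at x = c_{k+1}. The remaining
  denominators are nonzero there because contents of different addable boxes differ.\<close>

lemma regular_head:
  assumes "k < n"
  shows "regular (\<lambda>u. u(Suc k := cc (Suc k))) (\<lambda>u. head k (u (Suc k)))"
  unfolding head_def
proof (rule regular_sum[OF substitution_single])
  show "finite (addables (take k ws))" using addables_take[OF assms] by simp
  fix a assume a: "a \<in> addables (take k ws)"
  have k: "Suc k \<in> {1..n}" using assms by simp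
  show "regular (\<lambda>u. u(Suc k := cc (Suc k))) (\<lambda>u. (if a = ws ! k then 1
      else ((u (Suc k) - cc (Suc k)) * (c * u (Suc k) * Q (box_content (shape (take k ws)) a) - 1)) /
        ((c * u (Suc k) * cc (Suc k) - 1) * (u (Suc k) - Q (box_content (shape (take k ws)) a))))
     *s E (take k ws @ [a]))"
  proof (cases "a = ws ! k")
    case True
    then show ?thesis by (simp add: regular_const)
  next
    case False
    have "c * cc (Suc k) * cc (Suc k) \<noteq> 1" using c[OF k] by (simp add: power2_eq_square mult.assoc)
    then show ?thesis
      using False cc_neq_exit[OF assms a False] k
      by (simp only: if_False) (intro regular_scalar poly_functions_intros; simp)
  qed
qed

lemma head_cc:
  assumes "k < n"
  shows "head k (cc (Suc k)) = E (take (Suc k) ws)"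
proof -
  have "head k (cc (Suc k)) = (\<Sum>a\<in>addables (take k ws). if a = ws ! k then E (take k ws @ [ws ! k]) else 0)"
    unfolding head_def by (intro sum.cong) auto
  also have "\<dots> = E (take k ws @ [ws ! k])" using addables_take[OF assms] by (simp add: sum.delta)
  finally show ?thesis using assms ws(2) by (simp add: take_Suc_conv_app_nth)
qed

text \<open>The formula of \<open>E_fusion_factor\<close> is multiplied by the prefactor, whose
  second fraction cancels (x - 1) / (c x - 1). As the earlier variables are already constants, only
  u_{k+1} has to avoid finitely many values.\<close>

lemma E_tail_head:
  assumes k: "k < n"
  shows "generically n (\<lambda>u. E (take k ws) * tail k (specialize k u) =
    head k (u (Suc k)) * tail (Suc k) (specialize k u))"
proof -
  define us where "us = take k ws"
  define b where "b a = Q (box_content (shape us) a)" for a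
  \<comment> \<open>The values at which some factor or resolvent of a prefix is singular. If c = 0,
    the inverses are 0 by convention, and inequalities such as c x \<noteq> 1 hold for all
    x.\<close>
  define B where "B = {0, 1, inverse c, inverse (c * cc (Suc k))} \<union> (\<Union>i\<in>{..k}. exits (take i us)) \<union>
    (\<Union>i\<in>{..<k}. {cc (Suc i), Q 1 * cc (Suc i), Q (- 1) * cc (Suc i), inverse (c * cc (Suc i))})"
  note us = addables_take[OF k, folded us_def]
  have fin: "finite B" unfolding B_def using us lattice_take by (auto intro!: finite_exits)
  have "generically n (\<lambda>u. u (Suc k) \<notin> B)" using k by (intro generically_avoid fin) simp
  then show ?thesis
  proof (rule generically_mono)
    fix u :: "nat \<Rightarrow> complex" assume uB: "u (Suc k) \<notin> B"
    define x s where "x = u (Suc k)" and "s = specialize k u"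
    have x: "x \<noteq> 0" "x \<noteq> 1" "c * x \<noteq> 1" "c * x * cc (Suc k) \<noteq> 1"
      using uB inverse_unique[of c x] inverse_unique[of "c * cc (Suc k)" x] by (auto simp: B_def x_def ac_simps)
    have sx: "s (Suc k) = x" by (simp add: s_def x_def specialize_def)
    have si: "s (Suc i) = cc (Suc i)" if "i < k" for i using that by (simp add: s_def specialize_def)
    have "contents us ! i = contents ws ! i" if "i < k" for i
      using that nth_contents[of i us] nth_contents[of i ws] us ws k by (simp add: us_def min_absorb1)
    then have v: "s (Suc i) = Q (contents us ! i)" if "i < length us" for i
      using that si cc_eq us k by simp
    have "E us * fusion_factor c (\<lambda>i. s (Suc i)) x (length us) =
        ((x - 1) / (c * x - 1)) *s (((c * x) *s J (length us) - 1) * resolvent us x)"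
    proof (rule E_fusion_factor)
      fix i assume "i < length us"
      then have i: "i < k" using us by simp
      then have ci: "cc (Suc i) \<noteq> 0" using cc_nonzero k by simp
      have "x \<noteq> cc (Suc i)" "x \<noteq> Q 1 * cc (Suc i)" "x \<noteq> Q (- 1) * cc (Suc i)" "x \<noteq> inverse (c * cc (Suc i))"
        using uB i by (auto simp: B_def x_def)
      moreover have "c * cc (Suc i) * x \<noteq> 1" using \<open>x \<noteq> inverse (c * cc (Suc i))\<close> inverse_unique by metis
      moreover have "cc (Suc i) \<noteq> Q 1 * x" "cc (Suc i) \<noteq> Q (- 1) * x"
        using \<open>x \<noteq> Q (- 1) * cc (Suc i)\<close> \<open>x \<noteq> Q 1 * cc (Suc i)\<close> Q_minus[of 1] Q_nonzero[of 1]
        by (auto simp: mult.assoc[symmetric])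
      ultimately show "c * s (Suc i) * x \<noteq> 1 \<and> bx_norm (s (Suc i) / x) \<noteq> 0 \<and> s (Suc i) \<noteq> x"
        using si[OF i] x bx_norm_nonzero[of x "cc (Suc i)"] by auto
    next
      fix i assume "i \<le> length us"
      then show "x \<notin> exits (take i us)" using uB us by (auto simp: B_def x_def)
    qed (use v x us k in auto)
    then have Y: "E us * fusion_Y_family c (Suc k) s =
        ((x - 1) / (c * x - 1)) *s (((c * x) *s J k - 1) * resolvent us x)"
      by (simp add: fusion_Y_family_def sx us)
    have "E us * (prefactor (Suc k) x *s fusion_Y_family c (Suc k) s) = head k x"
    proof -
      have p: "prefactor (Suc k) x * ((x - 1) / (c * x - 1)) = (x - cc (Suc k)) / (c * x * cc (Suc k) - 1)"
        using x by (simp add: prefactor_def)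
      have r: "((c * x) *s J k - 1) * resolvent us x =
          (\<Sum>a\<in>addables us. ((c * x * b a - 1) / (x - b a)) *s E (us @ [a]))"
        unfolding resolvent_def sum_distrib_left
      proof (rule sum.cong[OF refl])
        fix a assume "a \<in> addables us"
        then have "J k * E (us @ [a]) = b a *s E (us @ [a])"
          using E_snoc_J[of us a] us k by (simp add: b_def)
        then show "((c * x) *s J k - 1) * inverse (x - Q (box_content (shape us) a)) *s E (us @ [a]) =
            ((c * x * b a - 1) / (x - b a)) *s E (us @ [a])"
          by (simp add: left_diff_distrib scale_mult mult_scale b_def[symmetric] divide_inverse
              scale_left_diff_distrib scale_right_diff_distrib mult.commute[of "inverse _"])
      qed
      have "E us * (prefactor (Suc k) x *s fusion_Y_family c (Suc k) s) =
          ((x - cc (Suc k)) / (c * x * cc (Suc k) - 1)) *s (\<Sum>a\<in>addables us. ((c * x * b a - 1) / (x - b a)) *s E (us @ [a]))"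
        unfolding mult_scale Y r scale_scale p ..
      also have "\<dots> = head k x"
        unfolding head_def scale_sum_right us_def[symmetric] b_def[symmetric]
      proof (rule sum.cong[OF refl])
        fix a assume a: "a \<in> addables us"
        have "b a \<in> exits us" using a by (auto simp: exits_def b_def)
        moreover have "exits (take k us) \<subseteq> B" unfolding B_def by blast
        ultimately have "x \<noteq> b a" using uB us(2) by (auto simp: x_def)
        then show "((x - cc (Suc k)) / (c * x * cc (Suc k) - 1)) *s ((c * x * b a - 1) / (x - b a)) *s E (us @ [a]) =
            (if a = ws ! k then 1
             else ((x - cc (Suc k)) * (c * x * b a - 1)) / ((c * x * cc (Suc k) - 1) * (x - b a))) *s E (us @ [a])"
          using us(4) x by (auto simp: b_def)
      qed
      finally show ?thesis .
    qed
    then show "E (take k ws) * tail k (specialize k u) = head k (u (Suc k)) * tail (Suc k) (specialize k u)"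
      unfolding tail_Suc[OF k] us_def[symmetric] s_def[symmetric] sx x_def[symmetric]
      by (simp only: mult.assoc[symmetric])
  qed
qed

text \<open>After k evaluations the function is \<open>E (take k ws)\<close> times the remaining
  factors with the first k variables fixed. Rewriting the next factor by \<open>head\<close>
  exhibits a quotient whose denominator survives u_{k+1} = c_{k+1}, and there \<open>head\<close>
  becomes the next idempotent. Generic equality is enough at each stage, but the last function must
  literally be constant, which holds since no factor is left.\<close>

theorem consecutive_evaluation_fusion_Psi:
  "consecutive_evaluation n q cc (fusion_Psi n q c (tableau_of ws)) (proj (E ws))"
proof -
  define G where "G k = (if k = 0 then fusion_Psi n q c (tableau_of ws)
    else (\<lambda>u. proj (E (take k ws) * tail k (specialize k u))))" for k
  have G: "generically n (\<lambda>u. G k u = proj (E (take k ws) * tail k (specialize k u)))" for k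
  proof (cases "k = 0")
    case True
    moreover have "specialize 0 u = u" for u by (simp add: specialize_def fun_eq_iff)
    ultimately show ?thesis using fusion_Psi_eq_tail by (simp add: G_def)
  next
    case False
    then show ?thesis unfolding generically_def
      by (intro bexI[of _ "\<lambda>u. 1"] poly_functions.const) (auto simp: G_def)
  qed
  have step: "evaluates_at n q (Suc k) (cc (Suc k)) (G k) (G (Suc k))" if k: "k < n" for k
  proof -
    obtain p1 where p1: "quotient_form (\<lambda>u. head k (u (Suc k))) p1" "\<exists>u. p1 (u(Suc k := cc (Suc k))) \<noteq> 0"
      using regular_head[OF k] unfolding regular_def by blast
    obtain p2 where p2: "quotient_form (tail (Suc k)) p2" "\<exists>u. p2 (specialize (Suc k) u) \<noteq> 0"
      using regular_tail[of "Suc k"] unfolding regular_def by blast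
    let ?p2 = "\<lambda>u. p2 (specialize k u)"
    have sp: "specialize k (u(Suc k := cc (Suc k))) = specialize (Suc k) u" for u
      by (auto simp: specialize_def fun_eq_iff)
    have q2: "quotient_form (\<lambda>u. tail (Suc k) (specialize k u)) ?p2"
      by (rule quotient_form_subst[OF p2(1)]) (use substitution_specialize[of k] in \<open>auto simp: substitution_def\<close>)
    have "\<exists>u. p1 (u(Suc k := cc (Suc k))) * ?p2 (u(Suc k := cc (Suc k))) \<noteq> 0"
    proof (rule substitution_domain[OF substitution_single, where p = p1 and r = ?p2])
      show "p1 \<in> poly_functions n" "?p2 \<in> poly_functions n"
        using p1(1) q2 quotient_form_denominator by blast+
      show "\<exists>u. p1 (u(Suc k := cc (Suc k))) \<noteq> 0" by (rule p1(2))
      show "\<exists>u. p2 (specialize k (u(Suc k := cc (Suc k)))) \<noteq> 0" unfolding sp by (rule p2(2))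
    qed
    then show ?thesis
    proof (rule evaluates_atI[OF quotient_form_mult[OF p1(1) q2]])
      show "Suc k \<in> {1..n}" using k by simp
      show "generically n (\<lambda>u. G k u = proj (head k (u (Suc k)) * tail (Suc k) (specialize k u)))"
        using generically_conj[OF G[of k] E_tail_head[OF k]] by (rule generically_mono) simp
      show "generically n (\<lambda>u. G (Suc k) u = proj (head k ((u(Suc k := cc (Suc k))) (Suc k)) *
          tail (Suc k) (specialize k (u(Suc k := cc (Suc k))))))"
        unfolding sp using G[of "Suc k"] by (simp add: head_cc[OF k])
    qed
  qed
  have "tail n u = 1" for u by (simp add: tail_def)
  then have "G n = (\<lambda>u. proj (E ws))" using n_pos ws(2) by (simp add: G_def)
  moreover have "evaluates_at n q k (cc k) (G (k - 1)) (G k)" if "k \<in> {1..n}" for k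
    using step[of "k - 1"] that by auto
  ultimately show ?thesis unfolding consecutive_evaluation_def by (intro exI[of _ G]) (auto simp: G_def)
qed

end

end

theorem mainTheorem3:
  fixes n :: nat and q c :: complex and U :: tableau
  assumes "n \<ge> 1"
    and "generic_parameter n q"
    and "standard_tableau n U"
    and "\<forall>k \<in> {1..n}. c * (q_content q U k)\<^sup>2 \<noteq> 1"
  shows "consecutive_evaluation n q (q_content q U) (fusion_Psi n q c U) (tableau_idempotent n q U)"
proof -
  interpret generic_hecke n q by standard (rule assms(2))
  obtain ws where ws: "lattice ws" "length ws = n" "U = tableau_of ws"
    using standard_tableau_word[OF assms(3,1)] by blast
  show ?thesis
    using consecutive_evaluation_fusion_Psi[of ws c] tableau_idempotent_E[of ws] ws assms(1,4) by simp
qed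

end
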